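(* Let $A\in\mathbb{R}_+^{n\times m}$ be a non-negative matrix and let $p\in\mathbb{R}^n_{++}$, $q\in\mathbb{R}^m_{++}$ with $\sum_ip_i=\sum_jq_j$. Suppose $(A,p,q)$ satisfies (Strong Existence) and $A$ satisfies (Uniqueness). Let $\hat A=D^1AD^0$ ($D^0,D^1$ positive diagonal) be the unique scaled matrix with $\hat A\mathbf{1}_m=p$, $\hat A^T\mathbf{1}_n=q$. Let $A^{(t)}$ be the scaled matrix after $t$ iterations of Sinkhorn's algorithm and $r^{(t)}=A^{(t)}\mathbf{1}_m$. Then $$\lim_{t\to\infty}\frac{\|r^{(t+1)}/\sqrt p-\sqrt p\|_2}{\|r^{(t)}/\sqrt p-\sqrt p\|_2}=\lambda_\infty,$$ where $$\lambda_\infty:=\lambda_2(\tilde A\tilde A^T)=\lambda_2(\tilde A^T\tilde A),\qquad \tilde A:=\mathcal{D}(1/\sqrt p)\cdot\hat A\cdot\mathcal{D}(1/\sqrt q),$$ and $\lambda_2(\cdot)$ denotes the second largest eigenvalue.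
   Context: (Strong Existence): there exists a non-negative $A'\in\mathbb{R}_+^{n\times m}$ with the same zero pattern as $A$ ($A'_{ij}=0\iff A_{ij}=0$) and with row sums $p$ and column sums $q$. It is well known that this is equivalent to the existence of positive diagonal $D^0,D^1$ such that $D^1AD^0$ has row sums $p$ and column sums $q$. (Uniqueness): $A$ is indecomposable, i.e. there are no permutation matrices $P,Q$ such that $PAQ$ is block diagonal (at least two blocks, possibly rectangular). Sinkhorn's algorithm: starting from $d^{0}\in\mathbb{R}^m_{++}$, each iteration performs $d^1\leftarrow p/(Ad^0)$ and then $d^0\leftarrow q/(A^Td^1)$. With $d^{0(t)},d^{1(t)}$ the vectors after $t$ iterations, $A^{(t)}=\mathcal{D}(d^{1(t)})A\mathcal{D}(d^{0(t)})$, so that $A^{(t)}$ always has column sums $q$. Divisions and square roots of vectors are entrywise, $\mathcal{D}(x)$ is the diagonal matrix with diagonal $x$, $\mathbf{1}_k$ is the all-ones vector in $\mathbb{R}^k$, and eigenvalues are counted with multiplicity ($n,m\ge2$).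
   Formalization: The limit is proved for almost every positive starting vector d^0 (it fails for some, e.g. the exact scaling); for every d^0 only that λ_∞ is an asymptotic upper bound of the ratios is proved; when λ_∞=0 the quotient 0/0 is read as 0. *)

theory Defs
  imports
    "HOL-Analysis.Analysis"
    "HOL-Computational_Algebra.Polynomial"
begin

definition vdiv :: "real ^ 'k \<Rightarrow> real ^ 'k \<Rightarrow> real ^ 'k" where
  "vdiv x y = (\<chi> i. x $ i / y $ i)"

definition vsqrt :: "real ^ 'k \<Rightarrow> real ^ 'k" where
  "vsqrt x = (\<chi> i. sqrt (x $ i))"

definition diag_mat :: "real ^ 'k \<Rightarrow> real ^ 'k ^ 'k" where
  "diag_mat x = (\<chi> i j. if i = j then x $ i else 0)"

(* The library order on vectors makes "0 < x" mean "0 \<le> x and x \<noteq> 0", which is weaker. *)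
definition pos_vec :: "real ^ 'k \<Rightarrow> bool" where
  "pos_vec x \<longleftrightarrow> (\<forall>i. 0 < x $ i)"

definition nonneg_mat :: "real ^ 'm ^ 'n \<Rightarrow> bool" where
  "nonneg_mat A \<longleftrightarrow> (\<forall>i j. 0 \<le> A $ i $ j)"

(* The unit of the componentwise product, 1, is the all-ones vector. *)
definition has_marginals :: "real ^ 'm ^ 'n \<Rightarrow> real ^ 'n \<Rightarrow> real ^ 'm \<Rightarrow> bool" where
  "has_marginals A p q \<longleftrightarrow> A *v 1 = p \<and> transpose A *v 1 = q"

definition strong_existence :: "real ^ 'm ^ 'n \<Rightarrow> real ^ 'n \<Rightarrow> real ^ 'm \<Rightarrow> bool" where
  "strong_existence A p q \<longleftrightarrow>
     (\<exists>A'. nonneg_mat A' \<and> (\<forall>i j. A' $ i $ j = 0 \<longleftrightarrow> A $ i $ j = 0) \<and> has_marginals A' p q)"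

definition permutation_matrix :: "real ^ 'k ^ 'k \<Rightarrow> bool" where
  "permutation_matrix P \<longleftrightarrow>
     (\<exists>\<pi>. \<pi> permutes UNIV \<and> P = (\<chi> i j. if j = \<pi> i then 1 else 0))"

(* Row i lies in the block number f i and column j in the block number g j. By monotonicity
   every block occupies consecutive rows and consecutive columns, in the order of the index types;
   the range conditions say that there are k blocks, each with at least one row and one column. *)
definition block_diagonal :: "real ^ 'm::{finite,linorder} ^ 'n::{finite,linorder} \<Rightarrow> bool" where
  "block_diagonal B \<longleftrightarrow>
     (\<exists>(k::nat) (f :: 'n \<Rightarrow> nat) (g :: 'm \<Rightarrow> nat).
        2 \<le> k \<and> mono f \<and> mono g \<and> range f = {..<k} \<and> range g = {..<k} \<and>
        (\<forall>i j. f i \<noteq> g j \<longrightarrow> B $ i $ j = 0))"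

definition indecomposable :: "real ^ 'm::{finite,linorder} ^ 'n::{finite,linorder} \<Rightarrow> bool" where
  "indecomposable A \<longleftrightarrow>
     \<not> (\<exists>P Q. permutation_matrix P \<and> permutation_matrix Q \<and> block_diagonal (P ** A ** Q))"

definition charpoly :: "real ^ 'k ^ 'k \<Rightarrow> real poly" where
  "charpoly M = det (\<chi> i j. (if i = j then [:0, 1:] else 0) - [:M $ i $ j:])"

(* Real eigenvalues, with algebraic multiplicity, in decreasing order. *)
definition eigenvalues :: "real ^ 'k ^ 'k \<Rightarrow> real list" where
  "eigenvalues M = rev (sorted_list_of_multiset (proots (charpoly M)))"

(* List positions start at 0. Meaningful if M has at least two real eigenvalues, in particular
   if M is symmetric of size at least 2. *)
definition second_eigenvalue :: "real ^ 'k ^ 'k \<Rightarrow> real" where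
  "second_eigenvalue M = eigenvalues M ! 1"

primrec sinkhorn_d0 ::
  "real ^ 'm ^ 'n \<Rightarrow> real ^ 'n \<Rightarrow> real ^ 'm \<Rightarrow> real ^ 'm \<Rightarrow> nat \<Rightarrow> real ^ 'm" where
  "sinkhorn_d0 A p q d 0 = d"
| "sinkhorn_d0 A p q d (Suc t) =
     vdiv q (transpose A *v vdiv p (A *v sinkhorn_d0 A p q d t))"

(* The algorithm computes no row scaling before the first iteration; the value at t = 0 is a
   placeholder that does not affect any limit. *)
definition sinkhorn_d1 ::
  "real ^ 'm ^ 'n \<Rightarrow> real ^ 'n \<Rightarrow> real ^ 'm \<Rightarrow> real ^ 'm \<Rightarrow> nat \<Rightarrow> real ^ 'n" where
  "sinkhorn_d1 A p q d t = (case t of 0 \<Rightarrow> 1 | Suc s \<Rightarrow> vdiv p (A *v sinkhorn_d0 A p q d s))"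

definition sinkhorn_matrix ::
  "real ^ 'm ^ 'n \<Rightarrow> real ^ 'n \<Rightarrow> real ^ 'm \<Rightarrow> real ^ 'm \<Rightarrow> nat \<Rightarrow> real ^ 'm ^ 'n" where
  "sinkhorn_matrix A p q d t =
     diag_mat (sinkhorn_d1 A p q d t) ** A ** diag_mat (sinkhorn_d0 A p q d t)"

definition sinkhorn_residual ::
  "real ^ 'm ^ 'n \<Rightarrow> real ^ 'n \<Rightarrow> real ^ 'm \<Rightarrow> real ^ 'm \<Rightarrow> nat \<Rightarrow> real" where
  "sinkhorn_residual A p q d t =
     norm (vdiv (sinkhorn_matrix A p q d t *v 1) (vsqrt p) - vsqrt p)"

definition normalized_mat :: "real ^ 'm ^ 'n \<Rightarrow> real ^ 'n \<Rightarrow> real ^ 'm \<Rightarrow> real ^ 'm ^ 'n" where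
  "normalized_mat B p q = diag_mat (vdiv 1 (vsqrt p)) ** B ** diag_mat (vdiv 1 (vsqrt q))"

end

theory Submission
  imports Defs
begin

text \<open>
  Write \<open>B\<close> for the scaled matrix, \<open>u = d\<^sup>0 / e\<^sup>0\<close> and \<open>v = (B u) / p\<close>. An iteration replaces \<open>u\<close> by weighted
  harmonic means of \<open>v\<close> and \<open>v\<close> by weighted means of \<open>u\<close>; this defines a map \<open>F\<close>, homogeneous of
  degree 1. The sum of \<open>p / v\<close> does not increase along orbits, and its decrements bound the spread of
  \<open>u\<close> within each row; by indecomposability every orbit converges to a constant vector.

  The difference of two orbits obeys an exact linear recursion whose matrix, after weighting by
  \<open>sqrt p\<close>, tends to the symmetric matrix \<open>S\<close> formed from the normalized matrix and its transpose. The
  residual is the norm of \<open>sqrt p (F v - v) / v\<close>, obeys a recursion of the same kind, and stays orthogonal to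
  the top eigenvector \<open>sqrt p\<close> of \<open>S\<close>. This gives the upper bound for every starting point.

  For the limit let \<open>lambda > 0\<close>. By an invariant cone argument, a residual not having ratio \<open>lambda\<close>
  decays at a rate \<open>mu < lambda\<close>. Near any starting point there is a direction \<open>e\<close> that a fixed number
  of steps maps to a \<open>lambda\<close>-eigenvector. If two points on a line in that direction both had fast decay,
  then the difference of their orbits, scaled to a common limit, would lie in the expanding cone and
  yet decay like \<open>mu ^ t\<close>. So each such line contains at most one exceptional point, and the
  exceptional set is null.
\<close>

text \<open>The limit cannot hold for every start: for \<open>d = e0\<close> all residuals from the
  first iteration on are 0, so their quotients are 0 even if lambda is positive. Hence an
  exceptional null set must be controlled. Linearization alone does not do this, because the
  derivative of the iterates may be singular. But eigenvectors for a nonzero eigenvalue lie in the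
  range of \<open>row_avg\<close>, and the derivative of \<open>F\<close> maps that range onto
  itself; this yields the direction \<open>e\<close> and explains why lambda must be positive here.
  Scaling two orbits to a common limit adds to their difference a multiple of a vector close to
  \<open>vsqrt p\<close>. The splitting of the space is made between lambda and the next smaller
  eigenvalue, so \<open>vsqrt p\<close> (eigenvalue 1) and every lambda-eigenvector lie in its upper
  part. The chosen eigenvector is orthogonal to \<open>vsqrt p\<close>, so the two contributions
  cannot cancel, and a multiple eigenvalue does no harm. The recursions are exact since 1/x - 1/y =
  (y - x)/(xy): the nonlinearity enters as a factor tending to 1, without a Taylor
  remainder.\<close>

subsection \<open>Orthonormal eigenbases\<close>

text \<open>A maximizer of the Rayleigh quotient on the unit sphere of \<open>V\<close> is an
  eigenvector, since otherwise the quotient could be increased in first order.\<close>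

lemma exists_unit_eigenvector:
  fixes f :: "'a::euclidean_space \<Rightarrow> 'a"
  assumes lin: "linear f" and sym: "\<And>x y. f x \<bullet> y = x \<bullet> f y"
    and V: "subspace V" and inv: "\<And>x. x \<in> V \<Longrightarrow> f x \<in> V" and nz: "V \<noteq> {0}"
  obtains x c where "x \<in> V" "norm x = 1" "f x = c *\<^sub>R x"
proof -
  define K where "K = V \<inter> sphere 0 1"
  have "compact K" unfolding K_def using closed_subspace[OF V] by (simp add: closed_Int_compact)
  obtain v where v: "v \<in> V" "v \<noteq> 0" using nz V subspace_0 by blast
  have "v /\<^sub>R norm v \<in> K" unfolding K_def using v V by (auto simp: subspace_scale)
  hence "K \<noteq> {}" by auto
  have "continuous_on K (\<lambda>x. x \<bullet> f x)"
    by (intro continuous_intros linear_continuous_on lin linear_conv_bounded_linear[THEN iffD1])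
  from continuous_attains_sup[OF \<open>compact K\<close> \<open>K \<noteq> {}\<close> this]
  obtain x where x: "x \<in> K" and mx: "\<And>y. y \<in> K \<Longrightarrow> y \<bullet> f y \<le> x \<bullet> f x" by blast
  define c where "c = x \<bullet> f x"
  have xV: "x \<in> V" and nx: "norm x = 1" using x by (auto simp: K_def)
  have g: "y \<bullet> f y \<le> c * (y \<bullet> y)" if "y \<in> V" for y
  proof (cases "y = 0")
    case False
    have "y /\<^sub>R norm y \<in> K" unfolding K_def using that V False by (auto simp: subspace_scale)
    from mx[OF this] have "(y \<bullet> f y) / (norm y)^2 \<le> c"
      by (simp add: linear_cmul[OF lin] c_def power2_eq_square field_simps)
    thus ?thesis using False by (simp add: field_simps dot_square_norm)
  qed (simp add: linear_0[OF lin])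
  \<comment> \<open>\<open>2 *\<^sub>R w\<close> is the gradient at \<open>x\<close> of the form
    \<open>c * (y \<bullet> y) - y \<bullet> f y\<close>, which is nonnegative on \<open>V\<close>
    and vanishes at \<open>x\<close>; the fact \<open>q\<close> below expands it along
    \<open>x + t *\<^sub>R w\<close>.\<close>
  define w where "w = c *\<^sub>R x - f x"
  have wV: "w \<in> V" unfolding w_def using xV V inv by (simp add: subspace_diff subspace_scale)
  define b where "b = c * (w \<bullet> w) - w \<bullet> f w"
  have b: "0 \<le> b" using g[OF wV] by (simp add: b_def)
  have q: "0 \<le> 2 * t * (w \<bullet> w) + t^2 * b" for t
  proof -
    have "x + t *\<^sub>R w \<in> V" using xV wV V by (simp add: subspace_add subspace_scale)
    from g[OF this] have "0 \<le> c * ((x + t *\<^sub>R w) \<bullet> (x + t *\<^sub>R w)) - (x + t *\<^sub>R w) \<bullet> f (x + t *\<^sub>R w)" by simp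
    also have "\<dots> = c * (x \<bullet> x) - x \<bullet> f x + 2 * t * (c * (x \<bullet> w) - f x \<bullet> w) + t^2 * b"
      by (simp add: linear_add[OF lin] linear_cmul[OF lin] inner_add_left inner_add_right sym
          b_def power2_eq_square algebra_simps inner_commute[of w x])
        (metis inner_commute sym)
    also have "c * (x \<bullet> x) - x \<bullet> f x = 0" using nx by (simp add: c_def dot_square_norm)
    also have "c * (x \<bullet> w) - f x \<bullet> w = w \<bullet> w" by (simp add: w_def inner_diff_left)
    finally show ?thesis by simp
  qed
  have "w \<bullet> w = 0"
  proof (rule ccontr)
    assume "w \<bullet> w \<noteq> 0"
    hence ww: "w \<bullet> w > 0" by simp
    \<comment> \<open>For small negative \<open>t\<close> the linear term wins; the denominator is
      \<open>b + 1\<close> because \<open>b\<close> may be 0.\<close>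
    define t where "t = - (w \<bullet> w) / (b + 1)"
    have "2 * t * (w \<bullet> w) + t^2 * b = t * (2 * (w \<bullet> w) + t * b)" by (simp add: power2_eq_square algebra_simps)
    moreover have "2 * (w \<bullet> w) + t * b > 0"
    proof -
      have "(w \<bullet> w) * (b / (b + 1)) < (w \<bullet> w) * 2"
        using ww b by (intro mult_strict_left_mono) (auto simp: field_simps)
      thus ?thesis by (simp add: t_def)
    qed
    moreover have "t < 0" using ww b by (simp add: t_def field_simps)
    ultimately have "2 * t * (w \<bullet> w) + t^2 * b < 0" by (simp add: mult_neg_pos)
    with q[of t] show False by simp
  qed
  hence "f x = c *\<^sub>R x" by (simp add: w_def)
  with xV nx show ?thesis using that by blast
qed

text \<open>Induction on the dimension: a unit eigenvector is split off, and by symmetry of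
  \<open>f\<close> its orthogonal complement in \<open>V\<close> is again invariant.\<close>

lemma orthonormal_eigenbasis_subspace:
  fixes f :: "'a::euclidean_space \<Rightarrow> 'a"
  assumes lin: "linear f" and sym: "\<And>x y. f x \<bullet> y = x \<bullet> f y"
    and "subspace V" and "\<And>x. x \<in> V \<Longrightarrow> f x \<in> V"
  shows "\<exists>E\<subseteq>V. finite E \<and> pairwise orthogonal E \<and> span E = V \<and>
           (\<forall>b\<in>E. norm b = 1 \<and> (\<exists>c. f b = c *\<^sub>R b))"
  using assms(3,4)
proof (induction "dim V" arbitrary: V rule: less_induct)
  case less
  show ?case
  proof (cases "V = {0}")
    case True
    thus ?thesis by (intro exI[of _ "{}"]) auto
  next
    case False
    obtain x c where x: "x \<in> V" "norm x = 1" "f x = c *\<^sub>R x"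
      using exists_unit_eigenvector[OF lin sym less.prems(1) less.prems(2) False] by metis
    define W where "W = V \<inter> {y. x \<bullet> y = 0}"
    have sW: "subspace W" unfolding W_def
      using subspace_inter[OF less.prems(1) subspace_hyperplane] by blast
    have xW: "x \<notin> W" using x by (auto simp: W_def)
    have "W \<subset> V" using x(1) xW unfolding W_def by blast
    hence "dim W < dim V" using dim_psubset[of W V] sW less.prems(1)
      by (metis span_eq_iff)
    moreover have "f y \<in> W" if "y \<in> W" for y
      using that less.prems(2)[of y] by (auto simp: W_def sym[symmetric] x)
    ultimately obtain E where E: "E \<subseteq> W" "finite E" "pairwise orthogonal E" "span E = W"
       "\<forall>b\<in>E. norm b = 1 \<and> (\<exists>c. f b = c *\<^sub>R b)" using less.hyps[OF _ sW] by blast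
    have "span (insert x E) = V"
    proof
      have "insert x E \<subseteq> V" using E x by (auto simp: W_def)
      thus "span (insert x E) \<subseteq> V" by (rule span_minimal[OF _ less.prems(1)])
      show "V \<subseteq> span (insert x E)"
      proof
        fix y assume y: "y \<in> V"
        have "y - (x \<bullet> y) *\<^sub>R x \<in> W" unfolding W_def
          using y x less.prems(1) by (simp add: subspace_diff subspace_scale inner_diff_right dot_square_norm)
        hence "y - (x \<bullet> y) *\<^sub>R x \<in> span E" using E by simp
        thus "y \<in> span (insert x E)" by (metis span_breakdown_eq)
      qed
    qed
    moreover have "pairwise orthogonal (insert x E)"
      using E(1,3) by (auto simp: pairwise_insert orthogonal_def W_def inner_commute)
    ultimately show ?thesis using E x
      by (intro exI[of _ "insert x E"]) (auto simp: W_def)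
  qed
qed

lemma orthonormal_expansion:
  fixes E :: "'a::euclidean_space set"
  assumes "finite E" "pairwise orthogonal E" "\<And>b. b \<in> E \<Longrightarrow> norm b = 1" "span E = UNIV"
  shows "x = (\<Sum>b\<in>E. (x \<bullet> b) *\<^sub>R b)"
proof -
  have *: "orthogonal (x - (\<Sum>b\<in>E. (b \<bullet> x / (b \<bullet> b)) *\<^sub>R b)) y" for y
    using Gram_Schmidt_step[OF assms(2), of y x] by (simp add: assms(4) orthogonal_commute)
  have "x - (\<Sum>b\<in>E. (b \<bullet> x / (b \<bullet> b)) *\<^sub>R b) = 0"
    using *[of "x - (\<Sum>b\<in>E. (b \<bullet> x / (b \<bullet> b)) *\<^sub>R b)"] by (simp add: orthogonal_def)
  also have "(\<Sum>b\<in>E. (b \<bullet> x / (b \<bullet> b)) *\<^sub>R b) = (\<Sum>b\<in>E. (x \<bullet> b) *\<^sub>R b)"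
    by (intro sum.cong) (auto simp: dot_square_norm assms(3) inner_commute)
  finally show ?thesis by simp
qed

section \<open>Characteristic polynomials of diagonalizable matrices and the second
  eigenvalue\<close>

lemma sum_const_poly: "(\<Sum>x\<in>A. [:f x:]) = [:\<Sum>x\<in>A. f x:]"
  by (induction A rule: infinite_finite_induct) auto

lemma prod_const_poly: "(\<Prod>x\<in>A. [:f x:]) = [:\<Prod>x\<in>A. f x :: 'a :: comm_semiring_1:]"
  by (induction A rule: infinite_finite_induct) (auto simp: one_pCons mult.commute)

text \<open>Over the polynomial ring, (X I - M) Q = Q D, where the constant matrix Q has the
  eigenvectors as columns and D is diagonal with entries X - \<open>d i\<close>. Taking determinants
  and cancelling det Q in an integral domain replaces any use of an inverse of Q.\<close>

lemma charpoly_of_eigenbasis: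
  fixes M :: "real ^ 'k ^ 'k" and b :: "'k \<Rightarrow> real ^ 'k"
  assumes eig: "\<And>i. M *v b i = d i *\<^sub>R b i" and det: "det (\<chi> i j. b j $ i) \<noteq> 0"
  shows "charpoly M = (\<Prod>i\<in>UNIV. [:- d i, 1:])"
proof -
  define C where "C = (\<chi> i j. (if i = j then [:0, 1:] else 0) - [:M $ i $ j:])"
  define D where "D = (\<chi> i j. if i = j then [:- d i, 1:] else (0::real poly))"
  define Q where "Q = (\<chi> i j. [:b j $ i:])"
  have "C ** Q = Q ** D"
  proof -
    have "(\<Sum>k\<in>UNIV. ((if i = k then [:0, 1:] else 0) - [:M $ i $ k:]) * [:b j $ k:])
        = (\<Sum>k\<in>UNIV. [:b k $ i:] * (if k = j then [:- d k, 1:] else 0))" for i j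
    proof -
      have "(\<Sum>k\<in>UNIV. ((if i = k then [:0, 1:] else 0) - [:M $ i $ k:]) * [:b j $ k:])
          = (\<Sum>k\<in>UNIV. if i = k then [:0, 1:] * [:b j $ k:] else 0) - (\<Sum>k\<in>UNIV. [:M $ i $ k * b j $ k:])"
        by (subst sum_subtractf[symmetric], rule sum.cong) (auto simp: algebra_simps)
      also have "(\<Sum>k\<in>UNIV. [:M $ i $ k * b j $ k:]) = [:(M *v b j) $ i:]"
        unfolding matrix_vector_mult_def by (simp add: sum_const_poly)
      also have "\<dots> = [:d j * b j $ i:]" by (simp add: eig)
      finally show ?thesis by (simp add: if_distrib cong: if_cong)
    qed
    thus ?thesis unfolding C_def Q_def D_def matrix_matrix_mult_def by (simp add: vec_eq_iff)
  qed
  hence "det C * det Q = det Q * det D" by (metis det_mul)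
  moreover have "det Q = [:det (\<chi> i j. b j $ i):]"
  proof -
    show ?thesis unfolding det_def Q_def
      by (simp add: prod_const_poly sum_const_poly[symmetric] of_int_poly mult.commute)
  qed
  ultimately have "det Q * det C = det Q * det D" "det Q \<noteq> 0" using det by (simp_all add: mult.commute)
  hence "det C = det D" by simp
  also have "det D = (\<Prod>i\<in>UNIV. [:- d i, 1:])"
    by (subst det_diagonal) (auto simp: D_def)
  finally show ?thesis unfolding charpoly_def C_def .
qed

lemma charpoly_orthonormal_eigenbasis:
  fixes M :: "real ^ 'k ^ 'k" and E :: "(real ^ 'k) set"
  assumes "finite E" "pairwise orthogonal E" "\<And>b. b \<in> E \<Longrightarrow> norm b = 1" "span E = UNIV"
    and eig: "\<And>b. b \<in> E \<Longrightarrow> M *v b = d b *\<^sub>R b"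
  shows "charpoly M = (\<Prod>b\<in>E. [:- d b, 1:])"
proof -
  have "0 \<notin> E" using assms(3) by force
  hence "independent E" using assms(2) by (simp add: pairwise_orthogonal_independent)
  hence "card E = CARD('k)" using assms(4) by (metis dim_eq_card dim_UNIV dim_span DIM_cart DIM_real mult.right_neutral)
  then obtain e where e: "bij_betw e (UNIV :: 'k set) E"
    using finite_same_card_bij[of "UNIV :: 'k set" E] assms(1) by auto
  have eE: "e i \<in> E" for i using e by (auto simp: bij_betw_def)
  have on: "e i \<bullet> e j = (if i = j then 1 else 0)" for i j
  proof (cases "i = j")
    case False
    hence "e i \<noteq> e j" using e by (auto simp: bij_betw_def inj_on_def)
    thus ?thesis using assms(2) eE False by (auto simp: pairwise_def orthogonal_def)
  qed (use eE assms(3) in \<open>auto simp: dot_square_norm\<close>)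
  let ?Q = "\<chi> i j. e j $ i"
  have "transpose ?Q ** ?Q = mat 1"
    using on by (simp add: vec_eq_iff matrix_matrix_mult_def transpose_def mat_def inner_vec_def)
  hence "det ?Q * det ?Q = 1" by (metis det_I det_mul det_transpose)
  hence "det ?Q \<noteq> 0" by auto
  from charpoly_of_eigenbasis[of M e "\<lambda>i. d (e i)", OF _ this]
  have "charpoly M = (\<Prod>i\<in>UNIV. [:- d (e i), 1:])" using eig eE by auto
  also have "\<dots> = (\<Prod>b\<in>E. [:- d b, 1:])" by (rule prod.reindex_bij_betw[OF e])
  finally show ?thesis .
qed

lemma proots_prod_linear: "finite E \<Longrightarrow> proots (\<Prod>b\<in>E. [:- d b, 1:]) = image_mset d (mset_set E)"
  for d :: "'b \<Rightarrow> real"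
proof (induction E rule: finite_induct)
  case (insert x F)
  have "(\<Prod>b\<in>F. [:- d b, 1:]) \<noteq> 0" using insert by (simp add: prod_zero_iff)
  hence "proots ([:- d x, 1:] * (\<Prod>b\<in>F. [:- d b, 1:])) = {#d x#} + proots (\<Prod>b\<in>F. [:- d b, 1:])"
    by (subst proots_mult) auto
  thus ?case using insert by (simp del: mult_pCons_left)
qed auto

text \<open>By \<open>le\<close> no eigenvalue exceeds 1, so one copy of 1, belonging to
  \<open>v\<close>, can be placed first in the sorted list. Position 1 then holds the largest
  eigenvalue on the orthogonal complement of \<open>v\<close>, which may again be 1.\<close>

lemma second_eigenvalue_attained:
  fixes M :: "real ^ 'k ^ 'k" and v :: "real ^ 'k"
  assumes card: "2 \<le> CARD('k)" and sym: "transpose M = M" and v: "M *v v = v" "v \<noteq> 0"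
    and le: "\<And>x. x \<bullet> (M *v x) \<le> x \<bullet> x"
  shows "\<exists>E d. finite E \<and> pairwise orthogonal E \<and> (\<forall>b\<in>E. norm b = 1 \<and> M *v b = d b *\<^sub>R b) \<and>
           span E = UNIV \<and> v /\<^sub>R norm v \<in> E \<and>
           (\<exists>b\<in>E. b \<noteq> v /\<^sub>R norm v \<and> d b = second_eigenvalue M) \<and>
           (\<forall>b\<in>E. b \<noteq> v /\<^sub>R norm v \<longrightarrow> d b \<le> second_eigenvalue M)"
proof -
  define w where "w = v /\<^sub>R norm v"
  have w: "norm w = 1" "M *v w = w" using v by (auto simp: w_def matrix_vector_mult_scaleR)
  have sy: "(M *v x) \<bullet> y = x \<bullet> (M *v y)" for x y by (metis dot_lmul_matrix sym transpose_matrix_vector)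
  have lin: "linear ((*v) M)" by simp
  have "subspace {y. w \<bullet> y = 0}" by (rule subspace_hyperplane)
  moreover have "M *v x \<in> {y. w \<bullet> y = 0}" if "x \<in> {y. w \<bullet> y = 0}" for x
    using that by (simp add: sy[symmetric] w)
  ultimately obtain F where F: "F \<subseteq> {y. w \<bullet> y = 0}" "finite F" "pairwise orthogonal F" "span F = {y. w \<bullet> y = 0}"
     "\<forall>b\<in>F. norm b = 1 \<and> (\<exists>c. M *v b = c *\<^sub>R b)"
    using orthonormal_eigenbasis_subspace[OF lin sy] by blast
  define E where "E = insert w F"
  \<comment> \<open>On a unit eigenvector the Rayleigh quotient is the eigenvalue, so no choice is
    required to name it.\<close>
  define d where "d b = b \<bullet> (M *v b)" for b
  have wF: "w \<notin> F" using F(1) w(1) by auto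
  have po: "pairwise orthogonal E"
    using F(1,3) by (auto simp: E_def pairwise_insert orthogonal_def inner_commute)
  have eig: "norm b = 1 \<and> M *v b = d b *\<^sub>R b" if "b \<in> E" for b
    using that F(5) w by (auto simp: E_def d_def dot_square_norm)
  have sp: "span E = UNIV"
  proof -
    have "y \<in> span E" for y
    proof -
      have "y - (w \<bullet> y) *\<^sub>R w \<in> {y. w \<bullet> y = 0}" using w(1) by (simp add: inner_diff_right dot_square_norm)
      thus ?thesis unfolding E_def using F(4) by (metis span_breakdown_eq)
    qed
    thus ?thesis by auto
  qed
  have fE: "finite E" using F by (simp add: E_def)
  have "0 \<notin> E" using eig by force
  hence "independent E" using po by (simp add: pairwise_orthogonal_independent)
  hence "card E = CARD('k)" using sp by (metis dim_eq_card dim_UNIV dim_span DIM_cart DIM_real mult.right_neutral)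
  have Fne: "F \<noteq> {}"
  proof
    assume "F = {}"
    hence "card E = 1" by (simp add: E_def)
    with \<open>card E = CARD('k)\<close> card show False by linarith
  qed
  have d1: "d b \<le> 1" if "b \<in> E" for b
    using le[of b] eig[OF that, THEN conjunct1] by (simp add: d_def dot_square_norm)
  have "charpoly M = (\<Prod>b\<in>E. [:- d b, 1:])"
    using charpoly_orthonormal_eigenbasis[OF fE po _ sp, of M d] eig by blast
  hence "proots (charpoly M) = image_mset d (mset_set E)"
    using proots_prod_linear[OF fE, of d] by simp
  moreover have "d w = 1" using w by (simp add: d_def dot_square_norm)
  ultimately have pr: "proots (charpoly M) = add_mset 1 (image_mset d (mset_set F))"
    using F(2) wF by (simp add: E_def)
  \<comment> \<open>In the ascending list the maximal element 1 goes last; the reversal in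
    \<open>eigenvalues\<close> brings it to the front.\<close>
  have ap: "sorted_list_of_multiset (add_mset 1 N) = sorted_list_of_multiset N @ [1]"
    if "\<forall>x\<in>#N. x \<le> (1::real)" for N
  proof -
    have "mset (sorted_list_of_multiset N @ [1]) = add_mset 1 N" by simp
    moreover have "sorted (sorted_list_of_multiset N @ [1])" using that by (auto simp: sorted_append)
    ultimately show ?thesis by (metis sorted_list_of_multiset_mset sorted_sort_id)
  qed
  have "\<forall>x\<in>#image_mset d (mset_set F). x \<le> 1" using d1 F(2) by (auto simp: E_def)
  from ap[OF this] have eg: "eigenvalues M = 1 # rev (sorted_list_of_multiset (image_mset d (mset_set F)))"
    by (simp add: eigenvalues_def pr)
  define L where "L = sorted_list_of_multiset (image_mset d (mset_set F))"
  have sL: "sorted L" "set L = d ` F" using F(2) by (auto simp: L_def)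
  have Lne: "L \<noteq> []" using sL(2) Fne by auto
  have se: "second_eigenvalue M = last L"
    using Lne by (simp add: second_eigenvalue_def eg L_def[symmetric] rev_nth last_conv_nth)
  have "last L \<in> d ` F" using Lne sL by (metis last_in_set)
  moreover have "d b \<le> last L" if "b \<in> F" for b
  proof -
    have "d b \<in> set L" using that sL by auto
    then obtain i where "i < length L" "d b = L ! i" by (metis in_set_conv_nth)
    thus ?thesis using sL Lne by (simp add: last_conv_nth sorted_nth_mono)
  qed
  ultimately have "(\<exists>b\<in>E. b \<noteq> w \<and> d b = second_eigenvalue M) \<and>
           (\<forall>b\<in>E. b \<noteq> w \<longrightarrow> d b \<le> second_eigenvalue M)" using wF se by (force simp: E_def)
  moreover have "w \<in> E" by (simp add: E_def)
  ultimately show ?thesis using fE po eig sp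
    unfolding w_def[symmetric] by (intro exI[of _ E] exI[of _ d]) blast
qed

subsection \<open>Orbits of asymptotically linear recursions\<close>

text \<open>The intended \<open>up\<close> is the orthogonal projection onto the eigenspaces of a
  symmetric \<open>S\<close> with eigenvalues at least \<open>lam\<close>; only the norm estimates
  that this gives are recorded. The cone consists of the vectors with
  \<open>norm (x - up x) \<le> norm (up x)\<close>.\<close>

locale spectral_splitting =
  fixes S :: "'a::euclidean_space \<Rightarrow> 'a" and up :: "'a \<Rightarrow> 'a" and lam mu0 :: real
  assumes mu0: "0 \<le> mu0" "mu0 < lam"
    and linS: "linear S" and lin: "linear up"
    and pyth: "(norm x)\<^sup>2 = (norm (up x))\<^sup>2 + (norm (x - up x))\<^sup>2"
    and comm: "up (S x) = S (up x)"
    and up_ge: "lam * norm (up x) \<le> norm (S (up x))"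
    and low_le: "norm (S (x - up x)) \<le> mu0 * norm (x - up x)"
begin

lemma norm_up_le: "norm (up x) \<le> norm x"
  using pyth[of x] by (smt (verit) norm_ge_zero power2_le_imp_le zero_le_power2)

lemma norm_low_le: "norm (x - up x) \<le> norm x"
  using pyth[of x] by (smt (verit) norm_ge_zero power2_le_imp_le zero_le_power2)

lemma norm_le_up_low: "norm x \<le> norm (up x) + norm (x - up x)"
  using norm_triangle_ineq[of "up x" "x - up x"] by simp

lemma up_step:
  assumes "norm (x' - S x) \<le> eps * norm x"
  shows "lam * norm (up x) - eps * norm x \<le> norm (up x')"
proof -
  have "up x' = S (up x) + up (x' - S x)" by (simp add: linear_diff[OF lin] comm)
  hence "norm (S (up x)) - norm (up (x' - S x)) \<le> norm (up x')"
    by (metis norm_diff_ineq)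
  thus ?thesis using up_ge[of x] norm_up_le[of "x' - S x"] assms by linarith
qed

lemma low_step:
  assumes "norm (x' - S x) \<le> eps * norm x"
  shows "norm (x' - up x') \<le> mu0 * norm (x - up x) + eps * norm x"
proof -
  have "x' - up x' = S (x - up x) + ((x' - S x) - up (x' - S x))"
    by (simp add: linear_diff[OF lin] comm linear_diff[OF linS])
  hence "norm (x' - up x') \<le> norm (S (x - up x)) + norm ((x' - S x) - up (x' - S x))"
    by (metis norm_triangle_ineq)
  thus ?thesis using low_le[of x] norm_low_le[of "x' - S x"] assms by linarith
qed

text \<open>In the cone \<open>norm x\<close> is at most twice \<open>norm (up x)\<close>, so a
  relative error \<open>eps\<close> costs \<open>2 * eps\<close> in each part. The cone is preserved
  if \<open>mu0 + 2 * eps \<le> lam - 2 * eps\<close>, which is the source of the factor 4.\<close>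

lemma cone_step:
  assumes "norm (x' - S x) \<le> eps * norm x" "0 \<le> eps" "4 * eps \<le> lam - mu0"
    and "norm (x - up x) \<le> norm (up x)"
  shows "norm (x' - up x') \<le> norm (up x')" "(lam - 2 * eps) * norm (up x) \<le> norm (up x')"
proof -
  have "eps * norm x \<le> eps * (2 * norm (up x))"
    using norm_le_up_low[of x] assms by (intro mult_left_mono) auto
  with up_step[OF assms(1)] show 1: "(lam - 2 * eps) * norm (up x) \<le> norm (up x')"
    by (simp add: algebra_simps)
  have "mu0 * norm (x - up x) \<le> mu0 * norm (up x)" using assms(4) mu0 by (intro mult_left_mono) auto
  hence "norm (x' - up x') \<le> (mu0 + 2 * eps) * norm (up x)"
    using low_step[OF assms(1)] \<open>eps * norm x \<le> eps * (2 * norm (up x))\<close> by (simp add: algebra_simps)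
  also have "\<dots> \<le> (lam - 2 * eps) * norm (up x)" using assms(3) by (intro mult_right_mono) auto
  finally show "norm (x' - up x') \<le> norm (up x')" using 1 by linarith
qed

lemma off_cone_step:
  assumes "norm (x' - S x) \<le> eps * norm x" "0 \<le> eps" "norm (up x) \<le> norm (x - up x)"
  shows "norm (x' - up x') \<le> (mu0 + 2 * eps) * norm (x - up x)"
proof -
  have "eps * norm x \<le> eps * (2 * norm (x - up x))"
    using norm_le_up_low[of x] assms by (intro mult_left_mono) auto
  with low_step[OF assms(1)] show ?thesis by (simp add: algebra_simps)
qed

lemma cone_growth:
  assumes step: "\<And>t. T \<le> t \<Longrightarrow> norm (x (Suc t) - S (x t)) \<le> eps * norm (x t)"
    and "0 \<le> eps" "4 * eps \<le> lam - mu0"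
    and cone: "norm (x T - up (x T)) \<le> norm (up (x T))"
  shows "norm (x (T + k) - up (x (T + k))) \<le> norm (up (x (T + k))) \<and>
    (lam - 2 * eps) ^ k * norm (up (x T)) \<le> norm (up (x (T + k)))"
proof (induction k)
  case (Suc k)
  have s: "norm (x (Suc (T + k)) - S (x (T + k))) \<le> eps * norm (x (T + k))" by (rule step) simp
  note c = cone_step[OF s assms(2,3) Suc[THEN conjunct1]]
  have "(lam - 2 * eps) ^ Suc k * norm (up (x T)) = (lam - 2 * eps) * ((lam - 2 * eps) ^ k * norm (up (x T)))"
    by simp
  also have "\<dots> \<le> (lam - 2 * eps) * norm (up (x (T + k)))"
    using Suc mu0 assms(2,3) by (intro mult_left_mono) auto
  finally show ?case using c by simp
qed (use cone in auto)

lemma off_cone_decay: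
  assumes step: "\<And>t. T \<le> t \<Longrightarrow> norm (x (Suc t) - S (x t)) \<le> eps * norm (x t)"
    and "0 \<le> eps"
    and cone: "\<And>t. T \<le> t \<Longrightarrow> norm (up (x t)) \<le> norm (x t - up (x t))"
  shows "norm (x (T + k)) \<le> 2 * (mu0 + 2 * eps) ^ k * norm (x T)"
proof -
  have "norm (x (T + k) - up (x (T + k))) \<le> (mu0 + 2 * eps) ^ k * norm (x T)"
  proof (induction k)
    case (Suc k)
    have "norm (x (T + Suc k) - up (x (T + Suc k))) \<le> (mu0 + 2 * eps) * norm (x (T + k) - up (x (T + k)))"
      using off_cone_step[OF step assms(2) cone, of "T + k"] by simp
    also have "\<dots> \<le> (mu0 + 2 * eps) * ((mu0 + 2 * eps) ^ k * norm (x T))"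
      using Suc mu0 assms(2) by (intro mult_left_mono) auto
    finally show ?case by simp
  qed (use norm_low_le in auto)
  thus ?thesis using norm_le_up_low[of "x (T + k)"] cone[of "T + k"] by simp
qed

text \<open>Membership in the cone only bounds \<open>norm x\<close> by twice its upper part, which
  is too weak for the exact ratio \<open>lam\<close>. The quotient of lower and upper part obeys a
  recursion with contraction factor \<open>mu0 / lam < 1\<close> and a forcing term tending to 0, so
  it vanishes in the limit.\<close>

lemma cone_ratio_tendsto_0:
  assumes step: "\<And>t. norm (x (Suc t) - S (x t)) \<le> th t * norm (x t)"
    and th: "th \<longlonglongrightarrow> 0" "\<And>t. 0 \<le> th t" "\<And>t. T \<le> t \<Longrightarrow> 4 * th t \<le> lam - mu0"
    and cone: "\<And>t. T \<le> t \<Longrightarrow> norm (x t - up (x t)) \<le> norm (up (x t))"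
    and pos: "\<And>t. T \<le> t \<Longrightarrow> 0 < norm (up (x t))"
  shows "(\<lambda>t. norm (x t - up (x t)) / norm (up (x t))) \<longlonglongrightarrow> 0"
proof -
  define g where "g t = norm (x t - up (x t)) / norm (up (x t))" for t
  define c where "c = mu0 / lam"
  have lam: "0 < lam" using mu0 by simp
  have c: "0 \<le> c" "c < 1" using mu0 lam by (auto simp: c_def)
  define h where "h t = (4 / lam) * th t" for t
  have g1: "0 \<le> g t" "g t \<le> 1" if "T \<le> t" for t
    using cone[OF that] pos[OF that] by (auto simp: g_def)
  have gs: "g (Suc t) \<le> c * g t + h t" if "T \<le> t" for t
  proof -
    define a where "a = norm (up (x t))"
    have a: "0 < a" using pos[OF that] by (simp add: a_def)
    have nx: "norm (x t) \<le> 2 * a" using norm_le_up_low[of "x t"] cone[OF that] by (simp add: a_def)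
    have low: "norm (x t - up (x t)) = g t * a" using a by (simp add: g_def a_def)
    have tx: "th t * norm (x t) \<le> th t * (2 * a)" using nx th(2) by (intro mult_left_mono)
    have A: "(lam - 2 * th t) * a \<le> norm (up (x (Suc t)))"
      using up_step[OF step[of t]] tx by (simp add: a_def algebra_simps)
    have B: "norm (x (Suc t) - up (x (Suc t))) \<le> (mu0 * g t + 2 * th t) * a"
      using low_step[OF step[of t]] tx low by (simp add: algebra_simps)
    have lt: "0 < norm (up (x (Suc t)))" using pos[of "Suc t"] that by simp
    \<comment> \<open>Replaces the denominator \<open>lam - 2 * th t\<close> by \<open>lam\<close>
      at the price of doubling the error term; \<open>g t \<le> 1\<close> and
      \<open>4 * th t \<le> lam - mu0\<close> provide the slack.\<close>
    have "(mu0 * g t + 2 * th t) * lam \<le> (mu0 * g t + 4 * th t) * (lam - 2 * th t)"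
    proof -
      have "2 * th t * (mu0 * g t) \<le> 2 * th t * mu0"
        using g1[OF that] th(2)[of t] mu0 by (intro mult_left_mono) (auto simp: mult_left_le)
      moreover have "0 \<le> 2 * th t * (lam - mu0 - 4 * th t)"
        using th(2)[of t] th(3)[OF that] by (intro mult_nonneg_nonneg) auto
      ultimately show ?thesis by (simp add: algebra_simps)
    qed
    moreover have "0 < lam - 2 * th t" using th(2)[of t] th(3)[OF that] mu0 by linarith
    ultimately have "(mu0 * g t + 2 * th t) \<le> (mu0 * g t + 4 * th t) / lam * (lam - 2 * th t)"
      using lam by (simp add: field_simps)
    hence "(mu0 * g t + 2 * th t) * a \<le> (mu0 * g t + 4 * th t) / lam * ((lam - 2 * th t) * a)"
      using a by (metis mult.assoc mult_right_mono less_imp_le)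
    also have "\<dots> \<le> (mu0 * g t + 4 * th t) / lam * norm (up (x (Suc t)))"
      using A g1[OF that] th(2)[of t] mu0 lam by (intro mult_left_mono) auto
    finally have "norm (x (Suc t) - up (x (Suc t))) \<le> (mu0 * g t + 4 * th t) / lam * norm (up (x (Suc t)))"
      using B by linarith
    hence "g (Suc t) \<le> (mu0 * g t + 4 * th t) / lam" using lt by (simp add: g_def field_simps)
    thus ?thesis by (simp add: c_def h_def add_divide_distrib)
  qed
  have h0: "h \<longlonglongrightarrow> 0" unfolding h_def using tendsto_mult_right_zero[OF th(1), of "4 / lam"] by simp
  have "g \<longlonglongrightarrow> 0"
  proof (rule LIMSEQ_I)
    fix r :: real assume r: "0 < r"
    \<comment> \<open>With this bound on the forcing term, \<open>r / 2\<close> is the fixed point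
      of the affine majorant of the recursion.\<close>
    have "0 < r / 2 * (1 - c)" using r c by simp
    from LIMSEQ_D[OF h0 this] obtain N where N: "\<And>t. N \<le> t \<Longrightarrow> norm (h t) < r / 2 * (1 - c)" by auto
    define K where "K = max N T"
    have bd: "g (K + k) \<le> c ^ k + r / 2" for k
    proof (induction k)
      case 0 thus ?case using g1(2)[of K] r by (simp add: K_def)
    next
      case (Suc k)
      have "N \<le> K + k" by (simp add: K_def)
      from N[OF this] have hN: "h (K + k) \<le> r / 2 * (1 - c)"
        using abs_ge_self[of "h (K + k)"] unfolding real_norm_def by linarith
      have "g (K + Suc k) \<le> c * g (K + k) + h (K + k)" using gs[of "K + k"] by (simp add: K_def)
      also have "\<dots> \<le> c * (c ^ k + r / 2) + r / 2 * (1 - c)"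
        using hN Suc c by (intro add_mono mult_left_mono) auto
      also have "\<dots> = c ^ Suc k + r / 2" by (simp add: field_simps)
      finally show ?case .
    qed
    have "(\<lambda>k. c ^ k) \<longlonglongrightarrow> 0" using c by (intro LIMSEQ_power_zero) auto
    from LIMSEQ_D[OF this, of "r/2"] r obtain m where m: "\<And>k. m \<le> k \<Longrightarrow> c ^ k < r / 2"
      using c by auto
    show "\<exists>no. \<forall>n\<ge>no. norm (g n - 0) < r"
    proof (intro exI allI impI)
      fix n assume n: "K + m \<le> n"
      have "g n \<le> c ^ (n - K) + r / 2" using bd[of "n - K"] n by simp
      moreover have "c ^ (n - K) < r / 2" using n by (intro m) auto
      moreover have "0 \<le> g n" using n by (intro g1) (auto simp: K_def)
      ultimately show "norm (g n - 0) < r" by simp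
    qed
  qed
  thus ?thesis by (simp add: g_def[abs_def])
qed

text \<open>Either the orbit is at some late time in the cone with a nonzero upper part, and then
  stays there and grows asymptotically like \<open>lam\<close>; or it never is, and the lower part,
  which decays, dominates forever.\<close>

lemma growth_dichotomy:
  assumes step: "\<And>t. norm (x (Suc t) - S (x t)) \<le> th t * norm (x t)"
    and th: "th \<longlonglongrightarrow> 0" "\<And>t. 0 \<le> th t"
    and mu: "mu0 < mu"
  shows "(\<forall>c<lam. \<forall>\<^sub>F t in sequentially. x t \<noteq> 0 \<and> c * norm (x t) \<le> norm (x (Suc t))) \<or>
         (\<exists>C. \<forall>t. norm (x t) \<le> C * mu ^ t)"
proof -
  \<comment> \<open>The first bound keeps the cone invariant, the second keeps the decay rate
    \<open>mu0 + 2 * eps\<close> outside it below \<open>mu\<close>.\<close>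
  define eps where "eps = min ((lam - mu0) / 4) ((mu - mu0) / 2)"
  have eps: "0 < eps" "4 * eps \<le> lam - mu0" "mu0 + 2 * eps \<le> mu"
    using mu mu0 by (auto simp: eps_def min_def field_simps)
  from LIMSEQ_D[OF th(1) eps(1)] obtain T where T: "\<And>t. T \<le> t \<Longrightarrow> th t \<le> eps"
    by (fastforce simp: less_imp_le)
  have st: "norm (x (Suc t) - S (x t)) \<le> eps * norm (x t)" if "T \<le> t" for t
    using step[of t] mult_right_mono[OF T[OF that] norm_ge_zero[of "x t"]] by linarith
  show ?thesis
  proof (cases "\<exists>t\<ge>T. norm (x t - up (x t)) \<le> norm (up (x t)) \<and> up (x t) \<noteq> 0")
    case True
    then obtain T' where T': "T \<le> T'" "norm (x T' - up (x T')) \<le> norm (up (x T'))" "up (x T') \<noteq> 0" by blast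
    have G: "norm (x t - up (x t)) \<le> norm (up (x t)) \<and> 0 < norm (up (x t))" if "T' \<le> t" for t
    proof -
      have *: "norm (x (T' + k) - up (x (T' + k))) \<le> norm (up (x (T' + k))) \<and>
            (lam - 2 * eps) ^ k * norm (up (x T')) \<le> norm (up (x (T' + k)))" for k
        using T' eps st by (intro cone_growth[where eps = eps]) auto
      have "0 < (lam - 2 * eps) ^ k * norm (up (x T'))" for k using T'(3) eps mu0 by simp
      with *[of "t - T'"] that show ?thesis by (smt (verit) le_add_diff_inverse)
    qed
    have th4: "4 * th t \<le> lam - mu0" if "T' \<le> t" for t using T[of t] T'(1) eps(2) that by linarith
    have g0: "(\<lambda>t. norm (x t - up (x t)) / norm (up (x t))) \<longlonglongrightarrow> 0"
      by (intro cone_ratio_tendsto_0[OF step th, where T = T']) (use G th4 in blast)+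
    have lam: "0 < lam" using mu0 by simp
    have "\<forall>\<^sub>F t in sequentially. x t \<noteq> 0 \<and> c * norm (x t) \<le> norm (x (Suc t))" if c: "c < lam" for c
    proof -
      \<comment> \<open>A lower bound for the growth factor:
        \<open>lam * norm (up x) / norm x\<close> minus the relative error.\<close>
      define s where "s t = lam / (1 + norm (x t - up (x t)) / norm (up (x t))) - th t" for t
      have "s \<longlonglongrightarrow> lam / (1 + 0) - 0" unfolding s_def by (intro tendsto_intros g0 th(1)) auto
      hence "\<forall>\<^sub>F t in sequentially. c < s t" using c by (intro order_tendstoD) auto
      moreover have "\<forall>\<^sub>F t in sequentially. T' \<le> t" by (rule eventually_ge_at_top)
      ultimately show ?thesis
      proof eventually_elim
        case (elim t)
        define g where "g = norm (x t - up (x t)) / norm (up (x t))"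
        have p: "0 < norm (up (x t))" using G elim by auto
        hence "norm (x t - up (x t)) = g * norm (up (x t))" by (simp add: g_def)
        hence "norm (x t) \<le> (1 + g) * norm (up (x t))"
          using norm_le_up_low[of "x t"] by (simp add: distrib_right)
        moreover have "0 \<le> g" by (simp add: g_def)
        ultimately have "norm (x t) / (1 + g) \<le> norm (up (x t))" by (simp add: field_simps)
        from mult_left_mono[OF this, of lam]
        have "lam / (1 + g) * norm (x t) \<le> lam * norm (up (x t))" using lam by simp
        hence "s t * norm (x t) \<le> norm (up (x (Suc t)))"
          using up_step[OF step[of t]] by (simp add: s_def g_def[symmetric] algebra_simps)
        also have "\<dots> \<le> norm (x (Suc t))" by (rule norm_up_le)
        finally have "c * norm (x t) \<le> norm (x (Suc t))"
          using elim mult_right_mono[of c "s t" "norm (x t)"] by simp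
        moreover have "x t \<noteq> 0" using p norm_up_le[of "x t"] by auto
        ultimately show ?case by simp
      qed
    qed
    thus ?thesis by blast
  next
    case False
    \<comment> \<open>A vector that lies in the cone only because its upper part is 0 satisfies this
      inequality too.\<close>
    have oc: "norm (up (x t)) \<le> norm (x t - up (x t))" if "T \<le> t" for t
      using False that by (metis linear norm_ge_zero norm_zero)
    have d: "norm (x (T + k)) \<le> 2 * (mu0 + 2 * eps) ^ k * norm (x T)" for k
      using eps(1) st oc by (intro off_cone_decay) auto
    have mp: "0 < mu" using mu mu0 by simp
    \<comment> \<open>The sum absorbs the times before \<open>T\<close>, where the recursion gives
      no control.\<close>
    define C where "C = 2 * norm (x T) / mu ^ T + (\<Sum>t<T. norm (x t) / mu ^ t)"
    have "norm (x t) \<le> C * mu ^ t" for t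
    proof (cases "t < T")
      case True
      have "norm (x t) / mu ^ t \<le> (\<Sum>t<T. norm (x t) / mu ^ t)"
        using True mp by (intro member_le_sum) auto
      also have "\<dots> \<le> C" using mp by (simp add: C_def)
      finally show ?thesis using mp by (simp add: field_simps)
    next
      case False
      then obtain k where k: "t = T + k" by (metis le_add_diff_inverse not_less)
      have "norm (x t) \<le> 2 * mu ^ k * norm (x T)"
        using d[of k] power_mono[OF eps(3), of k] eps mu0 k
        by (smt (verit) mult_left_mono mult_right_mono norm_ge_zero)
      also have "\<dots> = 2 * norm (x T) / mu ^ T * mu ^ t" using mp by (simp add: k power_add)
      also have "\<dots> \<le> C * mu ^ t"
        using mp by (intro mult_right_mono) (auto simp: C_def intro!: sum_nonneg)
      finally show ?thesis .
    qed
    thus ?thesis by blast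
  qed
qed

end

section \<open>The spectral splitting at the second eigenvalue\<close>

lemma norm_sum_orthonormal:
  fixes E :: "'a::real_inner set"
  assumes "finite E" "pairwise orthogonal E" "\<And>b. b \<in> E \<Longrightarrow> norm b = 1"
  shows "(norm (\<Sum>b\<in>E. c b *\<^sub>R b))\<^sup>2 = (\<Sum>b\<in>E. (c b)\<^sup>2)"
proof -
  have "pairwise (\<lambda>i j. orthogonal (c i *\<^sub>R i) (c j *\<^sub>R j)) E"
    using assms(2) by (auto simp: pairwise_def orthogonal_def)
  from norm_sum_Pythagorean[OF assms(1) this]
  show ?thesis using assms(3) by (simp add: power_mult_distrib)
qed

text \<open>Everything is read off from coordinates in an orthonormal eigenbasis containing the
  direction of \<open>v\<close>. By \<open>ge\<close> the eigenvalues are nonnegative, so bounds on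
  them carry over to their squares and hence to norms.\<close>

lemma second_eigenvalue_properties:
  fixes M :: "real ^ 'k ^ 'k" and v :: "real ^ 'k"
  assumes card: "2 \<le> CARD('k)" and sym: "transpose M = M" and v: "M *v v = v" "v \<noteq> 0"
    and le: "\<And>x. x \<bullet> (M *v x) \<le> x \<bullet> x" and ge: "\<And>x. 0 \<le> x \<bullet> (M *v x)"
  defines "lam \<equiv> second_eigenvalue M"
  shows "0 \<le> lam"
    and "\<And>x. x \<bullet> v = 0 \<Longrightarrow> norm (M *v x) \<le> lam * norm x"
    and "\<exists>y. y \<noteq> 0 \<and> y \<bullet> v = 0 \<and> M *v y = lam *\<^sub>R y"
    and "0 < lam \<Longrightarrow> \<exists>up mu0. spectral_splitting ((*v) M) up lam mu0 \<and> up v = v \<and>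
            (\<forall>y. M *v y = lam *\<^sub>R y \<longrightarrow> up y = y)"
proof -
  define w where "w = v /\<^sub>R norm v"
  obtain E d where E: "finite E" "pairwise orthogonal E" "span E = UNIV"
     and Ed: "\<And>b. b \<in> E \<Longrightarrow> norm b = 1" "\<And>b. b \<in> E \<Longrightarrow> M *v b = d b *\<^sub>R b"
     and w: "w \<in> E" and ex: "\<exists>b\<in>E. b \<noteq> w \<and> d b = lam" and al: "\<And>b. b \<in> E \<Longrightarrow> b \<noteq> w \<Longrightarrow> d b \<le> lam"
    using second_eigenvalue_attained[OF card sym v le] unfolding w_def[symmetric] lam_def by metis
  have orth: "b \<bullet> b' = 0" if "b \<in> E" "b' \<in> E" "b \<noteq> b'" for b b'
    using E(2) that by (auto simp: pairwise_def orthogonal_def)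
  have bb: "b \<bullet> b = 1" if "b \<in> E" for b using Ed(1)[OF that] by (simp add: dot_square_norm)
  have sy: "(M *v x) \<bullet> y = x \<bullet> (M *v y)" for x y by (metis dot_lmul_matrix sym transpose_matrix_vector)
  have d0: "0 \<le> d b" if "b \<in> E" for b using ge[of b] Ed(2)[OF that] bb[OF that] by simp
  have dw: "d w = 1"
  proof -
    have "M *v w = w" using v by (simp add: w_def matrix_vector_mult_scaleR)
    hence "(d w - 1) *\<^sub>R w = 0" using Ed(2)[OF w] by (simp add: algebra_simps)
    thus ?thesis using Ed(1)[OF w] by auto
  qed
  have ex': "x = (\<Sum>b\<in>E. (x \<bullet> b) *\<^sub>R b)" for x by (rule orthonormal_expansion) (use E Ed in auto)
  have nx: "(norm x)\<^sup>2 = (\<Sum>b\<in>E. (x \<bullet> b)\<^sup>2)" for x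
    by (subst (1) ex'[of x], rule norm_sum_orthonormal) (use E Ed in auto)
  have Mb: "(M *v x) \<bullet> b = d b * (x \<bullet> b)" if "b \<in> E" for x b by (simp add: sy Ed(2)[OF that])
  obtain b1 where b1: "b1 \<in> E" "b1 \<noteq> w" "d b1 = lam" using ex by blast
  show l0: "0 \<le> lam" using d0[OF b1(1)] b1 by simp
  show "norm (M *v x) \<le> lam * norm x" if "x \<bullet> v = 0" for x
  proof -
    have xw: "x \<bullet> w = 0" using that by (simp add: w_def)
    have "(norm (M *v x))\<^sup>2 = (\<Sum>b\<in>E. (d b)\<^sup>2 * (x \<bullet> b)\<^sup>2)"
      unfolding nx by (intro sum.cong) (auto simp: Mb power_mult_distrib)
    also have "\<dots> \<le> (\<Sum>b\<in>E. lam\<^sup>2 * (x \<bullet> b)\<^sup>2)"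
    proof (rule sum_mono)
      fix b assume "b \<in> E"
      thus "(d b)\<^sup>2 * (x \<bullet> b)\<^sup>2 \<le> lam\<^sup>2 * (x \<bullet> b)\<^sup>2"
        using al d0 xw by (cases "b = w") (auto intro!: mult_right_mono power_mono)
    qed
    also have "\<dots> = (lam * norm x)\<^sup>2" by (simp add: nx power_mult_distrib sum_distrib_left)
    finally show ?thesis by (rule power2_le_imp_le) (use l0 in simp)
  qed
  show "\<exists>y. y \<noteq> 0 \<and> y \<bullet> v = 0 \<and> M *v y = lam *\<^sub>R y"
  proof (intro exI conjI)
    show "b1 \<noteq> 0" using Ed(1)[OF b1(1)] by auto
    show "b1 \<bullet> v = 0" using orth[OF b1(1) w b1(2)] v by (simp add: w_def)
    show "M *v b1 = lam *\<^sub>R b1" using Ed(2)[OF b1(1)] b1(3) by simp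
  qed
  assume lp: "0 < lam"
  define U where "U = {b \<in> E. lam \<le> d b}"
  define up where "up x = (\<Sum>b\<in>U. (x \<bullet> b) *\<^sub>R b)" for x
  \<comment> \<open>Inserting 0 keeps the maximum defined when no eigenvalue lies below
    \<open>lam\<close>; \<open>mu0 < lam\<close> then relies on \<open>lam\<close> being
    positive.\<close>
  define mu0 where "mu0 = Max (insert 0 (d ` (E - U)))"
  have mu0: "0 \<le> mu0" "mu0 < lam" "\<And>b. b \<in> E - U \<Longrightarrow> d b \<le> mu0"
    using E(1) lp by (auto simp: mu0_def U_def)
  have U: "U \<subseteq> E" "finite U" using E by (auto simp: U_def)
  have upb: "up x \<bullet> b = (if b \<in> U then x \<bullet> b else 0)" if "b \<in> E" for x b
  proof -
    have "up x \<bullet> b = (\<Sum>b'\<in>U. (x \<bullet> b') * (b' \<bullet> b))" by (simp add: up_def inner_sum_left)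
    also have "\<dots> = (\<Sum>b'\<in>U. if b' = b then x \<bullet> b else 0)"
      using U that by (intro sum.cong) (auto simp: bb orth)
    also have "\<dots> = (if b \<in> U then x \<bullet> b else 0)" using U by simp
    finally show ?thesis .
  qed
  have eqI: "x = y" if "\<And>b. b \<in> E \<Longrightarrow> x \<bullet> b = y \<bullet> b" for x y
    by (subst ex'[of x], subst ex'[of y]) (simp add: that cong: sum.cong)
  have "spectral_splitting ((*v) M) up lam mu0"
  proof (rule spectral_splitting.intro)
    show "0 \<le> mu0" "mu0 < lam" using mu0 by auto
    show "linear ((*v) M)" by simp
    show "linear up" by (rule linearI) (simp_all add: up_def inner_add_left scaleR_add_left sum.distrib scaleR_sum_right)
    fix x
    show "(norm x)\<^sup>2 = (norm (up x))\<^sup>2 + (norm (x - up x))\<^sup>2"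
      unfolding nx sum.distrib[symmetric] by (intro sum.cong) (auto simp: upb inner_diff_left)
    show "up (M *v x) = M *v up x" by (rule eqI) (simp add: upb Mb)
    have "(lam * norm (up x))\<^sup>2 \<le> (norm (M *v up x))\<^sup>2"
    proof -
      have "(lam * norm (up x))\<^sup>2 = (\<Sum>b\<in>E. lam\<^sup>2 * (up x \<bullet> b)\<^sup>2)"
        by (simp add: nx power_mult_distrib sum_distrib_left)
      also have "\<dots> \<le> (\<Sum>b\<in>E. (d b)\<^sup>2 * (up x \<bullet> b)\<^sup>2)"
        using lp by (intro sum_mono) (auto simp: upb U_def intro!: mult_right_mono power_mono)
      also have "\<dots> = (norm (M *v up x))\<^sup>2"
        unfolding nx by (intro sum.cong) (auto simp: Mb power_mult_distrib)
      finally show ?thesis .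
    qed
    thus "lam * norm (up x) \<le> norm (M *v up x)" by (rule power2_le_imp_le) simp
    have "(norm (M *v (x - up x)))\<^sup>2 \<le> (mu0 * norm (x - up x))\<^sup>2"
    proof -
      have "(norm (M *v (x - up x)))\<^sup>2 = (\<Sum>b\<in>E. (d b)\<^sup>2 * ((x - up x) \<bullet> b)\<^sup>2)"
        unfolding nx by (intro sum.cong) (auto simp: Mb power_mult_distrib)
      also have "\<dots> \<le> (\<Sum>b\<in>E. mu0\<^sup>2 * ((x - up x) \<bullet> b)\<^sup>2)"
      proof (rule sum_mono)
        fix b assume "b \<in> E"
        thus "(d b)\<^sup>2 * ((x - up x) \<bullet> b)\<^sup>2 \<le> mu0\<^sup>2 * ((x - up x) \<bullet> b)\<^sup>2"
          using mu0(3)[of b] d0 by (cases "b \<in> U") (auto simp: upb inner_diff_left intro!: mult_right_mono power_mono)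
      qed
      also have "\<dots> = (mu0 * norm (x - up x))\<^sup>2" by (simp add: nx power_mult_distrib sum_distrib_left)
      finally show ?thesis .
    qed
    thus "norm (M *v (x - up x)) \<le> mu0 * norm (x - up x)" by (rule power2_le_imp_le) (use mu0 in simp)
  qed
  \<comment> \<open>Needed for all eigenvalues from \<open>lam\<close> upwards: it is applied to
    \<open>lam\<close>-eigenvectors and, with eigenvalue 1, to \<open>v\<close>.\<close>
  moreover have fixed: "up y = y" if y: "M *v y = c *\<^sub>R y" "lam \<le> c" for y c
  proof (rule eqI)
    fix b assume b: "b \<in> E"
    have "c * (y \<bullet> b) = d b * (y \<bullet> b)" using Mb[OF b, of y] unfolding y(1) inner_scaleR_left .
    hence "y \<bullet> b = 0 \<or> d b = c" by (metis mult_cancel_right)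
    thus "up y \<bullet> b = y \<bullet> b" using b y(2) by (auto simp: upb U_def)
  qed
  have "lam \<le> 1" using le[of b1] Ed(2)[OF b1(1)] bb[OF b1(1)] b1(3) by simp
  hence "up v = v" using fixed[of v 1] v by simp
  ultimately show "\<exists>up mu0. spectral_splitting ((*v) M) up lam mu0 \<and> up v = v \<and>
            (\<forall>y. M *v y = lam *\<^sub>R y \<longrightarrow> up y = y)" using fixed by blast
qed

text \<open>\<open>transpose N\<close> carries an eigenvector orthogonal to \<open>v\<close> to one
  of the other Gram matrix, with the same eigenvalue and orthogonal to \<open>w\<close>; it is
  nonzero if the eigenvalue is. Exchanging \<open>N\<close> and its transpose gives the reverse
  inequality.\<close>

lemma second_eigenvalue_gram_le:
  fixes N :: "real ^ 'm ^ 'n" and v :: "real ^ 'n" and w :: "real ^ 'm"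
  assumes "2 \<le> CARD('n)" "2 \<le> CARD('m)" and vw: "transpose N *v v = w" "N *v w = v" "v \<noteq> 0" "w \<noteq> 0"
    and le: "\<And>x. norm (transpose N *v x) \<le> norm x" "\<And>x. norm (N *v x) \<le> norm x"
  shows "second_eigenvalue (N ** transpose N) \<le> second_eigenvalue (transpose N ** N)"
proof -
  have adj: "(N *v x) \<bullet> y = x \<bullet> (transpose N *v y)" for x y
    by (metis dot_lmul_matrix transpose_transpose transpose_matrix_vector)
  have q1: "x \<bullet> (N ** transpose N *v x) = (norm (transpose N *v x))\<^sup>2" for x
    by (metis adj inner_commute dot_square_norm matrix_vector_mul_assoc)
  have q2: "x \<bullet> (transpose N ** N *v x) = (norm (N *v x))\<^sup>2" for x
    by (metis adj dot_square_norm matrix_vector_mul_assoc)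
  have p1: "N ** transpose N *v v = v" "transpose N ** N *v w = w"
    using vw by (simp_all add: matrix_vector_mul_assoc[symmetric])
  have tr: "transpose (N ** transpose N) = N ** transpose N" "transpose (transpose N ** N) = transpose N ** N"
    by (simp_all add: matrix_transpose_mul)
  note P = second_eigenvalue_properties[OF assms(1) tr(1) p1(1) \<open>v \<noteq> 0\<close>]
  note Q = second_eigenvalue_properties[OF assms(2) tr(2) p1(2) \<open>w \<noteq> 0\<close>]
  let ?l = "second_eigenvalue (N ** transpose N)" and ?k = "second_eigenvalue (transpose N ** N)"
  have b: "x \<bullet> (N ** transpose N *v x) \<le> x \<bullet> x" "0 \<le> x \<bullet> (N ** transpose N *v x)" for x
    using le(1)[of x] by (simp_all add: q1 dot_square_norm power_mono)
  have c: "x \<bullet> (transpose N ** N *v x) \<le> x \<bullet> x" "0 \<le> x \<bullet> (transpose N ** N *v x)" for x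
    using le(2)[of x] by (simp_all add: q2 dot_square_norm power_mono)
  have k0: "0 \<le> ?k" by (rule Q(1)) (use c in auto)
  have "\<exists>y. y \<noteq> 0 \<and> y \<bullet> v = 0 \<and> N ** transpose N *v y = ?l *\<^sub>R y" by (rule P(3)) (use b in auto)
  then obtain y where y: "y \<noteq> 0" "y \<bullet> v = 0" "N ** transpose N *v y = ?l *\<^sub>R y" by blast
  show ?thesis
  proof (cases "?l \<le> 0")
    case False
    define z where "z = transpose N *v y"
    have "z \<bullet> w = 0" using y(2) vw(2) adj[of w y] by (simp add: z_def inner_commute)
    hence "norm (transpose N ** N *v z) \<le> ?k * norm z" by (intro Q(2)) (use c in auto)
    moreover have "transpose N ** N *v z = ?l *\<^sub>R z"
      using y(3) by (metis matrix_vector_mul_assoc matrix_vector_mult_scaleR z_def)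
    moreover have "z \<noteq> 0" using y False by (auto simp: z_def matrix_vector_mul_assoc[symmetric])
    ultimately show ?thesis using False by simp
  qed (use k0 in simp)
qed

subsection \<open>The Sinkhorn map in rescaled coordinates\<close>

lemma weighted_sum_square_le:
  fixes w y :: "'i \<Rightarrow> real"
  assumes "\<And>j. j \<in> A \<Longrightarrow> 0 \<le> w j"
  shows "(\<Sum>j\<in>A. w j * y j)\<^sup>2 \<le> (\<Sum>j\<in>A. w j) * (\<Sum>j\<in>A. w j * (y j)\<^sup>2)"
proof -
  have "(\<Sum>j\<in>A. w j * y j) = (\<Sum>j\<in>A. sqrt (w j) * (sqrt (w j) * y j))"
    using assms by (intro sum.cong) (simp_all add: mult.assoc[symmetric])
  hence "(\<Sum>j\<in>A. w j * y j)\<^sup>2 \<le> (\<Sum>j\<in>A. (sqrt (w j))\<^sup>2) * (\<Sum>j\<in>A. (sqrt (w j) * y j)\<^sup>2)"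
    using Cauchy_Schwarz_ineq_sum[of "\<lambda>j. sqrt (w j)" "\<lambda>j. sqrt (w j) * y j" A] by simp
  thus ?thesis using assms by (simp add: power_mult_distrib)
qed

locale balanced_matrix =
  fixes B :: "real ^ 'm ^ 'n" and p :: "real ^ 'n" and q :: "real ^ 'm"
  assumes B0: "0 \<le> B $ i $ j" and p0: "0 < p $ i" and q0: "0 < q $ j"
    and row: "(\<Sum>j\<in>UNIV. B $ i $ j) = p $ i" and col: "(\<Sum>i\<in>UNIV. B $ i $ j) = q $ j"
begin

definition row_avg :: "real ^ 'm \<Rightarrow> real ^ 'n" where
  "row_avg u = (\<chi> i. (\<Sum>j\<in>UNIV. B $ i $ j * u $ j) / p $ i)"

definition col_harm :: "real ^ 'n \<Rightarrow> real ^ 'm" where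
  "col_harm v = (\<chi> j. q $ j / (\<Sum>i\<in>UNIV. B $ i $ j / v $ i))"

definition F :: "real ^ 'n \<Rightarrow> real ^ 'n" where
  "F v = row_avg (col_harm v)"

definition rho :: "real ^ 'n \<Rightarrow> real ^ 'n" where
  "rho v = (\<chi> i. sqrt (p $ i) * (F v $ i - v $ i) / v $ i)"

definition N :: "real ^ 'm ^ 'n" where
  "N = normalized_mat B p q"

definition S :: "real ^ 'n ^ 'n" where
  "S = N ** transpose N"

definition wt :: "real ^ 'n \<Rightarrow> real ^ 'n" where
  "wt x = (\<chi> i. sqrt (p $ i) * x $ i)"

text \<open>An order interval of constant vectors: weighted means leave it invariant, and the
  quotient \<open>b / a\<close> measures how far the vectors in it are from being constant.\<close>

definition between :: "real \<Rightarrow> real \<Rightarrow> real ^ 'k \<Rightarrow> bool" where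
  "between a b v \<longleftrightarrow> (\<forall>i. a \<le> v $ i \<and> v $ i \<le> b)"

lemma p_nz [simp]: "p $ i \<noteq> 0" using p0[of i] by simp
lemma q_nz [simp]: "q $ j \<noteq> 0" using q0[of j] by simp
lemma sqrt_p_mult [simp]: "sqrt (p $ i) * sqrt (p $ i) = p $ i" using p0[of i] by simp
lemma abs_p [simp]: "\<bar>p $ i\<bar> = p $ i" using p0[of i] by simp
lemma abs_q [simp]: "\<bar>q $ j\<bar> = q $ j" using q0[of j] by simp

lemma between_pos: "between a b v \<Longrightarrow> 0 < a \<Longrightarrow> pos_vec v"
  unfolding between_def pos_vec_def by (meson less_le_trans)

lemma row_avg_between: "between a b u \<Longrightarrow> between a b (row_avg u)"
proof -
  assume u: "between a b u"
  have "a \<le> (\<Sum>j\<in>UNIV. B $ i $ j * u $ j) / p $ i" "(\<Sum>j\<in>UNIV. B $ i $ j * u $ j) / p $ i \<le> b" for i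
  proof -
    have "a * p $ i = (\<Sum>j\<in>UNIV. B $ i $ j * a)" by (simp add: row sum_distrib_right[symmetric])
    also have "\<dots> \<le> (\<Sum>j\<in>UNIV. B $ i $ j * u $ j)" using u B0 by (intro sum_mono mult_left_mono) (auto simp: between_def)
    finally show "a \<le> (\<Sum>j\<in>UNIV. B $ i $ j * u $ j) / p $ i" using p0[of i] by (simp add: field_simps)
    have "(\<Sum>j\<in>UNIV. B $ i $ j * u $ j) \<le> (\<Sum>j\<in>UNIV. B $ i $ j * b)" using u B0 by (intro sum_mono mult_left_mono) (auto simp: between_def)
    also have "\<dots> = b * p $ i" by (simp add: row sum_distrib_right[symmetric])
    finally show "(\<Sum>j\<in>UNIV. B $ i $ j * u $ j) / p $ i \<le> b" using p0[of i] by (simp add: field_simps)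
  qed
  thus ?thesis by (simp add: between_def row_avg_def)
qed

lemma col_denom_pos: "pos_vec v \<Longrightarrow> 0 < (\<Sum>i\<in>UNIV. B $ i $ j / v $ i)"
proof -
  assume v: "pos_vec v"
  have nn: "0 \<le> B $ i $ j / v $ i" for i using v B0 by (simp add: pos_vec_def less_imp_le)
  have "(\<Sum>i\<in>UNIV. B $ i $ j / v $ i) \<noteq> 0"
  proof
    assume "(\<Sum>i\<in>UNIV. B $ i $ j / v $ i) = 0"
    hence "\<forall>i. B $ i $ j / v $ i = 0" using nn by (simp add: sum_nonneg_eq_0_iff)
    moreover have "v $ i \<noteq> 0" for i using v by (auto simp: pos_vec_def less_imp_neq[symmetric])
    ultimately have "\<forall>i. B $ i $ j = 0" by simp
    thus False using col[of j] by simp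
  qed
  moreover have "0 \<le> (\<Sum>i\<in>UNIV. B $ i $ j / v $ i)" by (rule sum_nonneg) (rule nn)
  ultimately show ?thesis by simp
qed

lemma col_harm_between: "between a b v \<Longrightarrow> 0 < a \<Longrightarrow> between a b (col_harm v)"
proof -
  assume v: "between a b v" and a: "0 < a"
  have vp: "pos_vec v" using v a by (rule between_pos)
  have b: "0 < b" using v a unfolding between_def by (meson less_le_trans order_trans)
  have "a \<le> col_harm v $ j \<and> col_harm v $ j \<le> b" for j
  proof -
    define D where "D = (\<Sum>i\<in>UNIV. B $ i $ j / v $ i)"
    have D: "0 < D" unfolding D_def by (rule col_denom_pos[OF vp])
    have vi: "0 < v $ i" "a \<le> v $ i" "v $ i \<le> b" for i using v vp by (auto simp: between_def pos_vec_def)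
    have "D \<le> (\<Sum>i\<in>UNIV. B $ i $ j / a)" unfolding D_def using B0 vi a
      by (intro sum_mono divide_left_mono) auto
    also have "\<dots> = q $ j / a" by (simp add: col sum_divide_distrib[symmetric])
    finally have 1: "a \<le> q $ j / D" using D a by (simp add: field_simps)
    have "q $ j / b = (\<Sum>i\<in>UNIV. B $ i $ j / b)" by (simp add: col sum_divide_distrib[symmetric])
    also have "\<dots> \<le> D" unfolding D_def using B0 vi b
      by (intro sum_mono divide_left_mono) auto
    finally have 2: "q $ j / D \<le> b" using D b by (simp add: field_simps)
    show ?thesis using 1 2 by (simp add: col_harm_def D_def)
  qed
  thus ?thesis by (simp add: between_def)
qed

lemma F_between: "between a b v \<Longrightarrow> 0 < a \<Longrightarrow> between a b (F v)"
  unfolding F_def by (intro row_avg_between col_harm_between)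

lemma iter_between: "between a b v \<Longrightarrow> 0 < a \<Longrightarrow> between a b ((F ^^ t) v)"
  by (induction t) (auto intro: F_between)

lemma between_Min_Max: "between (Min (range (($) v))) (Max (range (($) v))) v"
  by (simp add: between_def)

lemma pos_between: "pos_vec v \<Longrightarrow> 0 < Min (range (($) v))"
  by (auto simp: pos_vec_def)

lemma pos_iter: "pos_vec v \<Longrightarrow> pos_vec ((F ^^ t) v)"
  by (rule between_pos[OF iter_between[OF between_Min_Max pos_between] pos_between])

lemma pos_F: "pos_vec v \<Longrightarrow> pos_vec (F v)"
  using pos_iter[of v 1] by simp

lemma pos_col_harm: "pos_vec v \<Longrightarrow> pos_vec (col_harm v)"
  by (rule between_pos[OF col_harm_between[OF between_Min_Max pos_between] pos_between])

lemma pos_row_avg: "pos_vec u \<Longrightarrow> pos_vec (row_avg u)"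
  by (rule between_pos[OF row_avg_between[OF between_Min_Max] pos_between])

lemma F_scaleR: "0 < c \<Longrightarrow> F (c *\<^sub>R v) = c *\<^sub>R F v"
proof -
  assume c: "0 < c"
  have "(\<Sum>i\<in>UNIV. B $ i $ j / (c * v $ i)) = (\<Sum>i\<in>UNIV. B $ i $ j / v $ i) / c" for j
    unfolding sum_divide_distrib by (intro sum.cong) (auto simp: field_simps)
  hence "col_harm (c *\<^sub>R v) = c *\<^sub>R col_harm v"
    using c by (simp add: col_harm_def vec_eq_iff)
  thus ?thesis by (simp add: F_def row_avg_def vec_eq_iff sum_distrib_left mult_ac)
qed

lemma iter_scaleR: "0 < c \<Longrightarrow> (F ^^ t) (c *\<^sub>R v) = c *\<^sub>R (F ^^ t) v"
  by (induction t) (auto simp: F_scaleR)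

text \<open>The identity for differences of reciprocals, applied once to the entries
  \<open>1 / v $ k\<close> and once to the denominators, gives an exact linear formula whose extra
  factor is 1 at constant vectors.\<close>

lemma col_harm_diff:
  assumes "pos_vec v" "pos_vec w"
  shows "col_harm v $ j - col_harm w $ j =
    (\<Sum>k\<in>UNIV. B $ k $ j / q $ j * (col_harm v $ j * col_harm w $ j / (v $ k * w $ k)) * (v $ k - w $ k))"
proof -
  define D where "D v = (\<Sum>i\<in>UNIV. B $ i $ j / v $ i)" for v :: "real ^ 'n"
  have D: "0 < D v" "0 < D w" using assms col_denom_pos by (auto simp: D_def)
  have ch: "col_harm v $ j = q $ j / D v" "col_harm w $ j = q $ j / D w"
    by (simp_all add: col_harm_def D_def)
  have "D w - D v = (\<Sum>k\<in>UNIV. B $ k $ j * (v $ k - w $ k) / (v $ k * w $ k))"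
    unfolding D_def sum_subtractf[symmetric] using assms
    by (intro sum.cong refl) (auto simp: pos_vec_def field_simps less_imp_neq[symmetric])
  moreover have "q $ j / D v - q $ j / D w = q $ j / D v * (q $ j / D w) / q $ j * (D w - D v)"
    using D by (simp add: field_simps)
  ultimately show ?thesis unfolding ch by (simp add: sum_distrib_left mult_ac)
qed

lemma F_diff:
  assumes "pos_vec v" "pos_vec w"
  shows "F v $ i - F w $ i = (\<Sum>j\<in>UNIV. \<Sum>k\<in>UNIV. B $ i $ j * B $ k $ j / (p $ i * q $ j) *
    (col_harm v $ j * col_harm w $ j / (v $ k * w $ k)) * (v $ k - w $ k))"
proof -
  have "F v $ i - F w $ i = (\<Sum>j\<in>UNIV. B $ i $ j / p $ i * (col_harm v $ j - col_harm w $ j))"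
    by (simp add: F_def row_avg_def diff_divide_distrib[symmetric] sum_subtractf[symmetric]
        sum_divide_distrib algebra_simps)
  thus ?thesis unfolding col_harm_diff[OF assms] sum_distrib_left by (simp add: mult_ac)
qed

section \<open>The normalized matrix and the perturbed linear recursions\<close>

lemma N_entry: "N $ i $ j = B $ i $ j / (sqrt (p $ i) * sqrt (q $ j))"
  by (simp add: N_def normalized_mat_def diag_mat_def vdiv_def vsqrt_def matrix_matrix_mult_def
      if_distrib[of "\<lambda>x. x * _"] if_distrib[of "\<lambda>x. _ * x"] cong: if_cong)

lemma S_entry: "S $ i $ k = (\<Sum>j\<in>UNIV. B $ i $ j * B $ k $ j / (sqrt (p $ i) * q $ j * sqrt (p $ k)))"
  unfolding S_def matrix_matrix_mult_def transpose_def
  by (simp add: N_entry) (intro sum.cong refl, simp add: mult_ac)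

text \<open>Cauchy-Schwarz in each row with weights \<open>B $ i $ j\<close>, whose total
  \<open>p $ i\<close> cancels the row normalization; after exchanging the sums the column totals
  cancel \<open>q $ j\<close>.\<close>

lemma norm_N_le: "norm (N *v x) \<le> norm x"
proof -
  have "(norm (N *v x))\<^sup>2 = (\<Sum>i\<in>UNIV. (\<Sum>j\<in>UNIV. N $ i $ j * x $ j)\<^sup>2)"
    by (simp add: norm_vec_def L2_set_def matrix_vector_mult_def sum_nonneg)
  also have "\<dots> \<le> (\<Sum>i\<in>UNIV. \<Sum>j\<in>UNIV. B $ i $ j * ((x $ j)\<^sup>2 / q $ j))"
  proof (rule sum_mono)
    fix i
    have "(\<Sum>j\<in>UNIV. N $ i $ j * x $ j) = (\<Sum>j\<in>UNIV. B $ i $ j * (x $ j / sqrt (q $ j))) / sqrt (p $ i)"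
      unfolding sum_divide_distrib by (intro sum.cong) (auto simp: N_entry)
    also have "\<dots>\<^sup>2 = (\<Sum>j\<in>UNIV. B $ i $ j * (x $ j / sqrt (q $ j)))\<^sup>2 / p $ i"
      using p0[of i] by (simp add: power_divide)
    also have "\<dots> \<le> (\<Sum>j\<in>UNIV. B $ i $ j) * (\<Sum>j\<in>UNIV. B $ i $ j * (x $ j / sqrt (q $ j))\<^sup>2) / p $ i"
      using p0[of i] B0 by (intro divide_right_mono weighted_sum_square_le) (auto simp: less_imp_le)
    also have "\<dots> = (\<Sum>j\<in>UNIV. B $ i $ j * ((x $ j)\<^sup>2 / q $ j))"
      using q0 by (simp add: row power_divide less_imp_le)
    finally show "(\<Sum>j\<in>UNIV. N $ i $ j * x $ j)\<^sup>2 \<le> (\<Sum>j\<in>UNIV. B $ i $ j * ((x $ j)\<^sup>2 / q $ j))" .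
  qed
  also have "\<dots> = (\<Sum>j\<in>UNIV. (\<Sum>i\<in>UNIV. B $ i $ j) * ((x $ j)\<^sup>2 / q $ j))"
    unfolding sum_distrib_right by (rule sum.swap)
  also have "\<dots> = (norm x)\<^sup>2" by (simp add: col norm_vec_def L2_set_def sum_nonneg)
  finally show ?thesis by (rule power2_le_imp_le) simp
qed

lemma adjoint_N: "(N *v x) \<bullet> y = x \<bullet> (transpose N *v y)"
  by (metis dot_lmul_matrix transpose_transpose transpose_matrix_vector)

lemma norm_transpose_N_le: "norm (transpose N *v y) \<le> norm y"
proof -
  have "norm (transpose N *v y) * norm (transpose N *v y) = (N *v (transpose N *v y)) \<bullet> y"
    by (simp add: adjoint_N dot_square_norm power2_eq_square)
  also have "\<dots> \<le> norm (N *v (transpose N *v y)) * norm y" by (rule norm_cauchy_schwarz)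
  also have "\<dots> \<le> norm (transpose N *v y) * norm y" by (intro mult_right_mono norm_N_le) auto
  finally show ?thesis by (cases "transpose N *v y = 0") auto
qed

lemma norm_S_le: "norm (S *v x) \<le> norm x"
  unfolding S_def matrix_vector_mul_assoc[symmetric]
  using norm_N_le norm_transpose_N_le order_trans by blast

lemma N_sqrt: "N *v vsqrt q = vsqrt p" "transpose N *v vsqrt p = vsqrt q"
proof -
  have "(\<Sum>j\<in>UNIV. N $ i $ j * sqrt (q $ j)) = sqrt (p $ i)" for i
  proof -
    have "(\<Sum>j\<in>UNIV. N $ i $ j * sqrt (q $ j)) = (\<Sum>j\<in>UNIV. B $ i $ j) / sqrt (p $ i)"
      unfolding sum_divide_distrib by (intro sum.cong) (auto simp: N_entry)
    thus ?thesis using p0[of i] by (simp add: row real_div_sqrt)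
  qed
  thus "N *v vsqrt q = vsqrt p" by (simp add: matrix_vector_mult_def vsqrt_def vec_eq_iff)
  have "(\<Sum>i\<in>UNIV. N $ i $ j * sqrt (p $ i)) = sqrt (q $ j)" for j
  proof -
    have "(\<Sum>i\<in>UNIV. N $ i $ j * sqrt (p $ i)) = (\<Sum>i\<in>UNIV. B $ i $ j) / sqrt (q $ j)"
      unfolding sum_divide_distrib by (intro sum.cong) (auto simp: N_entry)
    thus ?thesis using q0[of j] by (simp add: col real_div_sqrt)
  qed
  thus "transpose N *v vsqrt p = vsqrt q" by (simp add: matrix_vector_mult_def vsqrt_def vec_eq_iff transpose_def)
qed

lemma S_sqrt: "S *v vsqrt p = vsqrt p"
  using N_sqrt unfolding S_def matrix_vector_mul_assoc[symmetric] by (simp only:)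

lemma sqrt_nz: "vsqrt p \<noteq> 0" "vsqrt q \<noteq> 0"
  by (auto simp: vec_eq_iff vsqrt_def)

text \<open>The kernel of \<open>S\<close> is nonnegative, so the error is bounded entrywise by
  \<open>th\<close> times \<open>S\<close> applied to the absolute values of \<open>x\<close>. As
  \<open>S\<close> does not increase norms, the relative error is \<open>th\<close>, without a
  dimension-dependent constant.\<close>

lemma S_perturb:
  assumes x': "\<And>i. x' $ i = (\<Sum>j\<in>UNIV. \<Sum>k\<in>UNIV. B $ i $ j * B $ k $ j / (sqrt (p $ i) * q $ j * sqrt (p $ k)) * om i j k * x $ k)"
    and om: "\<And>i j k. \<bar>om i j k - 1\<bar> \<le> th"
  shows "norm (x' - S *v x) \<le> th * norm x"
proof -
  define c where "c i j k = B $ i $ j * B $ k $ j / (sqrt (p $ i) * q $ j * sqrt (p $ k))" for i j k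
  have c0: "0 \<le> c i j k" for i j k using B0 p0[of i] p0[of k] q0[of j] by (simp add: c_def)
  define y where "y = (\<chi> k. \<bar>x $ k\<bar>)"
  have Sx: "(S *v x) $ i = (\<Sum>j\<in>UNIV. \<Sum>k\<in>UNIV. c i j k * x $ k)" for x i
    unfolding matrix_vector_mult_def by (simp add: S_entry c_def sum_distrib_right) (rule sum.swap)
  have "\<bar>(x' - S *v x) $ i\<bar> \<le> th * (S *v y) $ i" for i
  proof -
    have "(x' - S *v x) $ i = (\<Sum>j\<in>UNIV. \<Sum>k\<in>UNIV. c i j k * ((om i j k - 1) * x $ k))"
      unfolding vector_minus_component x' Sx c_def[symmetric] sum_subtractf[symmetric]
      by (simp add: algebra_simps)
    also have "\<bar>\<dots>\<bar> \<le> (\<Sum>j\<in>UNIV. \<Sum>k\<in>UNIV. \<bar>c i j k * ((om i j k - 1) * x $ k)\<bar>)"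
      by (rule order_trans[OF sum_abs]) (intro sum_mono sum_abs)
    also have "\<dots> \<le> (\<Sum>j\<in>UNIV. \<Sum>k\<in>UNIV. c i j k * (th * y $ k))"
      unfolding abs_mult abs_of_nonneg[OF c0] using om
      by (intro sum_mono mult_left_mono c0) (auto simp: y_def intro!: mult_right_mono)
    also have "\<dots> = th * (S *v y) $ i" by (simp add: Sx sum_distrib_left mult_ac)
    finally show ?thesis .
  qed
  hence "norm (x' - S *v x) \<le> norm (th *\<^sub>R (S *v y))"
    by (intro norm_le_componentwise_cart) (metis abs_ge_self order_trans real_norm_def vector_scaleR_component real_scaleR_def)
  also have "\<dots> \<le> \<bar>th\<bar> * norm y" by (simp add: mult_left_mono norm_S_le)
  also have "\<bar>th\<bar> = th" using om[of undefined undefined undefined] by simp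
  also have "norm y = norm x" by (simp add: y_def norm_vec_def)
  finally show ?thesis .
qed

lemma ratio_bound:
  assumes "0 < a" "a \<le> x" "x \<le> b" "a \<le> y" "y \<le> b" "a \<le> z" "z \<le> b" "a \<le> w" "w \<le> b"
  shows "\<bar>x * y / (z * w) - 1\<bar> \<le> (b / a)\<^sup>2 - (1::real)"
proof -
  have le: "z * w / (x * y) \<le> (b / a)\<^sup>2" if "a \<le> x" "x \<le> b" "a \<le> y" "y \<le> b" "a \<le> z" "z \<le> b" "a \<le> w" "w \<le> b"
    for x y z w
  proof -
    have "z * w / (x * y) \<le> (b * b) / (a * a)"
      using assms(1) that by (intro frac_le mult_mono mult_pos_pos mult_nonneg_nonneg) linarith+
    thus ?thesis by (simp add: power2_eq_square)
  qed
  define r where "r = x * y / (z * w)"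
  have r: "0 < r" unfolding r_def using assms by (intro divide_pos_pos mult_pos_pos) linarith+
  have "r \<le> (b / a)\<^sup>2" unfolding r_def by (rule le) (use assms in auto)
  \<comment> \<open>Since r + 1/r is at least 2, the lower bound on the ratio follows from the upper
    bound on its reciprocal, a ratio of the same kind.\<close>
  moreover have "1 - r \<le> 1 / r - 1"
  proof -
    have "0 \<le> (r - 1)\<^sup>2 / r" using r by simp
    also have "(r - 1)\<^sup>2 / r = r + 1 / r - 2" using r by (simp add: power2_eq_square field_simps)
    finally show ?thesis by simp
  qed
  moreover have "1 / r \<le> (b / a)\<^sup>2" using le[of x y z w] assms by (simp add: r_def)
  ultimately show ?thesis unfolding r_def[symmetric] by linarith
qed

text \<open>Weighting by \<open>sqrt (p $ i)\<close> turns the kernel B_ij B_kj / (p_i q_j) of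
  \<open>F_diff\<close> into the symmetric kernel of \<open>S\<close>.\<close>

lemma wt_diff_step:
  assumes "between a b v" "between a b w" "0 < a"
  shows "norm (wt (F v - F w) - S *v wt (v - w)) \<le> ((b / a)\<^sup>2 - 1) * norm (wt (v - w))"
proof (rule S_perturb[where om = "\<lambda>i j k. col_harm v $ j * col_harm w $ j / (v $ k * w $ k)"])
  have pv: "pos_vec v" "pos_vec w" using assms between_pos by auto
  show "wt (F v - F w) $ i = (\<Sum>j\<in>UNIV. \<Sum>k\<in>UNIV. B $ i $ j * B $ k $ j / (sqrt (p $ i) * q $ j * sqrt (p $ k)) *
    (col_harm v $ j * col_harm w $ j / (v $ k * w $ k)) * wt (v - w) $ k)" for i
  proof -
    have s: "sqrt (p $ i) / p $ i = 1 / sqrt (p $ i)" using p0[of i] by (simp add: field_simps)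
    have "sqrt (p $ i) * (c / (p $ i * d) * e * f) = c / (sqrt (p $ i) * d * sqrt (p $ k)) * e * (sqrt (p $ k) * f)" for c d e f k
    proof -
      have "sqrt (p $ i) * (c / (p $ i * d) * e * f) = (sqrt (p $ i) / p $ i) * (c / d * e * f)" by simp
      also have "\<dots> = c / (sqrt (p $ i) * d * sqrt (p $ k)) * e * (sqrt (p $ k) * f)"
        unfolding s using p0[of k] by simp
      finally show ?thesis .
    qed
    note 1 = this
    have "wt (F v - F w) $ i = sqrt (p $ i) * (F v $ i - F w $ i)" by (simp add: wt_def)
    also have "\<dots> = (\<Sum>j\<in>UNIV. \<Sum>k\<in>UNIV. B $ i $ j * B $ k $ j / (sqrt (p $ i) * q $ j * sqrt (p $ k)) *
      (col_harm v $ j * col_harm w $ j / (v $ k * w $ k)) * (sqrt (p $ k) * (v $ k - w $ k)))"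
      unfolding F_diff[OF pv] sum_distrib_left by (intro sum.cong refl 1)
    finally show ?thesis by (simp add: wt_def)
  qed
  show "\<bar>col_harm v $ j * col_harm w $ j / (v $ k * w $ k) - 1\<bar> \<le> (b / a)\<^sup>2 - 1" for i :: 'n and j k
    using assms col_harm_between[OF assms(1,3)] col_harm_between[OF assms(2,3)]
    by (intro ratio_bound) (auto simp: between_def)
qed

text \<open>\<open>F_diff\<close> is applied to the consecutive points \<open>F v\<close> and
  \<open>v\<close>. Its factor \<open>1 / v $ k\<close> turns the increment into
  \<open>rho v $ k\<close>, and the division by \<open>F v $ i\<close> in \<open>rho (F v)\<close>
  joins the perturbation factor.\<close>

lemma rho_step:
  assumes "between a b v" "0 < a"
  shows "norm (rho (F v) - S *v rho v) \<le> ((b / a)\<^sup>2 - 1) * norm (rho v)"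
proof (rule S_perturb[where om = "\<lambda>i j k. col_harm (F v) $ j * col_harm v $ j / (F v $ k * F v $ i)"])
  have pv: "pos_vec v" "pos_vec (F v)" using assms between_pos pos_F by auto
  have nz: "v $ k \<noteq> 0" "F v $ k \<noteq> 0" for k using pv by (auto simp: pos_vec_def less_imp_neq[symmetric])
  show "rho (F v) $ i = (\<Sum>j\<in>UNIV. \<Sum>k\<in>UNIV. B $ i $ j * B $ k $ j / (sqrt (p $ i) * q $ j * sqrt (p $ k)) *
    (col_harm (F v) $ j * col_harm v $ j / (F v $ k * F v $ i)) * rho v $ k)" for i
  proof -
    have s: "sqrt (p $ i) / p $ i = 1 / sqrt (p $ i)" using p0[of i] by (simp add: field_simps)
    have "sqrt (p $ i) * (c / (p $ i * d) * (e / (F v $ k * v $ k)) * f) / F v $ i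
         = c / (sqrt (p $ i) * d * sqrt (p $ k)) * (e / (F v $ k * F v $ i)) * (sqrt (p $ k) * f / v $ k)" for c d e f k
    proof -
      have "sqrt (p $ i) * (c / (p $ i * d) * (e / (F v $ k * v $ k)) * f) / F v $ i
          = (sqrt (p $ i) / p $ i) * (c / d * e / (F v $ k * v $ k) * f / F v $ i)" by simp
      also have "\<dots> = c / (sqrt (p $ i) * d * sqrt (p $ k)) * (e / (F v $ k * F v $ i)) * (sqrt (p $ k) * f / v $ k)"
        unfolding s using p0[of k] by (simp add: mult_ac)
      finally show ?thesis .
    qed
    note 1 = this
    have "rho (F v) $ i = sqrt (p $ i) * (F (F v) $ i - F v $ i) / F v $ i" by (simp add: rho_def)
    also have "\<dots> = (\<Sum>j\<in>UNIV. \<Sum>k\<in>UNIV. B $ i $ j * B $ k $ j / (sqrt (p $ i) * q $ j * sqrt (p $ k)) *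
      (col_harm (F v) $ j * col_harm v $ j / (F v $ k * F v $ i)) * (sqrt (p $ k) * (F v $ k - v $ k) / v $ k))"
      unfolding F_diff[OF pv(2,1)] sum_distrib_left sum_divide_distrib by (intro sum.cong refl 1)
    finally show ?thesis by (simp add: rho_def)
  qed
  show "\<bar>col_harm (F v) $ j * col_harm v $ j / (F v $ k * F v $ i) - 1\<bar> \<le> (b / a)\<^sup>2 - 1" for i j k
    using assms F_between[OF assms] col_harm_between[OF assms] col_harm_between[OF F_between[OF assms]]
    by (intro ratio_bound) (auto simp: between_def)
qed

text \<open>Column sums are exactly \<open>q\<close> after every iteration, so the total mass is
  right and the errors of the row sums add up to 0.\<close>

lemma rho_orthogonal: "pos_vec v \<Longrightarrow> rho v \<bullet> vsqrt p = 0"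
proof -
  assume v: "pos_vec v"
  have nz: "v $ k \<noteq> 0" for k using v by (auto simp: pos_vec_def less_imp_neq[symmetric])
  have "rho v \<bullet> vsqrt p = (\<Sum>i\<in>UNIV. p $ i * F v $ i / v $ i - p $ i)"
    unfolding inner_vec_def
  proof (rule sum.cong)
    fix i
    have "rho v $ i \<bullet> vsqrt p $ i = (sqrt (p $ i) * sqrt (p $ i)) * (F v $ i - v $ i) / v $ i"
      by (simp add: rho_def vsqrt_def del: sqrt_p_mult)
    also have "\<dots> = p $ i * F v $ i / v $ i - p $ i" using nz[of i]
      by (simp add: right_diff_distrib diff_divide_distrib)
    finally show "rho v $ i \<bullet> vsqrt p $ i = p $ i * F v $ i / v $ i - p $ i" .
  qed simp
  also have "\<dots> = (\<Sum>i\<in>UNIV. \<Sum>j\<in>UNIV. B $ i $ j / v $ i * col_harm v $ j) - (\<Sum>i\<in>UNIV. p $ i)"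
  proof -
    have "p $ i * F v $ i = (\<Sum>j\<in>UNIV. B $ i $ j * col_harm v $ j)" for i
      by (simp add: F_def row_avg_def)
    thus ?thesis by (simp add: sum_subtractf sum_divide_distrib)
  qed
  also have "(\<Sum>i\<in>UNIV. \<Sum>j\<in>UNIV. B $ i $ j / v $ i * col_harm v $ j) = (\<Sum>j\<in>UNIV. (\<Sum>i\<in>UNIV. B $ i $ j / v $ i) * col_harm v $ j)"
    unfolding sum_distrib_right by (rule sum.swap)
  also have "\<dots> = (\<Sum>j\<in>UNIV. q $ j)"
    using col_denom_pos[OF v] by (intro sum.cong) (auto simp: col_harm_def less_imp_neq[symmetric])
  also have "\<dots> = (\<Sum>i\<in>UNIV. p $ i)"
    unfolding row[symmetric] col[symmetric] by (rule sum.swap)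
  finally show ?thesis by simp
qed

end

subsection \<open>Convergence\<close>

text \<open>Connectedness of the bipartite graph of rows and columns whose edges are the nonzero
  entries: \<open>X\<close> and \<open>Y\<close> are the rows and columns of a union of
  components.\<close>

locale connected_balanced_matrix = balanced_matrix B p q
  for B :: "real ^ 'm ^ 'n" and p :: "real ^ 'n" and q :: "real ^ 'm" +
  assumes connected: "(\<And>i j. B $ i $ j \<noteq> 0 \<Longrightarrow> i \<in> X \<longleftrightarrow> j \<in> Y) \<Longrightarrow> X = {} \<or> X = UNIV"
begin

text \<open>The sum of \<open>p / v\<close> is a Lyapunov function: the first half-step preserves it, and its
  decrease in the second half-step controls the spread of \<open>u\<close> over every nonzero entry.\<close>

lemma lyapunov_decrease:
  assumes v: "pos_vec v"
  defines "u \<equiv> col_harm v"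
  shows "(\<Sum>i\<in>UNIV. p $ i / v $ i) - (\<Sum>i\<in>UNIV. p $ i / F v $ i) =
    (\<Sum>i\<in>UNIV. \<Sum>j\<in>UNIV. B $ i $ j * ((u $ j - F v $ i)\<^sup>2 / (u $ j * (F v $ i)\<^sup>2)))"
proof -
  have u: "u $ j > 0" for j using pos_col_harm[OF v] by (auto simp: u_def pos_vec_def)
  have w: "F v $ i > 0" for i using pos_F[OF v] by (auto simp: pos_vec_def)
  have "(\<Sum>i\<in>UNIV. p $ i / v $ i) = (\<Sum>i\<in>UNIV. \<Sum>j\<in>UNIV. B $ i $ j / v $ i)"
    by (simp add: row[symmetric] sum_divide_distrib)
  also have "\<dots> = (\<Sum>j\<in>UNIV. \<Sum>i\<in>UNIV. B $ i $ j / v $ i)" by (rule sum.swap)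
  also have "\<dots> = (\<Sum>j\<in>UNIV. q $ j / u $ j)"
    using col_denom_pos[OF v] by (simp add: u_def col_harm_def)
  also have "\<dots> = (\<Sum>j\<in>UNIV. \<Sum>i\<in>UNIV. B $ i $ j * (1 / u $ j))"
    by (simp add: col[symmetric] sum_divide_distrib)
  also have "\<dots> = (\<Sum>i\<in>UNIV. \<Sum>j\<in>UNIV. B $ i $ j * (1 / u $ j))" by (rule sum.swap)
  finally have 1: "(\<Sum>i\<in>UNIV. p $ i / v $ i) = (\<Sum>i\<in>UNIV. \<Sum>j\<in>UNIV. B $ i $ j * (1 / u $ j))" .
  have "(\<Sum>j\<in>UNIV. B $ i $ j * (1 / u $ j)) - p $ i / F v $ i =
     (\<Sum>j\<in>UNIV. B $ i $ j * ((u $ j - F v $ i)\<^sup>2 / (u $ j * (F v $ i)\<^sup>2)))" for i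
  proof -
    define z where "z = F v $ i"
    have z: "z > 0" using w by (simp add: z_def)
    have pz: "p $ i * z = (\<Sum>j\<in>UNIV. B $ i $ j * u $ j)" by (simp add: z_def F_def row_avg_def u_def)
    \<comment> \<open>Expanding the square: summed over \<open>j\<close>, the terms with
      \<open>u $ j / z\<^sup>2\<close> and with \<open>1 / z\<close> give \<open>p $ i / z\<close>
      and \<open>- 2 * p $ i / z\<close>, because \<open>z\<close> is the weighted mean of
      \<open>u\<close>.\<close>
    have "B $ i $ j * ((u $ j - z)\<^sup>2 / (u $ j * z\<^sup>2)) =
        B $ i $ j * (1 / u $ j) + B $ i $ j * u $ j / z\<^sup>2 - 2 * (B $ i $ j / z)" for j
      using u[of j] z by (simp add: field_simps power2_eq_square)
    hence "(\<Sum>j\<in>UNIV. B $ i $ j * ((u $ j - z)\<^sup>2 / (u $ j * z\<^sup>2))) =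
       (\<Sum>j\<in>UNIV. B $ i $ j * (1 / u $ j)) + (\<Sum>j\<in>UNIV. B $ i $ j * u $ j) / z\<^sup>2 - 2 * ((\<Sum>j\<in>UNIV. B $ i $ j) / z)"
      by (simp add: sum.distrib sum_subtractf sum_divide_distrib sum_distrib_left)
    also have "\<dots> = (\<Sum>j\<in>UNIV. B $ i $ j * (1 / u $ j)) - p $ i / z"
      unfolding row pz[symmetric] using z by (simp add: power2_eq_square)
    finally show ?thesis by (simp add: z_def)
  qed
  thus ?thesis unfolding 1 by (simp add: sum_subtractf[symmetric])
qed

text \<open>The Lyapunov values decrease and are nonnegative, hence their decrements tend to 0; each
  decrement is a sum of nonnegative terms, one for each entry.\<close>

lemma edge_difference_tendsto_0:
  assumes v: "pos_vec v" and e: "B $ i $ j \<noteq> 0"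
  shows "(\<lambda>t. col_harm ((F ^^ t) v) $ j - (F ^^ Suc t) v $ i) \<longlonglongrightarrow> 0"
proof -
  define a b where "a = Min (range (($) v))" and "b = Max (range (($) v))"
  have a: "0 < a" using pos_between[OF v] by (simp add: a_def)
  have bt: "between a b ((F ^^ t) v)" for t unfolding a_def b_def
    by (rule iter_between[OF between_Min_Max pos_between[OF v]])
  define Y where "Y t = (\<Sum>i\<in>UNIV. p $ i / (F ^^ t) v $ i)" for t
  define \<delta> where "\<delta> t = col_harm ((F ^^ t) v) $ j - (F ^^ Suc t) v $ i" for t
  \<comment> \<open>A lower bound for the coefficient of the squared difference, as its denominator
    consists of three orbit values not exceeding \<open>b\<close>.\<close>
  define K where "K = B $ i $ j / (b * b\<^sup>2)"
  have b: "0 < b" using a bt[of 0] unfolding between_def by (meson less_le_trans order_trans)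
  have K: "0 < K" using e B0[of i j] b by (simp add: K_def)
  have main: "K * (\<delta> t)\<^sup>2 \<le> Y t - Y (Suc t)" for t
  proof -
    define w where "w = (F ^^ t) v"
    have pw: "pos_vec w" unfolding w_def by (rule pos_iter[OF v])
    have bw: "between a b w" "between a b (col_harm w)" "between a b (F w)"
      using bt[of t] a col_harm_between F_between by (auto simp: w_def)
    have u: "0 < col_harm w $ j" "0 < F w $ i" for i j
      using bw a by (auto simp: between_def intro: less_le_trans)
    define T where "T i j = B $ i $ j * ((col_harm w $ j - F w $ i)\<^sup>2 / (col_harm w $ j * (F w $ i)\<^sup>2))" for i j
    have T0: "0 \<le> T i j" for i j using B0[of i j] u(1)[of j] u(2)[of i] by (simp add: T_def)
    have "K * (\<delta> t)\<^sup>2 = B $ i $ j * ((col_harm w $ j - F w $ i)\<^sup>2 / (b * b\<^sup>2))"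
      by (simp add: K_def \<delta>_def w_def)
    also have "\<dots> \<le> T i j" unfolding T_def
      using bw u(1)[of j] u(2)[of i] B0[of i j] b
      by (intro mult_left_mono divide_left_mono mult_mono power_mono) (auto simp: between_def less_imp_le)
    also have "\<dots> \<le> (\<Sum>j\<in>UNIV. T i j)" using T0 by (intro member_le_sum) auto
    also have "\<dots> \<le> (\<Sum>i\<in>UNIV. \<Sum>j\<in>UNIV. T i j)"
      using T0 by (intro member_le_sum[where f = "\<lambda>i. \<Sum>j\<in>UNIV. T i j"]) (auto intro: sum_nonneg)
    also have "\<dots> = Y t - Y (Suc t)"
      using lyapunov_decrease[OF pw] by (simp add: T_def Y_def w_def)
    finally show ?thesis .
  qed
  have "decseq Y"
  proof (rule decseq_SucI)
    fix t show "Y (Suc t) \<le> Y t" using main[of t] K by (smt (verit) mult_nonneg_nonneg zero_le_power2)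
  qed
  moreover have "0 \<le> Y t" for t unfolding Y_def
    using pos_iter[OF v] p0 by (intro sum_nonneg divide_nonneg_nonneg) (auto simp: pos_vec_def less_imp_le)
  ultimately obtain L where L: "Y \<longlonglongrightarrow> L" using decseq_convergent by metis
  have "(\<lambda>t. (Y t - Y (Suc t)) / K) \<longlonglongrightarrow> (L - L) / K"
    using K by (intro tendsto_intros L LIMSEQ_Suc) auto
  hence Y0: "(\<lambda>t. (Y t - Y (Suc t)) / K) \<longlonglongrightarrow> 0" by simp
  have "(\<lambda>t. (\<delta> t)\<^sup>2) \<longlonglongrightarrow> 0"
    using main K by (intro tendsto_sandwich[OF _ _ tendsto_const Y0]) (auto simp: field_simps)
  from tendsto_real_sqrt[OF this] have "(\<lambda>t. \<bar>\<delta> t\<bar>) \<longlonglongrightarrow> 0" by simp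
  thus ?thesis unfolding \<delta>_def by (rule tendsto_rabs_zero_cancel)
qed

lemma iter_spread_tendsto_0:
  assumes v: "pos_vec v"
  shows "(\<lambda>t. (F ^^ t) v $ i - (F ^^ t) v $ i0) \<longlonglongrightarrow> 0"
proof -
  \<comment> \<open>Rows and columns that asymptotically agree with row \<open>i0\<close>. The shift
    \<open>Suc t\<close> matches rows with the columns from which they are averaged; it is removed
    at the end.\<close>
  define X where "X = {i. (\<lambda>t. (F ^^ Suc t) v $ i - (F ^^ Suc t) v $ i0) \<longlonglongrightarrow> 0}"
  define Y where "Y = {j. (\<lambda>t. col_harm ((F ^^ t) v) $ j - (F ^^ Suc t) v $ i0) \<longlonglongrightarrow> 0}"
  have "i \<in> X \<longleftrightarrow> j \<in> Y" if e: "B $ i $ j \<noteq> 0" for i j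
  proof
    assume "i \<in> X"
    hence "(\<lambda>t. (F ^^ Suc t) v $ i - (F ^^ Suc t) v $ i0) \<longlonglongrightarrow> 0" by (simp add: X_def)
    from tendsto_add[OF edge_difference_tendsto_0[OF v e] this] show "j \<in> Y" by (simp add: Y_def)
  next
    assume "j \<in> Y"
    hence "(\<lambda>t. col_harm ((F ^^ t) v) $ j - (F ^^ Suc t) v $ i0) \<longlonglongrightarrow> 0" by (simp add: Y_def)
    from tendsto_diff[OF this edge_difference_tendsto_0[OF v e]] show "i \<in> X" by (simp add: X_def)
  qed
  hence "X = {} \<or> X = UNIV" by (rule connected)
  moreover have "i0 \<in> X" by (simp add: X_def)
  ultimately have "i \<in> X" by blast
  thus ?thesis unfolding X_def mem_Collect_eq by (rule LIMSEQ_imp_Suc)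
qed

text \<open>The largest coordinate is nonincreasing and bounded below by the initial minimum, so it
  converges to a positive number; the vanishing spread forces the other coordinates to the same
  limit.\<close>

lemma iter_tendsto_const:
  assumes v: "pos_vec v"
  obtains \<kappa> where "0 < \<kappa>" "\<And>i. (\<lambda>t. (F ^^ t) v $ i) \<longlonglongrightarrow> \<kappa>"
proof -
  define M where "M t = Max (range (($) ((F ^^ t) v)))" for t
  define a where "a = Min (range (($) v))"
  have a: "0 < a" using pos_between[OF v] by (simp add: a_def)
  have lo: "a \<le> (F ^^ t) v $ i" for t i
    using iter_between[OF between_Min_Max pos_between[OF v]] by (auto simp: between_def a_def)
  have M: "(F ^^ t) v $ i \<le> M t" for t i by (simp add: M_def)
  have "decseq M"
  proof (rule decseq_SucI)
    fix t
    have "between (Min (range (($) ((F ^^ t) v)))) (M t) (F ((F ^^ t) v))"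
      unfolding M_def by (rule F_between[OF between_Min_Max pos_between[OF pos_iter[OF v]]])
    thus "M (Suc t) \<le> M t" by (auto simp: M_def between_def)
  qed
  moreover have aM: "a \<le> M t" for t using lo M order_trans by blast
  ultimately obtain \<kappa> where \<kappa>: "M \<longlonglongrightarrow> \<kappa>" using decseq_convergent by metis
  have "a \<le> \<kappa>" using LIMSEQ_le_const[OF \<kappa>] aM by blast
  moreover have "(\<lambda>t. (F ^^ t) v $ i) \<longlonglongrightarrow> \<kappa>" for i
  proof -
    define s where "s t = (\<Sum>k\<in>UNIV. \<bar>(F ^^ t) v $ k - (F ^^ t) v $ i\<bar>)" for t
    have "s \<longlonglongrightarrow> (\<Sum>k\<in>(UNIV :: 'n set). \<bar>0\<bar>)" unfolding s_def
      by (intro tendsto_sum tendsto_rabs iter_spread_tendsto_0[OF v])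
    from tendsto_diff[OF \<kappa> this] have Ms: "(\<lambda>t. M t - s t) \<longlonglongrightarrow> \<kappa>" by simp
    have sM: "M t - s t \<le> (F ^^ t) v $ i" for t
    proof -
      have "M t \<in> range (($) ((F ^^ t) v))" unfolding M_def by (rule Max_in) auto
      then obtain k where k: "M t = (F ^^ t) v $ k" by auto
      have "\<bar>(F ^^ t) v $ k - (F ^^ t) v $ i\<bar> \<le> s t" unfolding s_def by (intro member_le_sum) auto
      thus ?thesis using k by linarith
    qed
    show ?thesis by (rule tendsto_sandwich[OF _ _ Ms \<kappa>]) (simp_all add: sM M)
  qed
  ultimately show thesis using that a by (meson less_le_trans)
qed

end

subsection \<open>Negligible sets of initial values\<close>

text \<open>The translates of \<open>K\<close> by \<open>e / (n + 1)\<close> are pairwise disjoint,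
  have equal measure and lie in one ball, so this measure is 0. No Fubini argument along the lines
  is required.\<close>

lemma negligible_if_lines_meet_once:
  fixes K :: "'a::euclidean_space set"
  assumes K: "compact K" and line: "\<And>x s. x \<in> K \<Longrightarrow> x + s *\<^sub>R e \<in> K \<Longrightarrow> s = 0"
  shows "negligible K"
proof -
  define A where "A n = (+) ((1 / real (Suc n)) *\<^sub>R e) ` K" for n
  have Kl: "K \<in> lmeasurable" using K by (rule lmeasurable_compact)
  have Al: "A n \<in> lmeasurable" for n unfolding A_def using Kl by (rule measurable_translation)
  have Am: "measure lebesgue (A n) = measure lebesgue K" for n unfolding A_def by (rule measure_translation)
  have disj: "disjoint_family_on A I" for I
    unfolding disjoint_family_on_def
  proof (intro ballI impI)
    fix m n :: nat assume "m \<noteq> n"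
    show "A m \<inter> A n = {}"
    proof (rule ccontr)
      assume "A m \<inter> A n \<noteq> {}"
      then obtain x y where xy: "x \<in> K" "y \<in> K"
        "(1 / real (Suc m)) *\<^sub>R e + x = (1 / real (Suc n)) *\<^sub>R e + y" by (auto simp: A_def)
      hence "y = x + (1 / real (Suc m) - 1 / real (Suc n)) *\<^sub>R e" by (simp add: algebra_simps)
      hence "1 / real (Suc m) - 1 / real (Suc n) = 0" using line xy(1,2) by metis
      hence "real (Suc m) = real (Suc n)" by simp
      with \<open>m \<noteq> n\<close> show False by simp
    qed
  qed
  obtain R where R: "\<And>x. x \<in> K \<Longrightarrow> norm x \<le> R" using compact_imp_bounded[OF K] by (auto simp: bounded_iff)
  define D where "D = cball (0::'a) (R + norm e)"
  have AD: "A n \<subseteq> D" for n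
  proof
    fix y assume "y \<in> A n"
    then obtain x where x: "x \<in> K" "y = (1 / real (Suc n)) *\<^sub>R e + x" by (auto simp: A_def)
    have "norm y \<le> norm ((1 / real (Suc n)) *\<^sub>R e) + norm x" unfolding x(2) by (rule norm_triangle_ineq)
    also have "norm ((1 / real (Suc n)) *\<^sub>R e) \<le> norm e"
      by (simp add: divide_le_eq mult_le_cancel_left1)
    finally show "y \<in> D" using R[OF x(1)] by (simp add: D_def)
  qed
  have Dl: "D \<in> lmeasurable" by (simp add: D_def lmeasurable_compact)
  have bd: "real n * measure lebesgue K \<le> measure lebesgue D" for n
  proof -
    have "real n * measure lebesgue K = (\<Sum>i<n. measure lebesgue (A i))" by (simp add: Am)
    also have "\<dots> = measure lebesgue (\<Union>i\<in>{..<n}. A i)"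
    proof (rule measure_finite_Union[symmetric])
      show "A ` {..<n} \<subseteq> sets lebesgue" using Al by (auto intro: fmeasurableD)
      show "emeasure lebesgue (A i) \<noteq> \<infinity>" for i using fmeasurableD2[OF Al] by auto
    qed (use disj in auto)
    also have "\<dots> \<le> measure lebesgue D"
      using AD Al Dl by (intro measure_mono_fmeasurable) (auto simp: fmeasurableD)
    finally show ?thesis .
  qed
  have "measure lebesgue K = 0"
  proof (rule ccontr)
    assume "measure lebesgue K \<noteq> 0"
    hence "0 < measure lebesgue K" by (simp add: zero_less_measure_iff)
    then obtain n where "measure lebesgue D < real n * measure lebesgue K"
      using reals_Archimedean3 by blast
    with bd[of n] show False by simp
  qed
  thus ?thesis using Kl by (simp add: negligible_iff_measure0)
qed

lemma geometric_increments_bound: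
  fixes x :: "nat \<Rightarrow> real"
  assumes inc: "\<And>t. \<bar>x (Suc t) - x t\<bar> \<le> D * mu ^ t" and lim: "x \<longlonglongrightarrow> L" and mu: "0 \<le> mu" "mu < 1"
  shows "\<bar>x t - L\<bar> \<le> D / (1 - mu) * mu ^ t"
proof -
  have D: "0 \<le> D" using inc[of 0] by simp
  have "\<bar>x (t + k) - x t\<bar> \<le> D * mu ^ t * (\<Sum>i<k. mu ^ i)" for k
  proof (induction k)
    case (Suc k)
    have "\<bar>x (t + Suc k) - x t\<bar> \<le> \<bar>x (Suc (t + k)) - x (t + k)\<bar> + \<bar>x (t + k) - x t\<bar>" by simp
    also have "\<dots> \<le> D * mu ^ (t + k) + D * mu ^ t * (\<Sum>i<k. mu ^ i)" using Suc inc by (intro add_mono)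
    finally show ?case by (simp add: power_add algebra_simps)
  qed simp
  moreover have "(\<Sum>i<k. mu ^ i) \<le> 1 / (1 - mu)" for k
  proof -
    have "(\<Sum>i<k. mu ^ i) = (1 - mu ^ k) / (1 - mu)" using mu by (simp add: sum_gp_strict)
    also have "\<dots> \<le> 1 / (1 - mu)" using mu by (intro divide_right_mono) auto
    finally show ?thesis .
  qed
  ultimately have bd: "\<bar>x (t + k) - x t\<bar> \<le> D * mu ^ t * (1 / (1 - mu))" for k
    using D mu by (meson mult_left_mono mult_nonneg_nonneg order_trans zero_le_power)
  have "(\<lambda>k. \<bar>x (k + t) - x t\<bar>) \<longlonglongrightarrow> \<bar>L - x t\<bar>"
    by (intro tendsto_intros LIMSEQ_ignore_initial_segment lim)
  from LIMSEQ_le_const2[OF this, of "D * mu ^ t * (1 / (1 - mu))"] bd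
  show ?thesis by (simp add: add.commute abs_minus_commute)
qed

text \<open>The equations are the normal equations of a weighted least squares problem, which is solved by
  an orthogonal projection; so \<open>X\<^sup>T D X\<close> has the same range as \<open>X\<^sup>T\<close>.\<close>

lemma weighted_normal_equation:
  fixes X :: "'i::finite \<Rightarrow> 'j::finite \<Rightarrow> real" and \<delta> :: "'i \<Rightarrow> real"
  assumes \<delta>: "\<And>i. 0 < \<delta> i"
  obtains x :: "real ^ 'j" where
    "\<And>j. (\<Sum>i\<in>UNIV. X i j * (\<delta> i * (\<Sum>k\<in>UNIV. X i k * x $ k))) = (\<Sum>i\<in>UNIV. X i j * z i)"
proof -
  define L :: "real ^ 'j \<Rightarrow> real ^ 'i" where "L x = (\<chi> i. sqrt (\<delta> i) * (\<Sum>k\<in>UNIV. X i k * x $ k))" for x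
  define g :: "real ^ 'i" where "g = (\<chi> i. z i / sqrt (\<delta> i))"
  have lin: "linear L"
    by (rule linearI) (simp_all add: L_def vec_eq_iff sum.distrib sum_distrib_left algebra_simps)
  have "span (range L) = range L" using linear_subspace_image[OF lin subspace_UNIV] by (rule span_eq_iff[THEN iffD2])
  then obtain y r where y: "y \<in> range L" and r: "\<And>w. w \<in> range L \<Longrightarrow> orthogonal r w" and g: "g = y + r"
    using orthogonal_subspace_decomp_exists[of "range L" g] by metis
  obtain x where x: "y = L x" using y by auto
  have "(\<Sum>i\<in>UNIV. X i j * (\<delta> i * (\<Sum>k\<in>UNIV. X i k * x $ k))) = (\<Sum>i\<in>UNIV. X i j * z i)" for j
  proof -
    \<comment> \<open>Testing the orthogonality of the remainder on the image of a unit vector is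
      the \<open>j\<close>-th normal equation.\<close>
    have "0 = r \<bullet> L (axis j 1)" using r by (simp add: orthogonal_def)
    also have "L (axis j 1) = (\<chi> i. sqrt (\<delta> i) * X i j)"
      by (simp add: L_def axis_def if_distrib[of "\<lambda>x. _ * x"] cong: if_cong)
    also have "r = g - L x" using g x by simp
    also have "(g - L x) \<bullet> (\<chi> i. sqrt (\<delta> i) * X i j) =
        (\<Sum>i\<in>UNIV. X i j * z i - X i j * (\<delta> i * (\<Sum>k\<in>UNIV. X i k * x $ k)))"
      unfolding inner_vec_def
    proof (rule sum.cong)
      fix i
      define s where "s = sqrt (\<delta> i)"
      have s: "s \<noteq> 0" "s * s = \<delta> i" using \<delta>[of i] by (auto simp: s_def)
      show "(g - L x) $ i \<bullet> (\<chi> i. sqrt (\<delta> i) * X i j) $ i =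
          X i j * z i - X i j * (\<delta> i * (\<Sum>k\<in>UNIV. X i k * x $ k))"
        unfolding s(2)[symmetric] using s(1) by (simp add: g_def L_def s_def[symmetric] algebra_simps)
    qed simp
    finally show ?thesis by (simp add: sum_subtractf)
  qed
  thus thesis by (rule that)
qed

context spectral_splitting
begin

text \<open>Orthogonality of \<open>y\<close> and \<open>s\<close> lets the norm of the main part
  \<open>\<alpha> *\<^sub>R y + \<beta> *\<^sub>R s\<close> dominate both summands. Relative errors
  of 1/4 in each then add up to at most half of it, which leaves at least the other half in the
  upper part.\<close>

lemma near_upper_plane_in_cone:
  assumes upfix: "up y = y" "up s = s" and orth: "y \<bullet> s = 0"
    and r: "4 * norm r1 \<le> norm y" "4 * norm r2 \<le> norm s"
    and x: "x = \<alpha> *\<^sub>R (y + r1) + \<beta> *\<^sub>R (s + r2)"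
  shows "norm (x - up x) \<le> norm (up x)" and "y \<noteq> 0 \<Longrightarrow> up x = 0 \<Longrightarrow> \<alpha> = 0"
proof -
  define m where "m = \<alpha> *\<^sub>R y + \<beta> *\<^sub>R s"
  define r where "r = \<alpha> *\<^sub>R r1 + \<beta> *\<^sub>R r2"
  have "(norm m)\<^sup>2 = (norm (\<alpha> *\<^sub>R y))\<^sup>2 + (norm (\<beta> *\<^sub>R s))\<^sup>2"
    unfolding m_def by (rule norm_add_Pythagorean) (simp add: orthogonal_def orth)
  hence m1: "norm (\<alpha> *\<^sub>R y) \<le> norm m" "norm (\<beta> *\<^sub>R s) \<le> norm m"
    by (smt (verit) norm_ge_zero power2_le_imp_le zero_le_power2)+
  have "norm r \<le> \<bar>\<alpha>\<bar> * norm r1 + \<bar>\<beta>\<bar> * norm r2"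
    unfolding r_def by (metis norm_scaleR norm_triangle_ineq)
  moreover have "4 * (\<bar>\<alpha>\<bar> * norm r1) \<le> norm m"
    using mult_left_mono[OF r(1), of "\<bar>\<alpha>\<bar>"] m1(1) by simp
  moreover have "4 * (\<bar>\<beta>\<bar> * norm r2) \<le> norm m"
    using mult_left_mono[OF r(2), of "\<bar>\<beta>\<bar>"] m1(2) by simp
  ultimately have rm: "2 * norm r \<le> norm m" by linarith
  have xm: "x = m + r" by (simp add: x m_def r_def algebra_simps)
  have ux: "up x = m + up r"
    by (simp add: xm m_def linear_add[OF lin] linear_cmul[OF lin] upfix)
  have lo: "norm m \<le> 2 * norm (up x)"
    using norm_diff_ineq[of m "up r"] norm_up_le[of r] rm ux by simp
  have "x - up x = r - up r" by (simp add: xm ux[unfolded xm])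
  hence "norm (x - up x) \<le> norm r" using norm_low_le[of r] by simp
  thus "norm (x - up x) \<le> norm (up x)" using rm lo by linarith
  assume "y \<noteq> 0" "up x = 0"
  hence "norm m = 0" using lo by simp
  hence "norm (\<alpha> *\<^sub>R y) = 0" using m1(1) norm_ge_zero[of "\<alpha> *\<^sub>R y"] by linarith
  thus "\<alpha> = 0" using \<open>y \<noteq> 0\<close> by simp
qed

end

section \<open>Continuity of the iteration, and surjectivity of its derivative on the range of
  \<open>row_avg\<close>\<close>

context balanced_matrix
begin

lemma tendsto_row_avg: "(U \<longlongrightarrow> u) G \<Longrightarrow> ((\<lambda>x. row_avg (U x)) \<longlongrightarrow> row_avg u) G"
  unfolding row_avg_def by (intro tendsto_intros) auto

lemma tendsto_col_harm:
  assumes "(V \<longlongrightarrow> v) G" "pos_vec v"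
  shows "((\<lambda>x. col_harm (V x)) \<longlongrightarrow> col_harm v) G"
  unfolding col_harm_def using assms col_denom_pos[OF assms(2)]
  by (intro tendsto_intros) (auto simp: pos_vec_def less_imp_neq[symmetric])

lemma tendsto_F: "(V \<longlongrightarrow> v) G \<Longrightarrow> pos_vec v \<Longrightarrow> ((\<lambda>x. F (V x)) \<longlongrightarrow> F v) G"
  unfolding F_def by (intro tendsto_row_avg tendsto_col_harm)

lemma tendsto_iter: "(V \<longlongrightarrow> v) G \<Longrightarrow> pos_vec v \<Longrightarrow> ((\<lambda>x. (F ^^ t) (V x)) \<longlongrightarrow> (F ^^ t) v) G"
  by (induction t) (auto intro: tendsto_F pos_iter)

lemma tendsto_rho: "(V \<longlongrightarrow> v) G \<Longrightarrow> pos_vec v \<Longrightarrow> ((\<lambda>x. rho (V x)) \<longlongrightarrow> rho v) G"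
  unfolding rho_def by (intro tendsto_intros tendsto_F) (auto simp: pos_vec_def less_imp_neq[symmetric])

lemma tendsto_wt: "(V \<longlongrightarrow> v) G \<Longrightarrow> ((\<lambda>x. wt (V x)) \<longlongrightarrow> wt v) G"
  unfolding wt_def by (intro tendsto_intros) auto

text \<open>Difference quotient operator of \<open>F\<close>; on the diagonal it is the derivative.\<close>

definition dF :: "real ^ 'n \<Rightarrow> real ^ 'n \<Rightarrow> real ^ 'n \<Rightarrow> real ^ 'n" where
  "dF v w x = (\<chi> i. \<Sum>j\<in>UNIV. \<Sum>k\<in>UNIV. B $ i $ j * B $ k $ j / (p $ i * q $ j) *
    (col_harm v $ j * col_harm w $ j / (v $ k * w $ k)) * x $ k)"

text \<open>The chain rule along two orbits at once: it gives exact differences of iterates, and for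
  \<open>v = w\<close> the derivative of the iterate.\<close>

primrec dF_iter :: "real ^ 'n \<Rightarrow> real ^ 'n \<Rightarrow> nat \<Rightarrow> real ^ 'n \<Rightarrow> real ^ 'n" where
  "dF_iter v w 0 x = x"
| "dF_iter v w (Suc t) x = dF ((F ^^ t) v) ((F ^^ t) w) (dF_iter v w t x)"

lemma dF_diff: "pos_vec v \<Longrightarrow> pos_vec w \<Longrightarrow> F v - F w = dF v w (v - w)"
  using F_diff[of v w] by (simp add: vec_eq_iff dF_def)

lemma dF_iter_diff: "pos_vec v \<Longrightarrow> pos_vec w \<Longrightarrow> (F ^^ t) v - (F ^^ t) w = dF_iter v w t (v - w)"
proof (induction t)
  case (Suc t)
  thus ?case using dF_diff[OF pos_iter[OF Suc.prems(1)] pos_iter[OF Suc.prems(2)], of t t] by simp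
qed simp

lemma dF_iter_scaleR: "dF_iter v w t (c *\<^sub>R x) = c *\<^sub>R dF_iter v w t x"
  by (induction t) (simp_all add: dF_def vec_eq_iff sum_distrib_left mult_ac)

lemma tendsto_dF_iter:
  assumes "(V \<longlongrightarrow> v) G" "(W \<longlongrightarrow> w) G" "pos_vec v" "pos_vec w"
  shows "((\<lambda>a. dF_iter (V a) (W a) t x) \<longlongrightarrow> dF_iter v w t x) G"
proof (induction t)
  case (Suc t)
  have "pos_vec ((F ^^ t) v)" "pos_vec ((F ^^ t) w)" using assms pos_iter by auto
  moreover have "((\<lambda>a. (F ^^ t) (V a)) \<longlongrightarrow> (F ^^ t) v) G" "((\<lambda>a. (F ^^ t) (W a)) \<longlongrightarrow> (F ^^ t) w) G"
    using assms tendsto_iter by auto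
  ultimately show ?case unfolding dF_iter.simps dF_def using Suc
    by (intro tendsto_intros tendsto_col_harm) (auto simp: pos_vec_def less_imp_neq[symmetric])
qed simp

text \<open>The derivative at \<open>v\<close> is a product of B, a positive diagonal matrix, the
  transpose of B and another positive diagonal matrix. Solving one normal equation for B and one for
  its transpose shows that it maps the range of \<open>row_avg\<close> onto itself, although
  \<open>row_avg\<close> need not be surjective.\<close>

lemma dF_range:
  assumes v: "pos_vec v" and z: "z \<in> range row_avg"
  shows "\<exists>y\<in>range row_avg. dF v v y = z"
proof -
  obtain w where w: "z = row_avg w" using z by auto
  have u: "0 < col_harm v $ j" for j using pos_col_harm[OF v] by (auto simp: pos_vec_def)
  have v0: "0 < v $ k" for k using v by (auto simp: pos_vec_def)
  obtain a :: "real ^ 'n" where a: "\<And>i. (\<Sum>j\<in>UNIV. B $ i $ j * ((col_harm v $ j)\<^sup>2 / q $ j * (\<Sum>k\<in>UNIV. B $ k $ j * a $ k)))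
      = (\<Sum>j\<in>UNIV. B $ i $ j * w $ j)"
    by (rule weighted_normal_equation[of "\<lambda>j. (col_harm v $ j)\<^sup>2 / q $ j" "\<lambda>j i. B $ i $ j" "\<lambda>j. w $ j"])
      (use u q0 in \<open>auto simp: less_imp_neq[symmetric]\<close>)
  obtain b :: "real ^ 'm" where b: "\<And>j. (\<Sum>k\<in>UNIV. B $ k $ j * (1 / ((v $ k)\<^sup>2 * p $ k) * (\<Sum>l\<in>UNIV. B $ k $ l * b $ l)))
      = (\<Sum>k\<in>UNIV. B $ k $ j * a $ k)"
    by (rule weighted_normal_equation[of "\<lambda>k. 1 / ((v $ k)\<^sup>2 * p $ k)" "\<lambda>k j. B $ k $ j" "\<lambda>k. a $ k"])
      (use v0 p0 in \<open>auto simp: less_imp_neq[symmetric]\<close>)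
  have "dF v v (row_avg b) $ i = z $ i" for i
  proof -
    have "dF v v (row_avg b) $ i = (\<Sum>j\<in>UNIV. B $ i $ j * ((col_harm v $ j)\<^sup>2 / q $ j *
       (\<Sum>k\<in>UNIV. B $ k $ j * (1 / ((v $ k)\<^sup>2 * p $ k) * (\<Sum>l\<in>UNIV. B $ k $ l * b $ l))))) / p $ i"
      unfolding dF_def sum_divide_distrib sum_distrib_left row_avg_def
      by (simp add: power2_eq_square mult_ac sum_distrib_left sum_distrib_right sum_divide_distrib)
    also have "\<dots> = z $ i" unfolding b a by (simp add: w row_avg_def)
    finally show ?thesis .
  qed
  thus ?thesis by (intro bexI[of _ "row_avg b"] rangeI) (simp add: vec_eq_iff)
qed

lemma dF_iter_range:
  assumes v: "pos_vec v" and z: "z \<in> range row_avg"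
  shows "\<exists>e. dF_iter v v t (row_avg e) = z"
  using z
proof (induction t arbitrary: z)
  case (Suc t)
  obtain y where "y \<in> range row_avg" "dF ((F ^^ t) v) ((F ^^ t) v) y = z"
    using dF_range[OF pos_iter[OF v] Suc.prems] by blast
  with Suc.IH show ?case by (metis dF_iter.simps(2))
qed auto

text \<open>For \<open>lam \<noteq> 0\<close> an eigenvector of \<open>N ** transpose N\<close> is
  in the range of \<open>N\<close>, which is the range of \<open>row_avg\<close> weighted by
  \<open>wt\<close>.\<close>

lemma eigenvector_in_range:
  assumes y: "S *v y = lam *\<^sub>R y" and "lam \<noteq> 0"
  obtains z where "z \<in> range row_avg" "wt z = y"
proof -
  define x where "x = (1 / lam) *\<^sub>R (transpose N *v y)"
  have Nx: "N *v x = y"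
    using y assms(2) unfolding x_def matrix_vector_mult_scaleR matrix_vector_mul_assoc S_def by simp
  define u where "u = (\<chi> j. x $ j / sqrt (q $ j))"
  have "wt (row_avg u) $ i = y $ i" for i
  proof -
    have s: "sqrt (p $ i) / p $ i = 1 / sqrt (p $ i)" using p0[of i] by (simp add: field_simps)
    have "wt (row_avg u) $ i = (sqrt (p $ i) / p $ i) * (\<Sum>j\<in>UNIV. B $ i $ j * u $ j)"
      by (simp add: wt_def row_avg_def)
    also have "\<dots> = (N *v x) $ i"
      unfolding s matrix_vector_mult_def
      by (simp add: N_entry u_def sum_divide_distrib mult_ac)
    finally show ?thesis by (simp add: Nx)
  qed
  hence "wt (row_avg u) = y" by (simp add: vec_eq_iff)
  thus thesis using that by blast
qed

end

section \<open>Exceptional starting points\<close>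

context connected_balanced_matrix
begin

definition fast_decay :: "real \<Rightarrow> real ^ 'n \<Rightarrow> bool" where
  "fast_decay mu v \<longleftrightarrow> (\<exists>C. \<forall>t. norm (rho ((F ^^ t) v)) \<le> C * mu ^ t)"

lemma linear_wt: "linear wt"
  by (rule linearI) (simp_all add: wt_def vec_eq_iff algebra_simps)

lemma rho_asymptotically_linear:
  assumes v: "pos_vec v"
  obtains th where "th \<longlonglongrightarrow> 0" "\<And>t. 0 \<le> th t"
    "\<And>t. norm (rho ((F ^^ Suc t) v) - S *v rho ((F ^^ t) v)) \<le> th t * norm (rho ((F ^^ t) v))"
proof -
  obtain \<kappa> where \<kappa>: "0 < \<kappa>" "\<And>i. (\<lambda>t. (F ^^ t) v $ i) \<longlonglongrightarrow> \<kappa>" using iter_tendsto_const[OF v] by blast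
  \<comment> \<open>The sum over all pairs dominates the bound for the maximal and minimal
    coordinate, and its limit follows from coordinatewise convergence alone.\<close>
  define th where "th t = (\<Sum>i\<in>UNIV. \<Sum>j\<in>UNIV. \<bar>((F ^^ t) v $ i / (F ^^ t) v $ j)\<^sup>2 - 1\<bar>)" for t
  have "th \<longlonglongrightarrow> (\<Sum>i\<in>(UNIV::'n set). \<Sum>j\<in>(UNIV::'n set). \<bar>(\<kappa> / \<kappa>)\<^sup>2 - 1\<bar>)" unfolding th_def
    using \<kappa>(1) by (intro tendsto_intros \<kappa>(2)) auto
  hence "th \<longlonglongrightarrow> 0" using \<kappa>(1) by simp
  moreover have "0 \<le> th t" for t unfolding th_def by (intro sum_nonneg) auto
  moreover have "norm (rho ((F ^^ Suc t) v) - S *v rho ((F ^^ t) v)) \<le> th t * norm (rho ((F ^^ t) v))" for t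
  proof -
    define w where "w = (F ^^ t) v"
    have w: "pos_vec w" unfolding w_def by (rule pos_iter[OF v])
    have "Max (range (($) w)) \<in> range (($) w)" "Min (range (($) w)) \<in> range (($) w)"
      by (intro Max_in Min_in; simp)+
    then obtain i j where i: "Max (range (($) w)) = w $ i" and j: "Min (range (($) w)) = w $ j"
      by blast
    have "norm (rho (F w) - S *v rho w) \<le> ((w $ i / w $ j)\<^sup>2 - 1) * norm (rho w)"
      using rho_step[OF between_Min_Max pos_between[OF w]] unfolding i j .
    also have "(w $ i / w $ j)\<^sup>2 - 1 \<le> \<bar>(w $ i / w $ j)\<^sup>2 - 1\<bar>" by simp
    also have "\<dots> \<le> (\<Sum>j\<in>UNIV. \<bar>(w $ i / w $ j)\<^sup>2 - 1\<bar>)" by (intro member_le_sum) auto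
    also have "\<dots> \<le> th t" unfolding th_def w_def[symmetric]
      by (intro member_le_sum[where f = "\<lambda>i. \<Sum>j\<in>UNIV. \<bar>(w $ i / w $ j)\<^sup>2 - 1\<bar>"]) (auto intro: sum_nonneg)
    finally show ?thesis by (simp add: w_def mult_right_mono)
  qed
  ultimately show thesis using that by blast
qed

text \<open>\<open>rho\<close> measures relative increments. As the orbit is bounded, its increments
  decay like \<open>mu ^ t\<close> and summing them bounds the distance to the limit; homogeneity
  moves this limit to 1.\<close>

lemma fast_decay_normalized:
  assumes v: "pos_vec v" and fast: "fast_decay mu v" and mu: "0 \<le> mu" "mu < 1"
    and \<kappa>: "0 < \<kappa>" "\<And>i. (\<lambda>t. (F ^^ t) v $ i) \<longlonglongrightarrow> \<kappa>"
  shows "\<exists>C. \<forall>t. norm (wt ((F ^^ t) ((1 / \<kappa>) *\<^sub>R v) - vec 1)) \<le> C * mu ^ t"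
proof -
  obtain C where C: "\<And>t. norm (rho ((F ^^ t) v)) \<le> C * mu ^ t" using fast by (auto simp: fast_decay_def)
  define b where "b = Max (range (($) v))"
  define D where "D i = C / sqrt (p $ i) * b" for i
  have bt: "0 < (F ^^ t) v $ i" "(F ^^ t) v $ i \<le> b" for t i
    using iter_between[OF between_Min_Max pos_between[OF v], of t] pos_iter[OF v, of t]
    by (auto simp: b_def between_def pos_vec_def)
  have d: "\<bar>(F ^^ Suc t) v $ i - (F ^^ t) v $ i\<bar> \<le> D i * mu ^ t" for i t
  proof -
    define w where "w = (F ^^ t) v"
    have w: "0 < w $ i" "w $ i \<le> b" using bt by (auto simp: w_def)
    have sp: "0 < sqrt (p $ i)" using p0 by simp
    have "\<bar>F w $ i - w $ i\<bar> = \<bar>rho w $ i\<bar> / sqrt (p $ i) * w $ i"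
      using w sp by (simp add: rho_def abs_mult)
    also have "\<dots> \<le> C * mu ^ t / sqrt (p $ i) * b"
      using w sp component_le_norm_cart[of "rho w" i] C[of t]
      by (intro mult_mono divide_right_mono) (auto simp: w_def intro: order_trans[OF norm_ge_zero C])
    finally show ?thesis by (simp add: D_def w_def mult_ac)
  qed
  define C' where "C' = (\<Sum>i\<in>UNIV. sqrt (p $ i) * (D i / (1 - mu)) / \<kappa>)"
  have "norm (wt ((F ^^ t) ((1 / \<kappa>) *\<^sub>R v) - vec 1)) \<le> C' * mu ^ t" for t
  proof -
    have "norm (wt ((F ^^ t) ((1 / \<kappa>) *\<^sub>R v) - vec 1)) \<le> (\<Sum>i\<in>UNIV. \<bar>wt ((F ^^ t) ((1 / \<kappa>) *\<^sub>R v) - vec 1) $ i\<bar>)"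
      by (rule norm_le_l1_cart)
    also have "\<dots> \<le> (\<Sum>i\<in>UNIV. sqrt (p $ i) * (D i / (1 - mu)) / \<kappa> * mu ^ t)"
    proof (rule sum_mono)
      fix i
      have "\<bar>wt ((F ^^ t) ((1 / \<kappa>) *\<^sub>R v) - vec 1) $ i\<bar> = sqrt (p $ i) * \<bar>(F ^^ t) v $ i - \<kappa>\<bar> / \<kappa>"
      proof -
        have "(F ^^ t) v $ i / \<kappa> - 1 = ((F ^^ t) v $ i - \<kappa>) / \<kappa>" using \<kappa>(1) by (simp add: field_simps)
        thus ?thesis using \<kappa>(1) p0[of i] by (simp add: iter_scaleR wt_def abs_mult)
      qed
      also have "\<dots> \<le> sqrt (p $ i) * (D i / (1 - mu) * mu ^ t) / \<kappa>"
        using \<kappa>(1) p0[of i] geometric_increments_bound[OF d \<kappa>(2) mu]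
        by (intro divide_right_mono mult_left_mono) (auto simp: less_imp_le)
      finally show "\<bar>wt ((F ^^ t) ((1 / \<kappa>) *\<^sub>R v) - vec 1) $ i\<bar> \<le> sqrt (p $ i) * (D i / (1 - mu)) / \<kappa> * mu ^ t"
        by simp
    qed
    also have "\<dots> = C' * mu ^ t" by (simp add: C'_def sum_distrib_right)
    finally show ?thesis .
  qed
  thus ?thesis by blast
qed

text \<open>Both orbits tend to the same constant vector at rate \<open>mu\<close>, so their
  difference decays like \<open>mu ^ t\<close>. In the cone its upper part would grow at least like
  \<open>(lam - 2 * eps) ^ k\<close>, a larger rate, unless that part is 0.\<close>

lemma fast_pair_off_cone:
  assumes sp: "spectral_splitting ((*v) S) up lam mu0"
    and eps: "0 \<le> eps" "4 * eps \<le> lam - mu0" and mu: "0 \<le> mu" "mu < lam - 2 * eps"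
    and v: "\<And>t. norm (wt ((F ^^ t) v - vec 1)) \<le> C * mu ^ t"
    and w: "\<And>t. norm (wt ((F ^^ t) w - vec 1)) \<le> D * mu ^ t"
    and btw: "between a b ((F ^^ T) v)" "between a b ((F ^^ T) w)" "0 < a" "(b / a)\<^sup>2 - 1 \<le> eps"
    and cone: "norm (wt ((F ^^ T) v - (F ^^ T) w) - up (wt ((F ^^ T) v - (F ^^ T) w)))
        \<le> norm (up (wt ((F ^^ T) v - (F ^^ T) w)))"
  shows "up (wt ((F ^^ T) v - (F ^^ T) w)) = 0"
proof -
  interpret sp: spectral_splitting "(*v) S" up lam mu0 by (rule sp)
  define x where "x t = wt ((F ^^ t) v - (F ^^ t) w)" for t
  have step: "norm (x (Suc t) - S *v x t) \<le> eps * norm (x t)" if "T \<le> t" for t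
  proof -
    obtain k where k: "t = k + T" using \<open>T \<le> t\<close> by (metis add.commute le_add_diff_inverse)
    have "between a b ((F ^^ t) v)" "between a b ((F ^^ t) w)"
      unfolding k funpow_add comp_def using btw by (auto intro: iter_between)
    from wt_diff_step[OF this btw(3)]
    have "norm (x (Suc t) - S *v x t) \<le> ((b / a)\<^sup>2 - 1) * norm (x t)" by (simp add: x_def)
    also have "\<dots> \<le> eps * norm (x t)" using btw(4) by (intro mult_right_mono) auto
    finally show ?thesis .
  qed
  define g where "g = lam - 2 * eps"
  have g: "0 < g" using mu by (simp add: g_def)
  have "norm (up (x T)) \<le> (C + D) * mu ^ T * (mu / g) ^ k" for k
  proof -
    have "g ^ k * norm (up (x T)) \<le> norm (up (x (T + k)))" unfolding g_def
      using sp.cone_growth[where x = x and eps = eps and T = T, OF step eps] cone by (simp add: x_def)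
    also have "\<dots> \<le> norm (x (T + k))" by (rule sp.norm_up_le)
    also have "x (T + k) = wt ((F ^^ (T + k)) v - vec 1) - wt ((F ^^ (T + k)) w - vec 1)"
      by (simp add: x_def linear_diff[OF linear_wt, symmetric])
    also have "norm \<dots> \<le> C * mu ^ (T + k) + D * mu ^ (T + k)"
      by (rule order_trans[OF norm_triangle_ineq4 add_mono[OF v w]])
    finally have "norm (up (x T)) * g ^ k \<le> (C + D) * mu ^ T * mu ^ k" by (simp add: power_add algebra_simps)
    hence "norm (up (x T)) \<le> (C + D) * mu ^ T * mu ^ k / g ^ k" using g by (simp add: pos_le_divide_eq)
    thus ?thesis by (simp add: power_divide)
  qed
  moreover have "(\<lambda>k. (C + D) * mu ^ T * (mu / g) ^ k) \<longlonglongrightarrow> (C + D) * mu ^ T * 0"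
    using mu g by (intro tendsto_mult_left LIMSEQ_power_zero) (auto simp: g_def)
  ultimately have "norm (up (x T)) \<le> (C + D) * mu ^ T * 0" by (intro LIMSEQ_le_const) auto
  thus ?thesis by (simp add: x_def)
qed

text \<open>Two fast orbits starting on a common line in the direction \<open>e\<close> coincide: normalising both
  limits to 1 puts their difference at time \<open>T\<close> into the expanding cone, whereas it decays fast.\<close>

lemma fast_decay_local_transversal:
  assumes u: "pos_vec u0" and sp: "spectral_splitting ((*v) S) up lam mu0"
    and up: "up (vsqrt p) = vsqrt p" "\<And>y. S *v y = lam *\<^sub>R y \<Longrightarrow> up y = y"
    and y: "y \<noteq> 0" "y \<bullet> vsqrt p = 0" "S *v y = lam *\<^sub>R y"
    and mu: "mu0 < mu" "mu < lam" "lam \<le> 1"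
  obtains e r where "0 < r" "\<And>u. u \<in> ball u0 r \<Longrightarrow> pos_vec u"
    "\<And>u s. u \<in> ball u0 r \<Longrightarrow> u + s *\<^sub>R e \<in> ball u0 r \<Longrightarrow>
       fast_decay mu (row_avg u) \<Longrightarrow> fast_decay mu (row_avg (u + s *\<^sub>R e)) \<Longrightarrow> s = 0"
proof -
  interpret sp: spectral_splitting "(*v) S" up lam mu0 by (rule sp)
  have mu': "0 \<le> mu" "mu < 1" using sp.mu0 mu by auto
  \<comment> \<open>The first bound keeps the cone invariant; the second makes the guaranteed growth
    rate \<open>lam - 2 * eps\<close> exceed \<open>mu\<close>.\<close>
  define eps where "eps = min ((lam - mu0) / 4) ((lam - mu) / 4)"
  have "0 < eps" "eps \<le> (lam - mu0) / 4" "eps \<le> (lam - mu) / 4" using sp.mu0 mu by (auto simp: eps_def)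
  hence eps: "0 < eps" "4 * eps \<le> lam - mu0" "mu < lam - 2 * eps"
    using mu by (simp_all add: le_divide_eq)
  \<comment> \<open>Orbit values and limits will lie in a window of relative width
    \<open>\<eta>\<close>. Normalized values then lie between \<open>\<alpha> / \<beta>\<close> and
    \<open>\<beta> / \<alpha>\<close>, whose quotient is a square; squaring again in
    \<open>wt_diff_step\<close> gives the fourth power. The bound 1/4 is for
    \<open>near_upper_plane_in_cone\<close>.\<close>
  have "\<forall>\<^sub>F \<eta> in at_right (0::real). \<eta> < 1 / 4" by (rule eventually_at_rightI[of 0 "1/4"]) auto
  moreover have "((\<lambda>\<eta>. (((1 + \<eta>) / (1 - \<eta>))\<^sup>2)\<^sup>2 - 1) \<longlongrightarrow> (((1 + 0) / (1 - 0))\<^sup>2)\<^sup>2 - 1) (at_right (0::real))"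
    by (intro tendsto_intros) auto
  hence "\<forall>\<^sub>F \<eta> in at_right (0::real). (((1 + \<eta>) / (1 - \<eta>))\<^sup>2)\<^sup>2 - 1 < eps"
    using eps(1) by (intro order_tendstoD) auto
  moreover have "\<forall>\<^sub>F \<eta> in at_right (0::real). 0 < \<eta>" by (rule eventually_at_right_less)
  ultimately have "\<forall>\<^sub>F \<eta> in at_right (0::real). 0 < \<eta> \<and> \<eta> < 1 / 4 \<and> (((1 + \<eta>) / (1 - \<eta>))\<^sup>2)\<^sup>2 - 1 < eps"
    by eventually_elim auto
  hence "\<exists>\<eta>::real. 0 < \<eta> \<and> \<eta> < 1 / 4 \<and> (((1 + \<eta>) / (1 - \<eta>))\<^sup>2)\<^sup>2 - 1 < eps"
    by (rule eventually_happens'[OF trivial_limit_at_right_real])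
  then obtain \<eta> where \<eta>: "0 < \<eta>" "\<eta> < 1 / 4" "(((1 + \<eta>) / (1 - \<eta>))\<^sup>2)\<^sup>2 - 1 < eps" by blast
  define v0 where "v0 = row_avg u0"
  have v0: "pos_vec v0" unfolding v0_def by (rule pos_row_avg[OF u])
  obtain \<kappa>0 where \<kappa>0: "0 < \<kappa>0" "\<And>i. (\<lambda>t. (F ^^ t) v0 $ i) \<longlonglongrightarrow> \<kappa>0" using iter_tendsto_const[OF v0] by blast
  define \<alpha> \<beta> where "\<alpha> = \<kappa>0 * (1 - \<eta>)" and "\<beta> = \<kappa>0 * (1 + \<eta>)"
  have \<alpha>\<beta>: "0 < \<alpha>" "\<alpha> < \<kappa>0" "\<kappa>0 < \<beta>" using \<kappa>0 \<eta> by (auto simp: \<alpha>_def \<beta>_def)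
  have "\<forall>\<^sub>F t in sequentially. \<alpha> < (F ^^ t) v0 $ i \<and> (F ^^ t) v0 $ i < \<beta>" for i
    by (intro eventually_conj order_tendstoD[OF \<kappa>0(2)] \<alpha>\<beta>)
  hence "\<forall>\<^sub>F t in sequentially. \<forall>i. \<alpha> < (F ^^ t) v0 $ i \<and> (F ^^ t) v0 $ i < \<beta>" by (rule eventually_all_finite)
  hence "\<exists>T. \<forall>i. \<alpha> < (F ^^ T) v0 $ i \<and> (F ^^ T) v0 $ i < \<beta>"
    by (rule eventually_happens'[OF sequentially_bot])
  then obtain T where T: "\<And>i. \<alpha> < (F ^^ T) v0 $ i \<and> (F ^^ T) v0 $ i < \<beta>" by metis
  have "lam \<noteq> 0" using sp.mu0 by simp
  then obtain z where z: "z \<in> range row_avg" "wt z = y"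
    using eigenvector_in_range[OF y(3)] by metis
  \<comment> \<open>The direction whose image under the derivative of \<open>T\<close> steps at the
    centre is, after weighting, the eigenvector \<open>y\<close>.\<close>
  obtain e where e: "dF_iter v0 v0 T (row_avg e) = z" using dF_iter_range[OF v0 z(1)] by blast
  \<comment> \<open>Two moving base points, because the exact difference quotient depends on both
    ends of a segment; hence the product filter.\<close>
  let ?P = "\<lambda>a. norm (wt (dF_iter (row_avg (fst a)) (row_avg (snd a)) T (row_avg e)) - y) < norm y / 4"
  have "((\<lambda>a. norm (wt (dF_iter (row_avg (fst a)) (row_avg (snd a)) T (row_avg e)) - y)) \<longlongrightarrow>
      norm (wt (dF_iter v0 v0 T (row_avg e)) - y)) (nhds u0 \<times>\<^sub>F nhds u0)"
    unfolding v0_def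
    by (intro tendsto_intros tendsto_wt tendsto_dF_iter tendsto_row_avg filterlim_fst filterlim_snd)
       (use v0 in \<open>auto simp: v0_def\<close>)
  hence "eventually ?P (nhds u0 \<times>\<^sub>F nhds u0)"
    using y(1) by (intro order_tendstoD) (auto simp: e z)
  then obtain Q where Q: "eventually Q (nhds u0)" "\<And>u u'. Q u \<Longrightarrow> Q u' \<Longrightarrow> ?P (u, u')"
    unfolding eventually_prod_same by blast
  have L: "((\<lambda>u. (F ^^ T) (row_avg u) $ i) \<longlongrightarrow> (F ^^ T) v0 $ i) (nhds u0)" for i
    unfolding v0_def by (intro tendsto_intros tendsto_iter tendsto_row_avg filterlim_ident) (use v0 in \<open>simp add: v0_def\<close>)
  have "\<forall>\<^sub>F u in nhds u0. \<alpha> < (F ^^ T) (row_avg u) $ i \<and> (F ^^ T) (row_avg u) $ i < \<beta>" for i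
    using T[of i] by (intro eventually_conj order_tendstoD[OF L]) auto
  hence ev1: "\<forall>\<^sub>F u in nhds u0. \<forall>i. \<alpha> < (F ^^ T) (row_avg u) $ i \<and> (F ^^ T) (row_avg u) $ i < \<beta>"
    by (rule eventually_all_finite)
  have "((\<lambda>u. u $ j) \<longlongrightarrow> u0 $ j) (nhds u0)" for j by (intro tendsto_intros filterlim_ident)
  hence "\<forall>\<^sub>F u in nhds u0. 0 < u $ j" for j using u by (intro order_tendstoD) (auto simp: pos_vec_def)
  hence ev2: "\<forall>\<^sub>F u in nhds u0. pos_vec u" unfolding pos_vec_def by (rule eventually_all_finite)
  from Q(1) ev1 ev2 have "\<forall>\<^sub>F u in nhds u0. Q u \<and> pos_vec u \<and>
      (\<forall>i. \<alpha> < (F ^^ T) (row_avg u) $ i \<and> (F ^^ T) (row_avg u) $ i < \<beta>)"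
    by eventually_elim auto
  then obtain r where r: "0 < r" "\<And>u. u \<in> ball u0 r \<Longrightarrow> Q u" "\<And>u. u \<in> ball u0 r \<Longrightarrow> pos_vec u"
     "\<And>u i. u \<in> ball u0 r \<Longrightarrow> \<alpha> < (F ^^ T) (row_avg u) $ i \<and> (F ^^ T) (row_avg u) $ i < \<beta>"
    unfolding eventually_nhds_metric by (auto simp: dist_commute)
  have bt: "between \<alpha> \<beta> ((F ^^ T) (row_avg u))" if "u \<in> ball u0 r" for u
    using r(4)[OF that] by (auto simp: between_def less_imp_le)
  \<comment> \<open>Orbits starting near the centre remain in the window from time \<open>T\<close>
    on, so their limits lie there too.\<close>
  have lim: "\<exists>\<kappa>. 0 < \<kappa> \<and> \<alpha> \<le> \<kappa> \<and> \<kappa> \<le> \<beta> \<and> (\<forall>i. (\<lambda>t. (F ^^ t) (row_avg u) $ i) \<longlonglongrightarrow> \<kappa>)"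
    if uin: "u \<in> ball u0 r" for u
  proof -
    obtain \<kappa> where \<kappa>: "0 < \<kappa>" "\<And>i. (\<lambda>t. (F ^^ t) (row_avg u) $ i) \<longlonglongrightarrow> \<kappa>"
      using iter_tendsto_const[OF pos_row_avg[OF r(3)[OF uin]]] by blast
    have btT: "between \<alpha> \<beta> ((F ^^ (t + T)) (row_avg u))" for t
      unfolding funpow_add comp_def by (rule iter_between[OF bt[OF uin] \<alpha>\<beta>(1)])
    have "(\<lambda>t. (F ^^ (t + T)) (row_avg u) $ undefined) \<longlonglongrightarrow> \<kappa>"
      by (rule LIMSEQ_ignore_initial_segment[OF \<kappa>(2)])
    from LIMSEQ_le_const[OF this, of \<alpha>] LIMSEQ_le_const2[OF this, of \<beta>]
    have "\<alpha> \<le> \<kappa>" "\<kappa> \<le> \<beta>" using btT by (auto simp: between_def)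
    thus ?thesis using \<kappa> by blast
  qed
  have "s = 0" if u1: "u \<in> ball u0 r" and u2: "u + s *\<^sub>R e \<in> ball u0 r"
    and fast: "fast_decay mu (row_avg u)" "fast_decay mu (row_avg (u + s *\<^sub>R e))" for u s
  proof -
    define v where "v = row_avg u"
    define w where "w = row_avg (u + s *\<^sub>R e)"
    have vw: "v - w = (- s) *\<^sub>R row_avg e"
      by (simp add: v_def w_def row_avg_def vec_eq_iff sum.distrib sum_distrib_left algebra_simps
          diff_divide_distrib[symmetric] add_divide_distrib)
    have pv: "pos_vec v" "pos_vec w" unfolding v_def w_def using r(3)[OF u1] r(3)[OF u2] pos_row_avg by auto
    obtain \<kappa> where \<kappa>: "0 < \<kappa>" "\<alpha> \<le> \<kappa>" "\<kappa> \<le> \<beta>" "\<And>i. (\<lambda>t. (F ^^ t) v $ i) \<longlonglongrightarrow> \<kappa>"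
      using lim[OF u1] unfolding v_def by blast
    obtain \<kappa>' where \<kappa>': "0 < \<kappa>'" "\<alpha> \<le> \<kappa>'" "\<kappa>' \<le> \<beta>" "\<And>i. (\<lambda>t. (F ^^ t) w $ i) \<longlonglongrightarrow> \<kappa>'"
      using lim[OF u2] unfolding w_def by blast
    obtain C where C: "\<And>t. norm (wt ((F ^^ t) ((1 / \<kappa>) *\<^sub>R v) - vec 1)) \<le> C * mu ^ t"
      using fast_decay_normalized[OF pv(1) fast(1)[folded v_def] mu' \<kappa>(1,4)] by blast
    obtain D where D: "\<And>t. norm (wt ((F ^^ t) ((1 / \<kappa>') *\<^sub>R w) - vec 1)) \<le> D * mu ^ t"
      using fast_decay_normalized[OF pv(2) fast(2)[folded w_def] mu' \<kappa>'(1,4)] by blast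
    have nb: "between (\<alpha> / \<beta>) (\<beta> / \<alpha>) ((F ^^ T) ((1 / k) *\<^sub>R x))"
      if "between \<alpha> \<beta> ((F ^^ T) x)" "\<alpha> \<le> k" "k \<le> \<beta>" for k x
    proof -
      have k: "0 < k" "0 < \<beta>" using that \<alpha>\<beta> by auto
      have "\<alpha> / \<beta> \<le> a / k \<and> a / k \<le> \<beta> / \<alpha>" if "\<alpha> \<le> a" "a \<le> \<beta>" for a
        using that \<open>\<alpha> \<le> k\<close> \<open>k \<le> \<beta>\<close> \<alpha>\<beta> by (auto intro!: frac_le)
      thus ?thesis using that(1) k by (auto simp: between_def iter_scaleR)
    qed
    have bv: "between (\<alpha> / \<beta>) (\<beta> / \<alpha>) ((F ^^ T) ((1 / \<kappa>) *\<^sub>R v))"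
      using nb[OF bt[OF u1] \<kappa>(2,3)] by (simp add: v_def)
    have bw: "between (\<alpha> / \<beta>) (\<beta> / \<alpha>) ((F ^^ T) ((1 / \<kappa>') *\<^sub>R w))"
      using nb[OF bt[OF u2] \<kappa>'(2,3)] by (simp add: w_def)
    define x where "x = wt ((F ^^ T) ((1 / \<kappa>) *\<^sub>R v) - (F ^^ T) ((1 / \<kappa>') *\<^sub>R w))"
    define r1 where "r1 = wt (dF_iter v w T (row_avg e)) - y"
    define r2 where "r2 = (1 / \<kappa>0) *\<^sub>R wt ((F ^^ T) w) - vsqrt p"
    \<comment> \<open>The first summand comes from moving along the line, the second from the
      different limits; \<open>r1\<close> and \<open>r2\<close> are the deviations from
      \<open>y\<close> and \<open>vsqrt p\<close>.\<close>
    have xe: "x = (- s / \<kappa>) *\<^sub>R (y + r1) + ((1 / \<kappa> - 1 / \<kappa>') * \<kappa>0) *\<^sub>R (vsqrt p + r2)"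
    proof -
      have "x = (1 / \<kappa>) *\<^sub>R wt ((F ^^ T) v) - (1 / \<kappa>') *\<^sub>R wt ((F ^^ T) w)"
        using \<kappa>(1) \<kappa>'(1) by (simp add: x_def iter_scaleR linear_diff[OF linear_wt] linear_cmul[OF linear_wt])
      also have "\<dots> = (1 / \<kappa>) *\<^sub>R wt ((F ^^ T) v - (F ^^ T) w) + (1 / \<kappa> - 1 / \<kappa>') *\<^sub>R wt ((F ^^ T) w)"
        by (simp add: linear_diff[OF linear_wt] algebra_simps)
      also have "wt ((F ^^ T) v - (F ^^ T) w) = (- s) *\<^sub>R (y + r1)"
        unfolding dF_iter_diff[OF pv] vw dF_iter_scaleR linear_cmul[OF linear_wt] by (simp add: r1_def)
      also have "wt ((F ^^ T) w) = \<kappa>0 *\<^sub>R (vsqrt p + r2)" using \<kappa>0(1) by (simp add: r2_def)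
      finally show ?thesis by simp
    qed
    have r1: "4 * norm r1 \<le> norm y" using Q(2)[OF r(2)[OF u1] r(2)[OF u2]] by (simp add: r1_def v_def w_def)
    have r2: "4 * norm r2 \<le> norm (vsqrt p)"
    proof -
      have "norm r2 \<le> norm ((1 / 4) *\<^sub>R vsqrt p)"
      proof (rule norm_le_componentwise_cart)
        fix i
        have "\<bar>(F ^^ T) w $ i / \<kappa>0 - 1\<bar> \<le> \<eta>"
          using r(4)[OF u2, of i] \<kappa>0(1) by (simp add: w_def \<alpha>_def \<beta>_def abs_le_iff field_simps)
        hence "\<bar>(F ^^ T) w $ i / \<kappa>0 - 1\<bar> \<le> 1 / 4" using \<eta> by linarith
        hence "sqrt (p $ i) * \<bar>(F ^^ T) w $ i / \<kappa>0 - 1\<bar> \<le> sqrt (p $ i) * (1 / 4)"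
          using p0[of i] by (intro mult_left_mono) auto
        moreover have "r2 $ i = sqrt (p $ i) * ((F ^^ T) w $ i / \<kappa>0 - 1)"
          by (simp add: r2_def wt_def vsqrt_def algebra_simps)
        ultimately show "norm (r2 $ i) \<le> norm (((1 / 4) *\<^sub>R vsqrt p) $ i)"
          using p0[of i] by (simp add: abs_mult vsqrt_def)
      qed
      thus ?thesis by simp
    qed
    note cone = sp.near_upper_plane_in_cone[OF up(2)[OF y(3)] up(1) y(2) r1 r2 xe]
    have eb: "(\<beta> / \<alpha> / (\<alpha> / \<beta>))\<^sup>2 - 1 \<le> eps"
    proof -
      have "\<beta> / \<alpha> / (\<alpha> / \<beta>) = (\<beta> / \<alpha>)\<^sup>2" by (simp add: power2_eq_square)
      moreover have "\<beta> / \<alpha> = (1 + \<eta>) / (1 - \<eta>)" using \<kappa>0(1) by (simp add: \<alpha>_def \<beta>_def)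
      ultimately show ?thesis using \<eta>(3) by simp
    qed
    have "up x = 0" unfolding x_def
      by (rule fast_pair_off_cone[OF sp less_imp_le[OF eps(1)] eps(2) mu'(1) eps(3) C D bv bw _ eb])
         (use \<alpha>\<beta> cone(1) in \<open>auto simp: x_def\<close>)
    from cone(2)[OF y(1) this] \<kappa>(1) show "s = 0" by simp
  qed
  with r that show thesis by blast
qed

text \<open>Negligibility is a local property. Near each point the set is covered by countably many
  compact sets to which the translation argument applies.\<close>

lemma negligible_fast_decay:
  assumes sp: "spectral_splitting ((*v) S) up lam mu0"
    and up: "up (vsqrt p) = vsqrt p" "\<And>y. S *v y = lam *\<^sub>R y \<Longrightarrow> up y = y"
    and y: "y \<noteq> 0" "y \<bullet> vsqrt p = 0" "S *v y = lam *\<^sub>R y"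
    and mu: "mu0 < mu" "mu < lam" "lam \<le> 1"
  shows "negligible {u. pos_vec u \<and> fast_decay mu (row_avg u)}"
proof -
  let ?B = "{u. pos_vec u \<and> fast_decay mu (row_avg u)}"
  have mu0: "0 \<le> mu" using mu spectral_splitting.mu0[OF sp] by auto
  have "\<exists>U. openin (top_of_set ?B) U \<and> u0 \<in> U \<and> negligible U" if u0: "u0 \<in> ?B" for u0
  proof -
    have "pos_vec u0" using u0 by simp
    from fast_decay_local_transversal[OF this sp up y mu] obtain e r where r: "0 < r"
      and pos: "\<And>u. u \<in> ball u0 r \<Longrightarrow> pos_vec u"
      and tr: "\<And>u s. u \<in> ball u0 r \<Longrightarrow> u + s *\<^sub>R e \<in> ball u0 r \<Longrightarrow>
       fast_decay mu (row_avg u) \<Longrightarrow> fast_decay mu (row_avg (u + s *\<^sub>R e)) \<Longrightarrow> s = 0" by metis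
    define c where "c = cball u0 (r / 2)"
    have cr: "c \<subseteq> ball u0 r" using r by (auto simp: c_def)
    \<comment> \<open>Fixing the constant of the decay makes the condition closed; the sets for all
      \<open>n\<close> exhaust the fast orbits in the ball.\<close>
    define Z where "Z n = {u \<in> c. \<forall>t. norm (rho ((F ^^ t) (row_avg u))) \<le> real n * mu ^ t}" for n
    have "negligible (Z n)" for n
    proof (rule negligible_if_lines_meet_once[where e = e])
      have "continuous_on c (\<lambda>u. norm (rho ((F ^^ t) (row_avg u))))" for t
        unfolding continuous_on_def using cr pos pos_row_avg pos_iter
        by (intro ballI tendsto_norm tendsto_rho tendsto_iter tendsto_row_avg filterlim_ident) auto
      hence "closed {u \<in> c. norm (rho ((F ^^ t) (row_avg u))) \<le> real n * mu ^ t}" for t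
        by (intro continuous_on_closed_Collect_le continuous_on_const) (auto simp: c_def)
      hence "closed (\<Inter>t. {u \<in> c. norm (rho ((F ^^ t) (row_avg u))) \<le> real n * mu ^ t})" by blast
      also have "(\<Inter>t. {u \<in> c. norm (rho ((F ^^ t) (row_avg u))) \<le> real n * mu ^ t}) = Z n"
        by (auto simp: Z_def)
      finally have "closed (Z n)" .
      moreover have "bounded (Z n)" by (rule bounded_subset[of c]) (auto simp: c_def Z_def)
      ultimately show "compact (Z n)" by (simp add: compact_eq_bounded_closed)
      fix u s assume "u \<in> Z n" "u + s *\<^sub>R e \<in> Z n"
      thus "s = 0" using cr by (intro tr[of u s]) (auto simp: Z_def fast_decay_def)
    qed
    hence "negligible (\<Union>n. Z n)" by blast
    moreover have "?B \<inter> ball u0 (r / 2) \<subseteq> (\<Union>n. Z n)"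
    proof
      fix u assume u: "u \<in> ?B \<inter> ball u0 (r / 2)"
      then obtain C where C: "\<And>t. norm (rho ((F ^^ t) (row_avg u))) \<le> C * mu ^ t"
        by (auto simp: fast_decay_def)
      obtain n where n: "C \<le> real n" using real_arch_simple by blast
      have "norm (rho ((F ^^ t) (row_avg u))) \<le> real n * mu ^ t" for t
        using C[of t] mult_right_mono[OF n, of "mu ^ t"] mu0 by simp
      thus "u \<in> (\<Union>n. Z n)" using u by (auto simp: Z_def c_def)
    qed
    ultimately have "negligible (?B \<inter> ball u0 (r / 2))" by (rule negligible_subset)
    thus ?thesis using u0 r by (intro exI[of _ "?B \<inter> ball u0 (r / 2)"]) (auto intro: openin_open_Int)
  qed
  thus ?thesis unfolding locally_negligible_alt[of ?B] by blast
qed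

end

subsection \<open>Application to the algorithm\<close>

text \<open>Block numbers in \<open>block_diagonal\<close> must be monotone in the index order. The
  permutation sends the i-th index to the i-th entry of the list sorted by \<open>f\<close>.\<close>

lemma sorting_permutation:
  fixes f :: "'k::{finite,linorder} \<Rightarrow> 'b::linorder"
  shows "\<exists>\<pi>. \<pi> permutes UNIV \<and> mono (f \<circ> \<pi>)"
proof -
  define xs where "xs = sorted_list_of_set (UNIV :: 'k set)"
  define ys where "ys = sort_key f xs"
  define n where "n = length xs"
  have xs: "distinct xs" "set xs = UNIV" "sorted xs" by (simp_all add: xs_def)
  have ys: "distinct ys" "set ys = UNIV" "length ys = n" "sorted (map f ys)"
    using xs by (simp_all add: ys_def n_def)
  have bx: "bij_betw ((!) xs) {..<n} UNIV" using xs by (intro bij_betw_nth) (auto simp: n_def)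
  have by': "bij_betw ((!) ys) {..<n} UNIV" using ys by (intro bij_betw_nth) auto
  define idx where "idx = inv_into {..<n} ((!) xs)"
  have bi: "bij_betw idx UNIV {..<n}" unfolding idx_def by (rule bij_betw_inv_into[OF bx])
  have idx: "idx i < n" "xs ! idx i = i" for i
    using bi bij_betw_inv_into_right[OF bx, of i] by (auto simp: bij_betw_def idx_def)
  have im: "idx i \<le> idx j" if "i \<le> j" for i j
  proof (rule ccontr)
    assume "\<not> idx i \<le> idx j"
    hence "xs ! idx j \<le> xs ! idx i" using idx xs(3) by (intro sorted_nth_mono) (auto simp: n_def)
    hence "i = j" using idx that by simp
    thus False using \<open>\<not> idx i \<le> idx j\<close> by simp
  qed
  define \<pi> where "\<pi> i = ys ! idx i" for i
  have "bij \<pi>" using bij_betw_trans[OF bi by'] by (simp add: \<pi>_def[abs_def] comp_def)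
  hence "\<pi> permutes UNIV" by (simp add: permutes_def bij_iff)
  moreover have "mono (f \<circ> \<pi>)"
  proof (rule monoI)
    fix i j :: 'k assume "i \<le> j"
    hence "map f ys ! idx i \<le> map f ys ! idx j" using im idx ys by (intro sorted_nth_mono) auto
    thus "(f \<circ> \<pi>) i \<le> (f \<circ> \<pi>) j" using idx ys(3) by (simp add: \<pi>_def)
  qed
  ultimately show ?thesis by blast
qed

text \<open>A nontrivial \<open>X\<close> and its complement give two blocks. Nonzero entries in a
  row inside and a row outside \<open>X\<close> supply columns inside and outside \<open>Y\<close>,
  so both blocks have columns.\<close>

lemma indecomposable_connected:
  fixes A :: "real ^ 'm::{finite,linorder} ^ 'n::{finite,linorder}"
  assumes ind: "indecomposable A"
    and rows: "\<And>i. \<exists>j. A $ i $ j \<noteq> 0" and cols: "\<And>j. \<exists>i. A $ i $ j \<noteq> 0"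
    and XY: "\<And>i j. A $ i $ j \<noteq> 0 \<Longrightarrow> i \<in> X \<longleftrightarrow> j \<in> Y"
  shows "X = {} \<or> X = UNIV"
proof (rule ccontr)
  assume "\<not> (X = {} \<or> X = UNIV)"
  then obtain i0 i1 where i: "i0 \<in> X" "i1 \<notin> X" by blast
  obtain j0 j1 where "A $ i0 $ j0 \<noteq> 0" "A $ i1 $ j1 \<noteq> 0" using rows by blast
  hence j: "j0 \<in> Y" "j1 \<notin> Y" using XY i by blast+
  define f :: "'n::{finite,linorder} \<Rightarrow> nat" where "f i = (if i \<in> X then 0 else 1)" for i
  define g :: "'m::{finite,linorder} \<Rightarrow> nat" where "g j = (if j \<in> Y then 0 else 1)" for j
  obtain \<pi> where \<pi>: "\<pi> permutes UNIV" "mono (f \<circ> \<pi>)" using sorting_permutation by blast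
  obtain \<tau> where \<tau>: "\<tau> permutes UNIV" "mono (g \<circ> \<tau>)" using sorting_permutation by blast
  define P where "P = (\<chi> i j. if j = \<pi> i then 1 else (0::real))"
  \<comment> \<open>Multiplication from the right permutes columns by the inverse, so
    \<open>inv \<tau>\<close> makes the product have the entries
    \<open>A $ \<pi> i $ \<tau> j\<close>.\<close>
  define Q where "Q = (\<chi> i j. if j = inv \<tau> i then 1 else (0::real))"
  have "permutation_matrix P" unfolding permutation_matrix_def P_def using \<pi>(1) by blast
  moreover have "permutation_matrix Q"
    unfolding permutation_matrix_def Q_def using permutes_inv[OF \<tau>(1)] by blast
  moreover have "block_diagonal (P ** A ** Q)"
  proof -
    have ent: "(P ** A ** Q) $ i $ j = A $ \<pi> i $ \<tau> j" for i j
    proof -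
      have 1: "(P ** A) $ i $ k = A $ \<pi> i $ k" for k
        by (simp add: matrix_matrix_mult_def P_def if_distrib[of "\<lambda>x. x * _"] cong: if_cong)
      have "j = inv \<tau> k \<longleftrightarrow> k = \<tau> j" for k using \<tau>(1) by (metis permutes_inverses)
      thus ?thesis unfolding matrix_matrix_mult_def[of "P ** A"]
        by (simp add: 1 Q_def if_distrib[of "\<lambda>x. _ * x"] cong: if_cong)
    qed
    have "range f = {..<2}" using i by (auto simp: f_def image_iff less_2_cases_iff)
    moreover have "range \<pi> = UNIV" using \<pi>(1) by (rule permutes_image)
    ultimately have rf: "range (f \<circ> \<pi>) = {..<2}" by (simp only: image_comp[symmetric])
    have "range g = {..<2}" using j by (auto simp: g_def image_iff less_2_cases_iff)
    moreover have "range \<tau> = UNIV" using \<tau>(1) by (rule permutes_image)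
    ultimately have rg: "range (g \<circ> \<tau>) = {..<2}" by (simp only: image_comp[symmetric])
    have "(P ** A ** Q) $ i $ j = 0" if "(f \<circ> \<pi>) i \<noteq> (g \<circ> \<tau>) j" for i j
      using that XY[of "\<pi> i" "\<tau> j"] by (auto simp: ent f_def g_def split: if_splits)
    thus ?thesis unfolding block_diagonal_def
      by (intro exI[of _ 2] exI[of _ "f \<circ> \<pi>"] exI[of _ "g \<circ> \<tau>"]) (use rf rg \<pi> \<tau> in auto)
  qed
  ultimately show False using ind unfolding indecomposable_def by blast
qed

section \<open>From one-step bounds to limits of quotients\<close>

lemma ratio_tendsto:
  fixes R :: "nat \<Rightarrow> real"
  assumes R: "\<And>t. 0 \<le> R t"
    and up: "\<And>c. l < c \<Longrightarrow> \<forall>\<^sub>F t in sequentially. R (Suc t) \<le> c * R t"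
    and lo: "\<And>c. c < l \<Longrightarrow> \<forall>\<^sub>F t in sequentially. 0 < R t \<and> c * R t \<le> R (Suc t)"
  shows "(\<lambda>t. R (Suc t) / R t) \<longlonglongrightarrow> l"
proof (rule order_tendstoI)
  fix a assume "a < l"
  then obtain c where c: "a < c" "c < l" using dense by blast
  from lo[OF c(2)] show "\<forall>\<^sub>F t in sequentially. a < R (Suc t) / R t"
  proof eventually_elim
    case (elim t)
    hence "c \<le> R (Suc t) / R t" by (simp add: field_simps)
    thus ?case using c by simp
  qed
next
  fix b assume "l < b"
  then obtain c where c: "l < c" "c < b" using dense by blast
  have "\<forall>\<^sub>F t in sequentially. 0 < R t" using lo[of "l - 1"] by (simp add: eventually_conj_iff)
  with up[OF c(1)] show "\<forall>\<^sub>F t in sequentially. R (Suc t) / R t < b"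
  proof eventually_elim
    case (elim t)
    hence "R (Suc t) / R t \<le> c" by (simp add: field_simps)
    thus ?case using c by simp
  qed
qed

text \<open>Serves the case \<open>lambda = 0\<close>. A vanishing residual is harmless there, since
  division by 0 yields 0, the claimed limit; no starting point has to be excluded.\<close>

lemma superlinear_ratio_tendsto_0:
  fixes R :: "nat \<Rightarrow> real"
  assumes R: "\<And>t. 0 \<le> R t" and up: "\<And>c. 0 < c \<Longrightarrow> \<forall>\<^sub>F t in sequentially. R (Suc t) \<le> c * R t"
  shows "(\<lambda>t. R (Suc t) / R t) \<longlonglongrightarrow> 0"
proof (rule order_tendstoI)
  fix a :: real assume "a < 0"
  moreover have "0 \<le> R (Suc t) / R t" for t by (intro divide_nonneg_nonneg R)
  ultimately have "a < R (Suc t) / R t" for t by (rule order_less_le_trans)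
  thus "\<forall>\<^sub>F t in sequentially. a < R (Suc t) / R t" by (intro always_eventually allI)
next
  fix b :: real assume b: "0 < b"
  hence "\<forall>\<^sub>F t in sequentially. R (Suc t) \<le> b / 2 * R t" by (intro up) simp
  thus "\<forall>\<^sub>F t in sequentially. R (Suc t) / R t < b"
  proof eventually_elim
    case (elim t)
    show ?case
    proof (cases "R t = 0")
      case False
      hence "0 < R t" using R[of t] by simp
      hence "R (Suc t) / R t \<le> b / 2" using elim by (simp add: field_simps)
      also have "b / 2 < b" using b by simp
      finally show ?thesis .
    qed (use b in simp)
  qed
qed

section \<open>The residuals of the algorithm as norms of \<open>rho\<close>\<close>

context connected_balanced_matrix
begin

lemma S_eigen_setup:
  "transpose S = S" "x \<bullet> (S *v x) \<le> x \<bullet> x" "0 \<le> x \<bullet> (S *v x)"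
proof -
  show "transpose S = S" by (simp add: S_def matrix_transpose_mul)
  have "x \<bullet> (S *v x) = (norm (transpose N *v x))\<^sup>2"
    unfolding S_def by (metis adjoint_N inner_commute dot_square_norm matrix_vector_mul_assoc)
  thus "x \<bullet> (S *v x) \<le> x \<bullet> x" "0 \<le> x \<bullet> (S *v x)"
    using norm_transpose_N_le[of x] by (simp_all add: dot_square_norm power_mono)
qed

lemma rho_contraction:
  assumes card: "2 \<le> CARD('n)" and v: "pos_vec v" and c: "second_eigenvalue S < c"
  shows "\<forall>\<^sub>F t in sequentially. norm (rho ((F ^^ Suc t) v)) \<le> c * norm (rho ((F ^^ t) v))"
proof -
  let ?l = "second_eigenvalue S"
  obtain th where th: "th \<longlonglongrightarrow> 0" "\<And>t. 0 \<le> th t"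
    "\<And>t. norm (rho ((F ^^ Suc t) v) - S *v rho ((F ^^ t) v)) \<le> th t * norm (rho ((F ^^ t) v))"
    using rho_asymptotically_linear[OF v] by blast
  have "\<forall>\<^sub>F t in sequentially. th t < c - ?l" using c by (intro order_tendstoD(2)[OF th(1)]) simp
  thus ?thesis
  proof eventually_elim
    case (elim t)
    let ?x = "rho ((F ^^ t) v)"
    have "norm (S *v ?x) \<le> ?l * norm ?x"
      by (rule second_eigenvalue_properties(2)[OF card S_eigen_setup(1) S_sqrt sqrt_nz(1) S_eigen_setup(2,3)])
         (rule rho_orthogonal[OF pos_iter[OF v]])
    moreover have "norm (rho ((F ^^ Suc t) v)) \<le> norm (S *v ?x) + norm (rho ((F ^^ Suc t) v) - S *v ?x)"
      by (rule norm_triangle_sub)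
    moreover have "th t * norm ?x \<le> (c - ?l) * norm ?x" using elim by (intro mult_right_mono) auto
    ultimately show ?case using th(3)[of t] by (simp add: algebra_simps)
  qed
qed

text \<open>For \<open>mu\<close> strictly between \<open>mu0\<close> and the second eigenvalue the
  exceptional set is that of the fast-decaying orbits; all others fall into the first case of
  \<open>growth_dichotomy\<close>.\<close>

lemma generic_rho_growth:
  assumes card: "2 \<le> CARD('n)" and pos: "0 < second_eigenvalue S"
  obtains Z where "negligible Z" "\<And>u c. pos_vec u \<Longrightarrow> u \<notin> Z \<Longrightarrow> c < second_eigenvalue S \<Longrightarrow>
    \<forall>\<^sub>F t in sequentially. 0 < norm (rho ((F ^^ t) (row_avg u))) \<and>
      c * norm (rho ((F ^^ t) (row_avg u))) \<le> norm (rho ((F ^^ Suc t) (row_avg u)))"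
proof -
  let ?l = "second_eigenvalue S"
  note props = second_eigenvalue_properties[OF card S_eigen_setup(1) S_sqrt sqrt_nz(1) S_eigen_setup(2,3)]
  obtain up mu0 where sp: "spectral_splitting ((*v) S) up ?l mu0" and up: "up (vsqrt p) = vsqrt p"
    "\<And>y. S *v y = ?l *\<^sub>R y \<Longrightarrow> up y = y" using props(4)[OF pos] by blast
  interpret sp: spectral_splitting "(*v) S" up ?l mu0 by (rule sp)
  obtain y where y: "y \<noteq> 0" "y \<bullet> vsqrt p = 0" "S *v y = ?l *\<^sub>R y" using props(3) by blast
  have l1: "?l \<le> 1"
  proof -
    have "?l * norm y \<le> 1 * norm y" using norm_S_le[of y] y(3) pos by simp
    thus ?thesis using y(1) by simp
  qed
  obtain mu where mu: "mu0 < mu" "mu < ?l" using dense[OF sp.mu0(2)] by blast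
  show thesis
  proof (rule that)
    show "negligible {u. pos_vec u \<and> fast_decay mu (row_avg u)}"
      by (rule negligible_fast_decay[OF sp up y mu l1])
    fix u c assume u: "pos_vec u" "u \<notin> {u. pos_vec u \<and> fast_decay mu (row_avg u)}" and c: "c < ?l"
    have v: "pos_vec (row_avg u)" by (rule pos_row_avg[OF u(1)])
    obtain th where th: "th \<longlonglongrightarrow> 0" "\<And>t. 0 \<le> th t" "\<And>t. norm (rho ((F ^^ Suc t) (row_avg u)) -
        S *v rho ((F ^^ t) (row_avg u))) \<le> th t * norm (rho ((F ^^ t) (row_avg u)))"
      using rho_asymptotically_linear[OF v] by blast
    have "\<not> (\<exists>C. \<forall>t. norm (rho ((F ^^ t) (row_avg u))) \<le> C * mu ^ t)"
      using u by (simp add: fast_decay_def)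
    with sp.growth_dichotomy[where x = "\<lambda>t. rho ((F ^^ t) (row_avg u))", OF th(3,1,2) mu(1)] c
    show "\<forall>\<^sub>F t in sequentially. 0 < norm (rho ((F ^^ t) (row_avg u))) \<and>
      c * norm (rho ((F ^^ t) (row_avg u))) \<le> norm (rho ((F ^^ Suc t) (row_avg u)))" by simp
  qed
qed

text \<open>Dividing the scalings by \<open>e1\<close> and \<open>e0\<close> conjugates the
  algorithm on \<open>A\<close> to the mean iteration on \<open>B\<close>; \<open>half\<close> is
  the row update and \<open>full\<close> the column update.\<close>

lemma sinkhorn_d0_iterate:
  fixes A :: "real ^ 'm ^ 'n"
  assumes e1: "pos_vec e1" and e0: "pos_vec e0" and B: "\<And>i j. B $ i $ j = e1 $ i * A $ i $ j * e0 $ j"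
    and d: "pos_vec d"
  shows "vdiv p (A *v sinkhorn_d0 A p q d t) = vdiv e1 ((F ^^ t) (row_avg (vdiv d e0)))"
    and "sinkhorn_d0 A p q d (Suc t) = (\<chi> j. e0 $ j * col_harm ((F ^^ t) (row_avg (vdiv d e0))) $ j)"
proof -
  have e: "e1 $ i \<noteq> 0" "e0 $ j \<noteq> 0" for i j using e1 e0 by (auto simp: pos_vec_def less_imp_neq[symmetric])
  have A: "A $ i $ j = B $ i $ j / (e1 $ i * e0 $ j)" for i j using e by (simp add: B)
  have ps: "pos_vec (vdiv d e0)" using d e0 by (auto simp: pos_vec_def vdiv_def)
  define v where "v t = (F ^^ t) (row_avg (vdiv d e0))" for t
  have vt: "v t $ i \<noteq> 0" for t i
    using pos_iter[OF pos_row_avg[OF ps], of t] by (auto simp: v_def pos_vec_def less_imp_neq[symmetric])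
  have half: "vdiv p (A *v x) = vdiv e1 w" if w: "w = row_avg (vdiv x e0)" "\<And>i. w $ i \<noteq> 0" for x w
  proof -
    have "(A *v x) $ i = p $ i * w $ i / e1 $ i" for i
    proof -
      have "(A *v x) $ i = (\<Sum>j\<in>UNIV. B $ i $ j * (x $ j / e0 $ j)) / e1 $ i"
        unfolding matrix_vector_mult_def sum_divide_distrib by (simp add: A mult_ac)
      thus ?thesis by (simp add: w(1) row_avg_def vdiv_def)
    qed
    thus ?thesis using w(2) e by (simp add: vdiv_def vec_eq_iff)
  qed
  have full: "vdiv q (transpose A *v vdiv e1 w) = (\<chi> j. e0 $ j * col_harm w $ j)" for w
  proof -
    have "(transpose A *v vdiv e1 w) $ j = (\<Sum>i\<in>UNIV. B $ i $ j / w $ i) / e0 $ j" for j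
      unfolding matrix_vector_mult_def sum_divide_distrib using e
      by (simp add: A transpose_def vdiv_def mult_ac)
    thus ?thesis by (simp add: vdiv_def vec_eq_iff col_harm_def)
  qed
  have cancel: "vdiv (\<chi> j. e0 $ j * x $ j) e0 = x" for x using e by (simp add: vdiv_def vec_eq_iff)
  have inv: "row_avg (vdiv (sinkhorn_d0 A p q d t) e0) = v t" for t
  proof (induction t)
    case (Suc t)
    show ?case unfolding sinkhorn_d0.simps(2) half[OF Suc[symmetric] vt] full cancel
      by (simp add: v_def F_def)
  qed (simp add: v_def)
  show 1: "vdiv p (A *v sinkhorn_d0 A p q d t) = vdiv e1 ((F ^^ t) (row_avg (vdiv d e0)))"
    using half[OF inv[symmetric] vt] by (simp add: v_def)
  show "sinkhorn_d0 A p q d (Suc t) = (\<chi> j. e0 $ j * col_harm ((F ^^ t) (row_avg (vdiv d e0))) $ j)"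
    unfolding sinkhorn_d0.simps(2) 1 full ..
qed

text \<open>The row scaling at time \<open>Suc t\<close> is computed from the column scaling at time
  \<open>t\<close>; this accounts for the shift by one and leaves out the placeholder at time
  0.\<close>

lemma sinkhorn_residual_eq:
  fixes A :: "real ^ 'm ^ 'n"
  assumes e1: "pos_vec e1" and e0: "pos_vec e0" and B: "\<And>i j. B $ i $ j = e1 $ i * A $ i $ j * e0 $ j"
    and d: "pos_vec d"
  shows "sinkhorn_residual A p q d (Suc t) = norm (rho ((F ^^ t) (row_avg (vdiv d e0))))"
proof -
  note it = sinkhorn_d0_iterate[OF assms, of t]
  define w where "w = (F ^^ t) (row_avg (vdiv d e0))"
  have "pos_vec (vdiv d e0)" using d e0 by (auto simp: pos_vec_def vdiv_def)
  hence wn: "w $ i \<noteq> 0" for i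
    using pos_iter[OF pos_row_avg, of "vdiv d e0" t] by (auto simp: w_def pos_vec_def less_imp_neq[symmetric])
  have entry: "sinkhorn_matrix A p q d (Suc t) $ i $ j = e1 $ i / w $ i * A $ i $ j * (e0 $ j * col_harm w $ j)" for i j
    unfolding sinkhorn_matrix_def it(2) sinkhorn_d1_def nat.case it(1)
    by (simp add: w_def vdiv_def diag_mat_def matrix_matrix_mult_def if_distrib[of "\<lambda>x. x * _"]
        if_distrib[of "\<lambda>x. _ * x"] cong: if_cong)
  have "(sinkhorn_matrix A p q d (Suc t) *v 1) $ i = p $ i * F w $ i / w $ i" for i
  proof -
    have "(sinkhorn_matrix A p q d (Suc t) *v 1) $ i
        = (\<Sum>j\<in>UNIV. e1 $ i / w $ i * A $ i $ j * (e0 $ j * col_harm w $ j))"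
      by (simp add: matrix_vector_mult_def entry)
    also have "\<dots> = (\<Sum>j\<in>UNIV. B $ i $ j * col_harm w $ j) / w $ i"
      unfolding sum_divide_distrib by (simp add: B mult_ac)
    also have "\<dots> = p $ i * F w $ i / w $ i" by (simp add: F_def row_avg_def)
    finally show ?thesis .
  qed
  moreover have "p $ i * F w $ i / w $ i / sqrt (p $ i) - sqrt (p $ i) = sqrt (p $ i) * (F w $ i - w $ i) / w $ i" for i
  proof -
    have "p $ i * F w $ i / w $ i / sqrt (p $ i) = p $ i / sqrt (p $ i) * (F w $ i / w $ i)" by simp
    also have "p $ i / sqrt (p $ i) = sqrt (p $ i)" using p0[of i] by (simp add: real_div_sqrt)
    finally show ?thesis using wn[of i] by (simp add: field_simps)
  qed
  ultimately have "vdiv (sinkhorn_matrix A p q d (Suc t) *v 1) (vsqrt p) - vsqrt p = rho w"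
    by (simp add: vec_eq_iff vdiv_def vsqrt_def rho_def)
  thus ?thesis by (simp add: sinkhorn_residual_def w_def)
qed

end

theorem theorem4:
  fixes A Ahat Atilde :: "real ^ 'm::{finite,linorder} ^ 'n::{finite,linorder}"
    and p e1 :: "real ^ 'n::{finite,linorder}" and q e0 :: "real ^ 'm::{finite,linorder}" and lambda :: real
  assumes "2 \<le> CARD('n)" and "2 \<le> CARD('m)"
    and "nonneg_mat A" and "pos_vec p" and "pos_vec q"
    and "(\<Sum>i\<in>UNIV. p $ i) = (\<Sum>j\<in>UNIV. q $ j)"
    and "strong_existence A p q"
    and "indecomposable A"
    and "pos_vec e1" and "pos_vec e0"
    and "Ahat = diag_mat e1 ** A ** diag_mat e0"
    and "has_marginals Ahat p q"
    and "Atilde = normalized_mat Ahat p q"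
    and "lambda = second_eigenvalue (Atilde ** transpose Atilde)"
  shows "lambda = second_eigenvalue (transpose Atilde ** Atilde)
    \<and> (\<forall>d c. pos_vec d \<longrightarrow> lambda < c \<longrightarrow>
         (\<forall>\<^sub>F t in sequentially.
            sinkhorn_residual A p q d (Suc t) \<le> c * sinkhorn_residual A p q d t))
    \<and> (AE d in lborel. pos_vec d \<longrightarrow>
         (\<lambda>t. sinkhorn_residual A p q d (Suc t) / sinkhorn_residual A p q d t)
           \<longlonglongrightarrow> lambda)"
proof -
  have B: "Ahat $ i $ j = e1 $ i * A $ i $ j * e0 $ j" for i j
    by (simp add: assms(11) diag_mat_def matrix_matrix_mult_def if_distrib[of "\<lambda>x. x * _"]
        if_distrib[of "\<lambda>x. _ * x"] cong: if_cong)
  have e: "0 < e1 $ i" "0 < e0 $ j" for i j using assms(9,10) by (auto simp: pos_vec_def)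
  have pq: "0 < p $ i" "0 < q $ j" for i j using assms(4,5) by (auto simp: pos_vec_def)
  have rows: "(\<Sum>j\<in>UNIV. Ahat $ i $ j) = p $ i" for i
    using assms(12) by (auto simp: has_marginals_def matrix_vector_mult_def vec_eq_iff)
  have cols: "(\<Sum>i\<in>UNIV. Ahat $ i $ j) = q $ j" for j
    using assms(12) by (auto simp: has_marginals_def matrix_vector_mult_def vec_eq_iff transpose_def)
  have nz: "Ahat $ i $ j \<noteq> 0 \<longleftrightarrow> A $ i $ j \<noteq> 0" for i j using e(1)[of i] e(2)[of j] by (simp add: B)
  have "\<exists>j. A $ i $ j \<noteq> 0" for i
  proof (rule ccontr)
    assume "\<not> ?thesis"
    hence "p $ i = 0" using rows[of i] by (simp add: B)
    thus False using pq(1)[of i] by simp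
  qed
  moreover have "\<exists>i. A $ i $ j \<noteq> 0" for j
  proof (rule ccontr)
    assume "\<not> ?thesis"
    hence "q $ j = 0" using cols[of j] by (simp add: B)
    thus False using pq(2)[of j] by simp
  qed
  ultimately interpret connected_balanced_matrix Ahat p q
  proof unfold_locales
    show "0 \<le> Ahat $ i $ j" for i j using assms(3) e(1)[of i] e(2)[of j] by (simp add: B nonneg_mat_def)
    show "0 < p $ i" "0 < q $ j" for i j by (fact pq)+
    show "(\<Sum>j\<in>UNIV. Ahat $ i $ j) = p $ i" for i by (rule rows)
    show "(\<Sum>i\<in>UNIV. Ahat $ i $ j) = q $ j" for j by (rule cols)
    show "X = {} \<or> X = UNIV" if "\<And>i j. Ahat $ i $ j \<noteq> 0 \<Longrightarrow> (i \<in> X) = (j \<in> Y)"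
      and "\<And>i. \<exists>j. A $ i $ j \<noteq> 0" "\<And>j. \<exists>i. A $ i $ j \<noteq> 0" for X Y
      using indecomposable_connected[OF assms(8) that(2,3), of X Y] that(1) nz by blast
  qed
  have N: "Atilde = N" by (simp add: assms(13) N_def)
  have lam: "lambda = second_eigenvalue S" by (simp add: assms(14) S_def N)
  have lam0: "0 \<le> lambda" unfolding lam
    by (rule second_eigenvalue_properties(1)[OF assms(1) S_eigen_setup(1) S_sqrt sqrt_nz(1) S_eigen_setup(2,3)])
  have eq: "lambda = second_eigenvalue (transpose Atilde ** Atilde)"
  proof (rule antisym)
    show "lambda \<le> second_eigenvalue (transpose Atilde ** Atilde)" unfolding assms(14) N
      by (rule second_eigenvalue_gram_le[OF assms(1,2) N_sqrt(2,1) sqrt_nz norm_transpose_N_le norm_N_le])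
    show "second_eigenvalue (transpose Atilde ** Atilde) \<le> lambda" unfolding assms(14) N
      using second_eigenvalue_gram_le[OF assms(2,1), of "transpose N" "vsqrt q" "vsqrt p"]
        N_sqrt sqrt_nz norm_transpose_N_le norm_N_le by (simp only: transpose_transpose simp_thms)
  qed
  note res = sinkhorn_residual_eq[OF assms(9,10) B]
  have pv: "pos_vec (row_avg (vdiv d e0))" "pos_vec (vdiv d e0)" if "pos_vec d" for d
    using that e(2) pos_row_avg by (auto simp: pos_vec_def vdiv_def)
  have contr: "\<forall>\<^sub>F t in sequentially. sinkhorn_residual A p q d (Suc t) \<le> c * sinkhorn_residual A p q d t"
    if d: "pos_vec d" and c: "lambda < c" for d c
  proof -
    have "\<forall>\<^sub>F t in sequentially. sinkhorn_residual A p q d (Suc (Suc t)) \<le> c * sinkhorn_residual A p q d (Suc t)"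
      unfolding res[OF d] by (rule rho_contraction[OF assms(1) pv(1)[OF d]]) (use c in \<open>simp add: lam\<close>)
    thus ?thesis by (subst (asm) eventually_sequentially_Suc)
  qed
  have R0: "0 \<le> sinkhorn_residual A p q d t" for d t by (simp add: sinkhorn_residual_def)
  have "AE d in lborel. pos_vec d \<longrightarrow>
         (\<lambda>t. sinkhorn_residual A p q d (Suc t) / sinkhorn_residual A p q d t) \<longlonglongrightarrow> lambda"
  proof (cases "lambda = 0")
    case True
    hence "(\<lambda>t. sinkhorn_residual A p q d (Suc t) / sinkhorn_residual A p q d t) \<longlonglongrightarrow> lambda"
      if "pos_vec d" for d using superlinear_ratio_tendsto_0[OF R0 contr[OF that]] by simp
    thus ?thesis by simp
  next
    case False
    hence "0 < second_eigenvalue S" using lam0 lam by simp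
    from generic_rho_growth[OF assms(1) this] obtain Z where Z: "negligible Z"
      and lo: "\<And>u c. pos_vec u \<Longrightarrow> u \<notin> Z \<Longrightarrow> c < lambda \<Longrightarrow>
    \<forall>\<^sub>F t in sequentially. 0 < norm (rho ((F ^^ t) (row_avg u))) \<and>
      c * norm (rho ((F ^^ t) (row_avg u))) \<le> norm (rho ((F ^^ Suc t) (row_avg u)))"
      unfolding lam by blast
    \<comment> \<open>Returns from the relative coordinates \<open>vdiv d e0\<close> to
      \<open>d\<close>; being linear it maps null sets to null sets.\<close>
    define h where "h u = (\<chi> j. e0 $ j * u $ j)" for u
    have "linear h" by (rule linearI) (simp_all add: h_def vec_eq_iff algebra_simps)
    hence "negligible (h ` Z)"
      by (intro negligible_differentiable_image_negligible Z linear_imp_differentiable_on) auto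
    moreover have "(\<lambda>t. sinkhorn_residual A p q d (Suc t) / sinkhorn_residual A p q d t) \<longlonglongrightarrow> lambda"
      if d: "pos_vec d" "d \<notin> h ` Z" for d
    proof -
      have "h (vdiv d e0) = d" using e(2) by (simp add: h_def vdiv_def vec_eq_iff less_imp_neq[symmetric])
      hence "vdiv d e0 \<notin> Z" using d(2) by (metis image_eqI)
      note lo' = lo[OF pv(2)[OF d(1)] this]
      have "(\<lambda>t. sinkhorn_residual A p q d (Suc (Suc t)) / sinkhorn_residual A p q d (Suc t)) \<longlonglongrightarrow> lambda"
      proof (rule ratio_tendsto[where R = "\<lambda>t. sinkhorn_residual A p q d (Suc t)", OF R0])
        show "\<forall>\<^sub>F t in sequentially. sinkhorn_residual A p q d (Suc (Suc t)) \<le> c * sinkhorn_residual A p q d (Suc t)"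
          if "lambda < c" for c
          using contr[OF d(1) that] by (subst eventually_sequentially_Suc)
        show "\<forall>\<^sub>F t in sequentially. 0 < sinkhorn_residual A p q d (Suc t) \<and>
            c * sinkhorn_residual A p q d (Suc t) \<le> sinkhorn_residual A p q d (Suc (Suc t))" if "c < lambda" for c
          unfolding res[OF d(1)] by (rule lo'[OF that])
      qed
      thus ?thesis by (rule LIMSEQ_imp_Suc)
    qed
    ultimately have "AE d in lebesgue. pos_vec d \<longrightarrow>
         (\<lambda>t. sinkhorn_residual A p q d (Suc t) / sinkhorn_residual A p q d t) \<longlonglongrightarrow> lambda"
      unfolding eventually_ae_filter_negligible by (intro exI[of _ "h ` Z"]) auto
    thus ?thesis by (simp add: AE_completion_iff)
  qed
  with eq contr show ?thesis by blast
qed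

end
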